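(* Let $\Omega,\Omega_1,\Omega_2$ be minimal aperiodic tiling spaces in $\mathbb{R}^d$ with finite local complexity (FLC), let $h_1:\Omega\to\Omega_1$ and $h_2:\Omega\to\Omega_2$ be homeomorphisms, and suppose $[h_1]=[h_2]$ in $\check H^1(\Omega;\mathbb{R}^d)$. Then there exist a quasi-translation $\tau_s:\Omega\to\Omega$ and an MLD equivalence $\phi:\Omega_1\to\Omega_2$ such that $h_2\circ\tau_s=\phi\circ h_1$.
   Context: **Tiling spaces.** A tile is a convex polytope in $\mathbb{R}^d$ with non-empty interior, possibly carrying a label in a compact metric space; the set of prototiles (tiles up to translation) is compact. A tiling is a collection of tiles covering $\mathbb{R}^d$, any two of which meet only along their boundaries. A Delone set is a uniformly discrete and relatively dense subset of $\mathbb{R}^d$, possibly labelled. Tilings and labelled Delone sets are used interchangeably. $\mathbb{R}^d$ acts by translation, $T\mapsto T-x$. The patch $T\cap B(x,R)$ is the set of labelled tiles meeting $B(x,R)$ (for Delone sets: labelled points in $B(x,R)$). Two tilings (Delone sets) are $\varepsilon$-close if on a ball of radius about $1/\varepsilon$ around the origin there is a one-to-one correspondence between their tiles (points), corresponding tiles being $\varepsilon$-close in Hausdorff distance (points being $\varepsilon$-close) with $\varepsilon$-close labels. A tiling space is a compact translation-invariant set of tilings (or labelled Delone sets). It is minimal if every $\mathbb{R}^d$-orbit is dense, aperiodic if $T-x=T$ implies $x=0$ for each of its elements, FLC if for each $R$ there are finitely many patches of radius $R$ up to translation. **Maps.** A quasi-translation is a map $\tau_s:\Omega\to\Omega$ homotopic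 to the identity; equivalently $\tau_s(T)=T-s(T)$ with $s:\Omega\to\mathbb{R}^d$ continuous. A factor map is a continuous onto map $\phi$ with $\phi(T-x)=\phi(T)-x$. A local derivation is a factor map such that for all $r>0$ there is $R>0$ with: $T\cap B(0,R)=T'\cap B(0,R)$ implies $\phi(T)\cap B(0,r)=\phi(T')\cap B(0,r)$. An MLD equivalence is a local derivation that is a homeomorphism whose inverse is a local derivation. **FLC transversals.** The canonical transversal of a space of Delone sets is the set of its elements containing the origin. An FLC transversal of an FLC tiling space $\Omega$ is $\mathcal{D}^{-1}(\Xi')$, where $\mathcal{D}:\Omega\to\Omega_0$ is a local derivation to a space of Delone sets with canonical transversal $\Xi'$. A function on $\Omega$ is transversally locally constant if its restriction to every FLC transversal is locally constant. **Strong cohomology.** For $\Omega$ minimal, aperiodic, FLC, a strong 1-cocycle is a continuous $\alpha:\Omega\times\mathbb{R}^d\to\mathbb{R}^d$ with $\alpha(T,x)+\alpha(T-x,y)=\alpha(T,x+y)$ and with $\alpha(\cdot,v)$ transversally locally constant for each $v$; it is a strong coboundary if $\alpha(T,v)=s(T-v)-s(T)$ with $s:\Omega\to\mathbb{R}^d$ continuous and transversally locally constant. The quotient $H^1_s(\Omega;\mathbb{R}^d)$ is canonically isomorphic to $\check H^1(\Omega;\mathbb{R}^d)$: on an open flow box $U=\{S-x: S\in\Xi, |x|<\varepsilon\}$ ($\Xi$ an FLC transversal) put $c_U(S-x)=\alpha(S,x)$; the differences $c_U-c_V$ on overlaps are locally constant and form the Čech cocycle. The fundamental shape class $[\mathcal{F}(\Omega)]$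 is the class of $\mathcal{F}(T,v)=v$. **Class of a homeomorphism.** For a homeomorphism $h:\Omega\to\Omega'$ of minimal aperiodic FLC tiling spaces, $[h]:=h^*[\mathcal{F}(\Omega')]\in\check H^1(\Omega;\mathbb{R}^d)\cong H^1_s(\Omega;\mathbb{R}^d)$, where $h^*$ is pullback in Čech cohomology. *)

theory Defs
  imports "HOL-Analysis.Analysis"
begin

section \<open>Tilings and labelled Delone sets\<close>

text \<open>
  A labelled point \<open>(x, l)\<close> is encoded as \<open>({x}, l)\<close>, so that tilings and labelled Delone sets are
  both sets of labelled subsets of the ambient Euclidean space. Translation, patches, Hausdorff
  distance (which is the usual distance on singletons) and finite local complexity are then given
  by one formula for both kinds of objects.
\<close>

type_synonym ('a, 'l) pattern = "('a set \<times> 'l) set"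

definition shift_piece :: "'a::euclidean_space \<Rightarrow> 'a set \<times> 'l \<Rightarrow> 'a set \<times> 'l" where
  "shift_piece x t = ((\<lambda>y. y - x) ` fst t, snd t)"

definition translate :: "('a::euclidean_space, 'l) pattern \<Rightarrow> 'a \<Rightarrow> ('a, 'l) pattern"
    (infixl "\<ominus>" 65) where
  "T \<ominus> x = shift_piece x ` T"

definition patch :: "('a::euclidean_space, 'l) pattern \<Rightarrow> 'a \<Rightarrow> real \<Rightarrow> ('a, 'l) pattern" where
  "patch T x R = {t \<in> T. fst t \<inter> ball x R \<noteq> {}}"

definition hausdorff_distance :: "'a::metric_space set \<Rightarrow> 'a set \<Rightarrow> real" where
  "hausdorff_distance A B = max (SUP a\<in>A. infdist a B) (SUP b\<in>B. infdist b A)"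

definition piece_dist ::
    "'a::euclidean_space set \<times> 'l::metric_space \<Rightarrow> 'a set \<times> 'l \<Rightarrow> real" where
  "piece_dist t t' = max (hausdorff_distance (fst t) (fst t')) (dist (snd t) (snd t'))"

definition tile :: "'a::euclidean_space set \<times> 'l \<Rightarrow> bool" where
  "tile t \<longleftrightarrow> polytope (fst t) \<and> interior (fst t) \<noteq> {}"

lemma Metric_space_tile:
  "Metric_space (Collect tile) (piece_dist :: 'a::euclidean_space set \<times> 'l::metric_space \<Rightarrow> _)"
proof -
  have le_iff: "hausdorff_distance A B \<le> e \<longleftrightarrow>
      (\<forall>a\<in>A. infdist a B \<le> e) \<and> (\<forall>b\<in>B. infdist b A \<le> e)"
    if "compact A" "compact B" "A \<noteq> {}" "B \<noteq> {}" for A B :: "'a set" and e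
  proof -
    have bdd: "bdd_above ((\<lambda>a. infdist a B) ` A)" if "compact A" for A B :: "'a set"
      using that
      by (intro bounded_imp_bdd_above compact_imp_bounded compact_continuous_image)
        (auto intro: continuous_intros)
    show ?thesis
      using that bdd[of A B] bdd[of B A] by (simp add: hausdorff_distance_def cSUP_le_iff)
  qed
  have comp: "compact (fst t)" "fst t \<noteq> {}" if "tile t" for t :: "'a set \<times> 'l"
    using that by (auto simp: tile_def polytope_imp_compact)
  have infd: "infdist a B \<le> hausdorff_distance A B" "infdist b A \<le> hausdorff_distance A B"
    if "compact A" "compact B" "a \<in> A" "b \<in> B" for A B :: "'a set" and a b
    using le_iff[OF that(1,2), of "hausdorff_distance A B"] that(3,4) by auto
  have nonneg: "0 \<le> hausdorff_distance A B"
    if "compact A" "compact B" "A \<noteq> {}" "B \<noteq> {}" for A B :: "'a set"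
  proof -
    obtain a b where "a \<in> A" "b \<in> B" using \<open>A \<noteq> {}\<close> \<open>B \<noteq> {}\<close> by blast
    then show ?thesis using infd(1)[OF that(1,2)] infdist_nonneg[of a B] by force
  qed
  have zero: "hausdorff_distance A B = 0 \<longleftrightarrow> A = B"
    if "compact A" "compact B" "A \<noteq> {}" "B \<noteq> {}" for A B :: "'a set"
  proof
    assume "hausdorff_distance A B = 0"
    then have le: "\<forall>a\<in>A. infdist a B \<le> 0" "\<forall>b\<in>B. infdist b A \<le> 0"
      using le_iff[OF that, of 0] by simp_all
    have "a \<in> B" if "a \<in> A" for a
      using le(1) that infdist_nonneg[of a B] in_closed_iff_infdist_zero[of B a]
        compact_imp_closed[OF \<open>compact B\<close>] \<open>B \<noteq> {}\<close> by force
    moreover have "b \<in> A" if "b \<in> B" for b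
      using le(2) that infdist_nonneg[of b A] in_closed_iff_infdist_zero[of A b]
        compact_imp_closed[OF \<open>compact A\<close>] \<open>A \<noteq> {}\<close> by force
    ultimately show "A = B" by blast
  next
    assume "A = B"
    then show "hausdorff_distance A B = 0"
      using le_iff[OF that, of 0] nonneg[OF that] by auto
  qed
  have tri1: "infdist a C \<le> hausdorff_distance A B + hausdorff_distance B C"
    if "compact A" "compact B" "compact C" "B \<noteq> {}" "C \<noteq> {}" "a \<in> A" for A B C :: "'a set" and a
  proof -
    obtain b where b: "b \<in> B" "infdist a B = dist a b"
      using infdist_attains_inf[of B a] compact_imp_closed \<open>compact B\<close> \<open>B \<noteq> {}\<close> by metis
    obtain c where "c \<in> C" using \<open>C \<noteq> {}\<close> by blast
    then have infd_b: "infdist b C \<le> hausdorff_distance B C"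
      by (intro infd(1)[OF \<open>compact B\<close> \<open>compact C\<close> b(1)])
    have infd_a: "infdist a B \<le> hausdorff_distance A B"
      by (intro infd(1)[OF \<open>compact A\<close> \<open>compact B\<close> \<open>a \<in> A\<close> b(1)])
    have "infdist a C \<le> infdist b C + dist a b" by (rule infdist_triangle)
    also have "\<dots> \<le> hausdorff_distance B C + hausdorff_distance A B"
      using b infd_a infd_b by linarith
    finally show ?thesis by simp
  qed
  have comm: "hausdorff_distance A B = hausdorff_distance B A" for A B :: "'a set"
    by (simp add: hausdorff_distance_def max.commute)
  have tri: "hausdorff_distance A C \<le> hausdorff_distance A B + hausdorff_distance B C"
    if "compact A" "compact B" "compact C" "A \<noteq> {}" "B \<noteq> {}" "C \<noteq> {}" for A B C :: "'a set"
  proof -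
    have "\<forall>a\<in>A. infdist a C \<le> hausdorff_distance A B + hausdorff_distance B C"
      using tri1[OF that(1,2,3,5,6)] by blast
    moreover have "\<forall>c\<in>C. infdist c A \<le> hausdorff_distance A B + hausdorff_distance B C"
      using tri1[OF that(3,2,1,5,4)] comm[of A B] comm[of B C] by (simp add: add.commute)
    ultimately show ?thesis using le_iff[OF that(1,3,4,6)] by blast
  qed
  show ?thesis
  proof
    show "0 \<le> piece_dist t t'" for t t' :: "'a set \<times> 'l"
      by (simp add: piece_dist_def le_max_iff_disj)
    show "piece_dist t t' = piece_dist t' t" for t t' :: "'a set \<times> 'l"
      by (simp add: piece_dist_def comm dist_commute)
    show "piece_dist t t' = 0 \<longleftrightarrow> t = t'" if "t \<in> Collect tile" "t' \<in> Collect tile" for t t' :: "'a set \<times> 'l"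
    proof -
      have "piece_dist t t' = 0 \<longleftrightarrow> hausdorff_distance (fst t) (fst t') = 0 \<and> snd t = snd t'"
      proof -
        have "0 \<le> hausdorff_distance (fst t) (fst t')"
          by (rule nonneg) (use comp that in simp_all)
        then have "piece_dist t t' = 0 \<longleftrightarrow>
            hausdorff_distance (fst t) (fst t') = 0 \<and> dist (snd t) (snd t') = 0"
          unfolding piece_dist_def using zero_le_dist[of "snd t" "snd t'"] by linarith
        then show ?thesis by simp
      qed
      moreover have "hausdorff_distance (fst t) (fst t') = 0 \<longleftrightarrow> fst t = fst t'"
        by (rule zero) (use comp that in simp_all)
      ultimately show ?thesis by (simp add: prod_eq_iff)
    qed
    show "piece_dist t t'' \<le> piece_dist t t' + piece_dist t' t''"
      if "t \<in> Collect tile" "t' \<in> Collect tile" "t'' \<in> Collect tile" for t t' t'' :: "'a set \<times> 'l"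
    proof -
      have "hausdorff_distance (fst t) (fst t'') \<le>
          hausdorff_distance (fst t) (fst t') + hausdorff_distance (fst t') (fst t'')"
        by (rule tri) (use comp that in simp_all)
      then show ?thesis
        using dist_triangle[of "snd t" "snd t''" "snd t'"] unfolding piece_dist_def by linarith
    qed
  qed
qed

definition tiling :: "('a::euclidean_space, 'l) pattern \<Rightarrow> bool" where
  "tiling T \<longleftrightarrow>
     (\<forall>t\<in>T. tile t) \<and>
     (\<Union>t\<in>T. fst t) = UNIV \<and>
     pairwise (\<lambda>t t'. fst t \<inter> fst t' \<subseteq> frontier (fst t) \<inter> frontier (fst t')) T"

definition delone :: "('a::euclidean_space, 'l) pattern \<Rightarrow> bool" where
  "delone T \<longleftrightarrow>
     (\<forall>t\<in>T. \<exists>x. fst t = {x}) \<and>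
     (\<exists>r>0. \<forall>x l y m. ({x}, l) \<in> T \<and> ({y}, m) \<in> T \<and> ({x}, l) \<noteq> ({y}, m) \<longrightarrow> r \<le> dist x y) \<and>
     (\<exists>R>0. \<forall>y. \<exists>x l. ({x}, l) \<in> T \<and> dist x y \<le> R)"

text \<open>
  The radius ``about'' \<open>1/\<epsilon>\<close>: the matched subcollections \<open>A\<close>, \<open>A'\<close> must contain everything meeting
  the ball of radius \<open>1/\<epsilon>\<close>, but a piece meeting this ball may be matched with one just outside it.
\<close>

definition close ::
    "real \<Rightarrow> ('a::euclidean_space, 'l::metric_space) pattern \<Rightarrow> ('a, 'l) pattern \<Rightarrow> bool" where
  "close \<epsilon> T T' \<longleftrightarrow>
     (\<exists>A A' f. patch T 0 (1/\<epsilon>) \<subseteq> A \<and> A \<subseteq> T \<and> patch T' 0 (1/\<epsilon>) \<subseteq> A' \<and> A' \<subseteq> T' \<and>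
        bij_betw f A A' \<and> (\<forall>t\<in>A. piece_dist t (f t) < \<epsilon>))"

definition pattern_topology ::
    "('a::euclidean_space, 'l::metric_space) pattern set \<Rightarrow> ('a, 'l) pattern topology" where
  "pattern_topology \<Omega> =
     topology (\<lambda>U. U \<subseteq> \<Omega> \<and> (\<forall>T\<in>U. \<exists>\<epsilon>>0. \<forall>T'\<in>\<Omega>. close \<epsilon> T T' \<longrightarrow> T' \<in> U))"

lemma close_mono:
  assumes "close \<delta> T T'" "0 < \<delta>" "\<delta> \<le> \<epsilon>"
  shows "close \<epsilon> T T'"
proof -
  have "1/\<epsilon> \<le> 1/\<delta>" using assms by (simp add: frac_le)
  then have *: "patch S 0 (1/\<epsilon>) \<subseteq> patch S 0 (1/\<delta>)" for S :: "('a, 'b) pattern"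
    unfolding patch_def using subset_ball[of "1/\<epsilon>" "1/\<delta>" 0] by blast
  obtain A A' f where A: "patch T 0 (1/\<delta>) \<subseteq> A" "A \<subseteq> T" "patch T' 0 (1/\<delta>) \<subseteq> A'" "A' \<subseteq> T'"
      "bij_betw f A A'" and f: "\<forall>t\<in>A. piece_dist t (f t) < \<delta>"
    using assms(1) unfolding close_def by blast
  have "\<forall>t\<in>A. piece_dist t (f t) < \<epsilon>"
    using f assms(3) by (meson less_le_trans)
  moreover have "patch T 0 (1/\<epsilon>) \<subseteq> A" "patch T' 0 (1/\<epsilon>) \<subseteq> A'"
    using A *[of T] *[of T'] by blast+
  ultimately show ?thesis
    unfolding close_def using A by blast
qed

lemma openin_pattern_topology:
  "openin (pattern_topology \<Omega>) U \<longleftrightarrow>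
     U \<subseteq> \<Omega> \<and> (\<forall>T\<in>U. \<exists>\<epsilon>>0. \<forall>T'\<in>\<Omega>. close \<epsilon> T T' \<longrightarrow> T' \<in> U)"
proof -
  let ?P = "\<lambda>U. U \<subseteq> \<Omega> \<and> (\<forall>T\<in>U. \<exists>\<epsilon>>0. \<forall>T'\<in>\<Omega>. close \<epsilon> T T' \<longrightarrow> T' \<in> U)"
  have "istopology ?P"
    unfolding istopology_def
  proof (intro conjI allI impI)
    fix S U assume S: "?P S" and U: "?P U"
    show "S \<inter> U \<subseteq> \<Omega>" using S by blast
    show "\<forall>T\<in>S \<inter> U. \<exists>\<epsilon>>0. \<forall>T'\<in>\<Omega>. close \<epsilon> T T' \<longrightarrow> T' \<in> S \<inter> U"
    proof
      fix T assume "T \<in> S \<inter> U"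
      then obtain d e where d: "d > 0" "\<forall>T'\<in>\<Omega>. close d T T' \<longrightarrow> T' \<in> S"
        and e: "e > 0" "\<forall>T'\<in>\<Omega>. close e T T' \<longrightarrow> T' \<in> U"
        using S U by blast
      have "close d T T' \<and> close e T T'" if "close (min d e) T T'" for T'
        using that d(1) e(1) close_mono[of "min d e" T T' d] close_mono[of "min d e" T T' e] by simp
      then show "\<exists>\<epsilon>>0. \<forall>T'\<in>\<Omega>. close \<epsilon> T T' \<longrightarrow> T' \<in> S \<inter> U"
        using d e by (intro exI[of _ "min d e"]) auto
    qed
  next
    fix K assume K: "\<forall>S\<in>K. ?P S"
    show "\<Union>K \<subseteq> \<Omega>" using K by blast
    show "\<forall>T\<in>\<Union>K. \<exists>\<epsilon>>0. \<forall>T'\<in>\<Omega>. close \<epsilon> T T' \<longrightarrow> T' \<in> \<Union>K"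
    proof
      fix T assume "T \<in> \<Union>K"
      then obtain S where "S \<in> K" "T \<in> S" by blast
      moreover from this K obtain \<epsilon> where "\<epsilon> > 0" "\<forall>T'\<in>\<Omega>. close \<epsilon> T T' \<longrightarrow> T' \<in> S" by blast
      ultimately show "\<exists>\<epsilon>>0. \<forall>T'\<in>\<Omega>. close \<epsilon> T T' \<longrightarrow> T' \<in> \<Union>K" by blast
    qed
  qed
  then show ?thesis
    unfolding pattern_topology_def by (simp add: topology_inverse')
qed

lemma topspace_pattern_topology [simp]: "topspace (pattern_topology \<Omega>) = \<Omega>"
proof
  show "topspace (pattern_topology \<Omega>) \<subseteq> \<Omega>"
    using openin_pattern_topology[of \<Omega> "topspace (pattern_topology \<Omega>)"] by simp
  have "openin (pattern_topology \<Omega>) \<Omega>"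
    unfolding openin_pattern_topology using zero_less_one by blast
  then show "\<Omega> \<subseteq> topspace (pattern_topology \<Omega>)"
    by (rule openin_subset)
qed

text \<open>
  The tiles come, up to translation, from a set of prototiles that is compact for the Hausdorff
  distance of the supports and the distance of the labels.
\<close>

definition space_of_tilings ::
    "('a::euclidean_space, 'l::metric_space) pattern set \<Rightarrow> bool" where
  "space_of_tilings \<Omega> \<longleftrightarrow>
     (\<forall>T\<in>\<Omega>. tiling T) \<and>
     (\<exists>P. compactin (Metric_space.mtopology (Collect tile) piece_dist) P \<and>
        (\<forall>T\<in>\<Omega>. \<forall>t\<in>T. \<exists>p\<in>P. \<exists>x. t = shift_piece x p)) \<and>
     (\<forall>T\<in>\<Omega>. \<forall>x. T \<ominus> x \<in> \<Omega>) \<and>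
     compact_space (pattern_topology \<Omega>)"

definition space_of_delone_sets ::
    "('a::euclidean_space, 'l::metric_space) pattern set \<Rightarrow> bool" where
  "space_of_delone_sets \<Omega> \<longleftrightarrow>
     (\<forall>T\<in>\<Omega>. delone T) \<and>
     (\<exists>K. compact K \<and> (\<forall>T\<in>\<Omega>. snd ` T \<subseteq> K)) \<and>
     (\<forall>T\<in>\<Omega>. \<forall>x. T \<ominus> x \<in> \<Omega>) \<and>
     compact_space (pattern_topology \<Omega>)"

definition tiling_space :: "('a::euclidean_space, 'l::metric_space) pattern set \<Rightarrow> bool" where
  "tiling_space \<Omega> \<longleftrightarrow> space_of_tilings \<Omega> \<or> space_of_delone_sets \<Omega>"

definition minimal_space :: "('a::euclidean_space, 'l::metric_space) pattern set \<Rightarrow> bool" where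
  "minimal_space \<Omega> \<longleftrightarrow> (\<forall>T\<in>\<Omega>. pattern_topology \<Omega> closure_of (range (\<lambda>x. T \<ominus> x)) = \<Omega>)"

definition aperiodic_space :: "('a::euclidean_space, 'l) pattern set \<Rightarrow> bool" where
  "aperiodic_space \<Omega> \<longleftrightarrow> (\<forall>T\<in>\<Omega>. \<forall>x. T \<ominus> x = T \<longrightarrow> x = 0)"

definition FLC :: "('a::euclidean_space, 'l) pattern set \<Rightarrow> bool" where
  "FLC \<Omega> \<longleftrightarrow>
     (\<forall>R>0. \<exists>F. finite F \<and> (\<forall>T\<in>\<Omega>. \<forall>x. \<exists>P\<in>F. \<exists>y. patch T x R = P \<ominus> y))"

section \<open>Maps between tiling spaces\<close>

definition quasi_translation ::
    "('a::euclidean_space, 'l::metric_space) pattern set \<Rightarrow>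
     (('a, 'l) pattern \<Rightarrow> ('a, 'l) pattern) \<Rightarrow> bool" where
  "quasi_translation \<Omega> \<tau> \<longleftrightarrow>
     homotopic_with (\<lambda>_. True) (pattern_topology \<Omega>) (pattern_topology \<Omega>) \<tau> id"

definition factor_map ::
    "('a::euclidean_space, 'l::metric_space) pattern set \<Rightarrow> ('a, 'm::metric_space) pattern set \<Rightarrow>
     (('a, 'l) pattern \<Rightarrow> ('a, 'm) pattern) \<Rightarrow> bool" where
  "factor_map \<Omega> \<Omega>' \<phi> \<longleftrightarrow>
     continuous_map (pattern_topology \<Omega>) (pattern_topology \<Omega>') \<phi> \<and>
     \<phi> ` \<Omega> = \<Omega>' \<and>
     (\<forall>T\<in>\<Omega>. \<forall>x. \<phi> (T \<ominus> x) = \<phi> T \<ominus> x)"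

definition local_derivation ::
    "('a::euclidean_space, 'l::metric_space) pattern set \<Rightarrow> ('a, 'm::metric_space) pattern set \<Rightarrow>
     (('a, 'l) pattern \<Rightarrow> ('a, 'm) pattern) \<Rightarrow> bool" where
  "local_derivation \<Omega> \<Omega>' \<phi> \<longleftrightarrow>
     factor_map \<Omega> \<Omega>' \<phi> \<and>
     (\<forall>r>0. \<exists>R>0. \<forall>T\<in>\<Omega>. \<forall>T'\<in>\<Omega>.
        patch T 0 R = patch T' 0 R \<longrightarrow> patch (\<phi> T) 0 r = patch (\<phi> T') 0 r)"

definition MLD_equivalence ::
    "('a::euclidean_space, 'l::metric_space) pattern set \<Rightarrow> ('a, 'm::metric_space) pattern set \<Rightarrow>
     (('a, 'l) pattern \<Rightarrow> ('a, 'm) pattern) \<Rightarrow> bool" where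
  "MLD_equivalence \<Omega> \<Omega>' \<phi> \<longleftrightarrow>
     local_derivation \<Omega> \<Omega>' \<phi> \<and>
     (\<exists>\<psi>. homeomorphic_maps (pattern_topology \<Omega>) (pattern_topology \<Omega>') \<phi> \<psi> \<and>
        local_derivation \<Omega>' \<Omega> \<psi>)"

section \<open>FLC transversals and strong cocycles\<close>

definition canonical_transversal ::
    "('a::euclidean_space, 'l) pattern set \<Rightarrow> ('a, 'l) pattern set" where
  "canonical_transversal \<Omega> = {T \<in> \<Omega>. \<exists>l. ({0}, l) \<in> T}"

text \<open>
  The label type \<open>real\<close> is no restriction: the canonical transversal does not depend on the labels,
  and forgetting them (replacing each by \<open>0\<close>) is a local derivation between spaces of Delone sets.
\<close>

definition FLC_transversal ::
    "('a::euclidean_space, 'l::metric_space) pattern set \<Rightarrow> ('a, 'l) pattern set \<Rightarrow> bool" where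
  "FLC_transversal \<Omega> \<Xi> \<longleftrightarrow>
     (\<exists>(\<Omega>\<^sub>0 :: ('a, real) pattern set) \<D>.
        space_of_delone_sets \<Omega>\<^sub>0 \<and> local_derivation \<Omega> \<Omega>\<^sub>0 \<D> \<and>
        \<Xi> = {T \<in> \<Omega>. \<D> T \<in> canonical_transversal \<Omega>\<^sub>0})"

definition locally_constant_on :: "'x topology \<Rightarrow> 'x set \<Rightarrow> ('x \<Rightarrow> 'b) \<Rightarrow> bool" where
  "locally_constant_on X S f \<longleftrightarrow>
     continuous_map (subtopology X S) (discrete_topology UNIV) f"

definition transversally_locally_constant ::
    "('a::euclidean_space, 'l::metric_space) pattern set \<Rightarrow> (('a, 'l) pattern \<Rightarrow> 'b) \<Rightarrow> bool" where
  "transversally_locally_constant \<Omega> f \<longleftrightarrow>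
     (\<forall>\<Xi>. FLC_transversal \<Omega> \<Xi> \<longrightarrow> locally_constant_on (pattern_topology \<Omega>) \<Xi> f)"

definition strong_cocycle ::
    "('a::euclidean_space, 'l::metric_space) pattern set \<Rightarrow>
     (('a, 'l) pattern \<Rightarrow> 'a \<Rightarrow> 'a) \<Rightarrow> bool" where
  "strong_cocycle \<Omega> \<alpha> \<longleftrightarrow>
     continuous_map (prod_topology (pattern_topology \<Omega>) euclidean) euclidean (\<lambda>(T, x). \<alpha> T x) \<and>
     (\<forall>T\<in>\<Omega>. \<forall>x y. \<alpha> T x + \<alpha> (T \<ominus> x) y = \<alpha> T (x + y)) \<and>
     (\<forall>v. transversally_locally_constant \<Omega> (\<lambda>T. \<alpha> T v))"

definition shape_cocycle :: "('a::euclidean_space, 'l) pattern \<Rightarrow> 'a \<Rightarrow> 'a" where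
  "shape_cocycle T v = v"

lemma strong_cocycle_shape_cocycle: "strong_cocycle \<Omega> shape_cocycle"
proof -
  have "(\<lambda>(T, x). shape_cocycle T x) = (snd :: ('a, 'b) pattern \<times> 'a \<Rightarrow> 'a)"
    by (auto simp: shape_cocycle_def)
  then show ?thesis
    by (simp add: strong_cocycle_def transversally_locally_constant_def locally_constant_on_def
        shape_cocycle_def continuous_map_snd)
qed

section \<open>First Cech cohomology with locally constant coefficients\<close>

text \<open>
  \<open>(I, U, g)\<close> stands for the open cover \<open>U i\<close>, \<open>i \<in> I\<close>, and the cochain whose value on the overlap
  of \<open>U i\<close> and \<open>U j\<close> is the function \<open>g i j\<close>, relevant on that overlap only.
\<close>

type_synonym ('i, 'x, 'b) cech_cochain = "'i set \<times> ('i \<Rightarrow> 'x set) \<times> ('i \<Rightarrow> 'i \<Rightarrow> 'x \<Rightarrow> 'b)"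

fun cech_cocycle :: "'x topology \<Rightarrow> ('i, 'x, 'b::ab_group_add) cech_cochain \<Rightarrow> bool" where
  "cech_cocycle X (I, U, g) \<longleftrightarrow>
     (\<forall>i\<in>I. openin X (U i)) \<and> (\<Union>i\<in>I. U i) = topspace X \<and>
     (\<forall>i\<in>I. \<forall>j\<in>I. locally_constant_on X (U i \<inter> U j) (g i j)) \<and>
     (\<forall>i\<in>I. \<forall>j\<in>I. \<forall>k\<in>I. \<forall>x \<in> U i \<inter> U j \<inter> U k. g i j x + g j k x = g i k x)"

text \<open>
  Equality in the direct limit over all open covers: on a common refinement \<open>\<W>\<close> with refinement
  maps \<open>\<rho>\<close>, \<open>\<sigma>\<close> the two cocycles differ by the coboundary of a locally constant 0-cochain \<open>b\<close>. A
  refinement indexed by itself suffices, as every indexed refinement contains one.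
\<close>

fun cech_cohomologous ::
    "'x topology \<Rightarrow> ('i, 'x, 'b::ab_group_add) cech_cochain \<Rightarrow> ('j, 'x, 'b) cech_cochain \<Rightarrow> bool" where
  "cech_cohomologous X (I, U, g) (J, V, g') \<longleftrightarrow>
     cech_cocycle X (I, U, g) \<and> cech_cocycle X (J, V, g') \<and>
     (\<exists>(\<W> :: 'x set set) \<rho> \<sigma> (b :: 'x set \<Rightarrow> 'x \<Rightarrow> 'b).
        (\<forall>W\<in>\<W>. openin X W) \<and> \<Union>\<W> = topspace X \<and>
        (\<forall>W\<in>\<W>. \<rho> W \<in> I \<and> W \<subseteq> U (\<rho> W) \<and> \<sigma> W \<in> J \<and> W \<subseteq> V (\<sigma> W)) \<and>
        (\<forall>W\<in>\<W>. locally_constant_on X W (b W)) \<and>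
        (\<forall>W\<in>\<W>. \<forall>W'\<in>\<W>. \<forall>x \<in> W \<inter> W'.
           g (\<rho> W) (\<rho> W') x - g' (\<sigma> W) (\<sigma> W') x = b W x - b W' x))"

text \<open>
  Elements of the first Cech cohomology group are represented as equivalence classes of cocycles on
  covers indexed by subsets of the space; every cocycle is cohomologous to such a one.
\<close>

type_synonym ('x, 'b) cech_class = "('x set, 'x, 'b) cech_cochain set"

definition cech_class ::
    "'x topology \<Rightarrow> ('i, 'x, 'b::ab_group_add) cech_cochain \<Rightarrow> ('x, 'b) cech_class" where
  "cech_class X c = {c'. cech_cohomologous X c c'}"

fun cech_pullback_cochain ::
    "'x topology \<Rightarrow> ('x \<Rightarrow> 'y) \<Rightarrow> ('i, 'y, 'b) cech_cochain \<Rightarrow> ('i, 'x, 'b) cech_cochain" where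
  "cech_pullback_cochain X h (I, U, g) =
     (I, \<lambda>i. {x \<in> topspace X. h x \<in> U i}, \<lambda>i j x. g i j (h x))"

definition cech_pullback ::
    "'x topology \<Rightarrow> ('x \<Rightarrow> 'y) \<Rightarrow> ('y, 'b::ab_group_add) cech_class \<Rightarrow> ('x, 'b) cech_class" where
  "cech_pullback X h C = (\<Union>c\<in>C. cech_class X (cech_pullback_cochain X h c))"

section \<open>The class of a homeomorphism\<close>

definition flow_box ::
    "('a::euclidean_space, 'l) pattern set \<times> real \<Rightarrow> ('a, 'l) pattern set" where
  "flow_box = (\<lambda>(\<Xi>, \<epsilon>). (\<lambda>(S, x). S \<ominus> x) ` (\<Xi> \<times> ball 0 \<epsilon>))"

text \<open>Injectivity expresses that the box is a product, so that \<open>c\<^sub>U\<close> below is well defined.\<close>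

definition flow_boxes ::
    "('a::euclidean_space, 'l::metric_space) pattern set \<Rightarrow> (('a, 'l) pattern set \<times> real) set" where
  "flow_boxes \<Omega> =
     {(\<Xi>, \<epsilon>). FLC_transversal \<Omega> \<Xi> \<and> \<epsilon> > 0 \<and>
        inj_on (\<lambda>(S, x). S \<ominus> x) (\<Xi> \<times> ball 0 \<epsilon>) \<and>
        openin (pattern_topology \<Omega>) (flow_box (\<Xi>, \<epsilon>))}"

text \<open>The function \<open>c\<^sub>U\<close> with \<open>c\<^sub>U (S \<ominus> x) = \<alpha> S x\<close> for \<open>S \<in> \<Xi>\<close>, \<open>norm x < \<epsilon>\<close>.\<close>

definition flow_box_function ::
    "(('a::euclidean_space, 'l) pattern \<Rightarrow> 'a \<Rightarrow> 'a) \<Rightarrow> ('a, 'l) pattern set \<times> real \<Rightarrow>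
     ('a, 'l) pattern \<Rightarrow> 'a" where
  "flow_box_function \<alpha> = (\<lambda>(\<Xi>, \<epsilon>) T.
     case the_inv_into (\<Xi> \<times> ball 0 \<epsilon>) (\<lambda>(S, x). S \<ominus> x) T of (S, x) \<Rightarrow> \<alpha> S x)"

definition cech_cochain_of_strong ::
    "('a::euclidean_space, 'l::metric_space) pattern set \<Rightarrow> (('a, 'l) pattern \<Rightarrow> 'a \<Rightarrow> 'a) \<Rightarrow>
     (('a, 'l) pattern set \<times> real, ('a, 'l) pattern, 'a) cech_cochain" where
  "cech_cochain_of_strong \<Omega> \<alpha> =
     (flow_boxes \<Omega>, flow_box,
      \<lambda>u v T. flow_box_function \<alpha> u T - flow_box_function \<alpha> v T)"

definition shape_class ::
    "('a::euclidean_space, 'l::metric_space) pattern set \<Rightarrow> (('a, 'l) pattern, 'a) cech_class" where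
  "shape_class \<Omega> = cech_class (pattern_topology \<Omega>) (cech_cochain_of_strong \<Omega> shape_cocycle)"

definition homeo_class ::
    "('a::euclidean_space, 'l::metric_space) pattern set \<Rightarrow> ('a, 'm::metric_space) pattern set \<Rightarrow>
     (('a, 'l) pattern \<Rightarrow> ('a, 'm) pattern) \<Rightarrow> (('a, 'l) pattern, 'a) cech_class" where
  "homeo_class \<Omega> \<Omega>' h = cech_pullback (pattern_topology \<Omega>) h (shape_class \<Omega>')"

end

theory Submission
  imports Defs
begin

text \<open>
  In a space of finite local complexity a pattern close to \<open>T\<close> has, after a small shift, exactly the
  same patch around the origin as \<open>T\<close> (\<open>close_imp_agree\<close>), and this shift, its displacement from \<open>T\<close>,
  is unique (\<open>rigid\<close>). The coordinate in the ball factor of a flow box changes precisely by the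
  displacement (\<open>flow_box_function_displacement\<close>). The shape class therefore encodes displacements:
  if \<open>h\<^sub>1\<close> and \<open>h\<^sub>2\<close> have the same class, then there is a continuous function \<open>s\<close> on \<open>\<Omega>\<close> such that,
  when \<open>T\<close> varies slightly, the displacements of \<open>h\<^sub>1 T\<close> and of \<open>h\<^sub>2 T\<close> differ by the variation of \<open>s\<close>
  (\<open>common_displacement\<close>). To see this, the coordinate functions are regarded as a 0-cochain whose
  coboundary is the cocycle of the class; such a 0-cochain can be carried along to any cohomologous
  cocycle without changing its local variation (\<open>splitting_transport\<close>), and two of them with the same
  coboundary differ by a global function.

  Put \<open>k T = h\<^sub>2 T \<ominus> s T\<close>. Now \<open>h\<^sub>1 T\<close> and \<open>k T\<close> always move by the same displacement, so
  \<open>\<phi> = k \<circ> h\<^sub>1\<^sup>-\<^sup>1\<close> preserves displacements. Such a map commutes with small translations, up to patches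
  of any given radius, hence with all translations (\<open>equivariant\<close>), and by compactness it is local
  (\<open>uniformly_local\<close>). It is onto by minimality. The condition is symmetric, so once \<open>\<phi>\<close> is injective
  it is an MLD equivalence.

  It remains to write \<open>k\<close> as \<open>h\<^sub>2 \<circ> \<tau>\<close> with a quasi-translation \<open>\<tau>\<close>, that is, to follow the path
  \<open>h\<^sub>2 T \<ominus> t s T\<close>, \<open>0 \<le> t \<le> 1\<close>, through the inverse of \<open>h\<^sub>2\<close>. A continuous map sends orbits into orbits,
  because patches, once displacements are removed, are locally constant along a ball in an orbit
  (\<open>small_lift\<close>). The path thus lifts to translations of \<open>T\<close> by vectors depending continuously on \<open>T\<close>
  (\<open>continuous_lift\<close>). Injectivity of \<open>\<phi>\<close> follows: two points with the same image lie on one orbit,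
  and there equivariance and aperiodicity separate them.
\<close>

section \<open>Translation and agreement of patterns\<close>

lemma shift_piece_0 [simp]: "shift_piece 0 t = t"
  by (simp add: shift_piece_def)

lemma shift_piece_add [simp]: "shift_piece x (shift_piece y t) = shift_piece (y + x) t"
  by (auto simp: shift_piece_def image_image algebra_simps)

lemma fst_shift_piece [simp]: "fst (shift_piece x t) = (\<lambda>y. y - x) ` fst t"
  and snd_shift_piece [simp]: "snd (shift_piece x t) = snd t"
  by (simp_all add: shift_piece_def)

lemma translate_0 [simp]: "T \<ominus> 0 = T"
  by (simp add: translate_def)

lemma translate_add [simp]: "T \<ominus> x \<ominus> y = T \<ominus> (x + y)"
  by (auto simp: translate_def image_image)

lemma mem_translate: "t \<in> T \<ominus> x \<longleftrightarrow> shift_piece (- x) t \<in> T"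
proof
  assume "shift_piece (- x) t \<in> T"
  then have "shift_piece x (shift_piece (- x) t) \<in> T \<ominus> x"
    unfolding translate_def by blast
  then show "t \<in> T \<ominus> x" by simp
qed (auto simp: translate_def)

lemma translate_eq_iff: "T \<ominus> x = S \<longleftrightarrow> T = S \<ominus> (- x)"
proof
  show "T = S \<ominus> (- x)" if "T \<ominus> x = S" using that[symmetric] by simp
  show "T \<ominus> x = S" if "T = S \<ominus> (- x)" using that by simp
qed

lemma mem_patch: "t \<in> patch T x R \<longleftrightarrow> t \<in> T \<and> (\<exists>a\<in>fst t. dist x a < R)"
  by (auto simp: patch_def ball_def)

lemma mem_patch_0: "t \<in> patch T 0 R \<longleftrightarrow> t \<in> T \<and> (\<exists>a\<in>fst t. norm a < R)"
  by (simp add: mem_patch)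

lemma mem_patch_0I: "t \<in> T \<Longrightarrow> a \<in> fst t \<Longrightarrow> norm a < R \<Longrightarrow> t \<in> patch T 0 R"
  by (auto simp: mem_patch_0)

lemma patch_mono: "R \<le> R' \<Longrightarrow> patch T x R \<subseteq> patch T x R'"
  by (force simp: mem_patch)

definition agree :: "real \<Rightarrow> ('a::euclidean_space, 'l) pattern \<Rightarrow> ('a, 'l) pattern \<Rightarrow> bool" where
  "agree R T T' \<longleftrightarrow> patch T 0 R = patch T' 0 R"

lemma agree_refl [simp]: "agree R T T"
  and agree_sym: "agree R T T' \<Longrightarrow> agree R T' T"
  and agree_trans: "agree R T T' \<Longrightarrow> agree R T' T'' \<Longrightarrow> agree R T T''"
  by (simp_all add: agree_def)

lemma agree_iff:
  "agree R T T' \<longleftrightarrow> (\<forall>t. (\<exists>a\<in>fst t. norm a < R) \<longrightarrow> (t \<in> T \<longleftrightarrow> t \<in> T'))"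
  by (auto simp: agree_def set_eq_iff mem_patch_0)

lemma agree_mono: "agree R T T' \<Longrightarrow> R' \<le> R \<Longrightarrow> agree R' T T'"
  unfolding agree_iff by (meson less_le_trans)

lemma agree_translate:
  assumes "agree R T T'" "R' + norm x \<le> R"
  shows "agree R' (T \<ominus> x) (T' \<ominus> x)"
  unfolding agree_iff
proof (intro allI impI)
  fix t :: "'a set \<times> 'b" assume "\<exists>a\<in>fst t. norm a < R'"
  then obtain a where "a \<in> fst t" "norm a < R'" by blast
  moreover have "norm (a + x) \<le> norm a + norm x" by (rule norm_triangle_ineq)
  ultimately have "\<exists>a\<in>fst (shift_piece (- x) t). norm a < R"
    using assms(2) by (intro bexI[of _ "a + x"]) auto
  then show "t \<in> T \<ominus> x \<longleftrightarrow> t \<in> T' \<ominus> x"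
    using assms(1) unfolding agree_iff mem_translate by blast
qed

lemma agree_translate_cancel:
  assumes "agree R (T \<ominus> x) (T' \<ominus> x)" "R' + norm x \<le> R"
  shows "agree R' T T'"
  using agree_translate[OF assms(1), of R' "- x"] assms(2) by simp

lemma agree_everywhere:
  assumes "\<And>R. R > 0 \<Longrightarrow> agree R T T'" "\<forall>t\<in>T. fst t \<noteq> {}" "\<forall>t\<in>T'. fst t \<noteq> {}"
  shows "T = T'"
proof -
  have "t \<in> T \<longleftrightarrow> t \<in> T'" if ne: "fst t \<noteq> {}" for t :: "'a set \<times> 'b"
  proof -
    obtain a where "a \<in> fst t" using ne by blast
    moreover have "norm a < norm a + 1" "0 < norm a + 1" by (simp_all add: add_nonneg_pos)
    ultimately show ?thesis
      using assms(1)[of "norm a + 1"] unfolding agree_iff by blast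
  qed
  then show ?thesis using assms(2,3) by blast
qed

section \<open>Closeness of patterns\<close>

lemma infdist_lt_iff: "A \<noteq> {} \<Longrightarrow> infdist a A < e \<longleftrightarrow> (\<exists>b\<in>A. dist a b < e)"
  by (simp add: infdist_def cINF_less_iff)

lemma compact_bdd_above_infdist: "compact A \<Longrightarrow> bdd_above ((\<lambda>a. infdist a B) ` A)"
  by (intro bounded_imp_bdd_above compact_imp_bounded compact_continuous_image)
    (auto intro: continuous_intros)

lemma piece_dist_lessD:
  assumes "piece_dist t t' < e" "compact (fst t)" "compact (fst t')" "fst t \<noteq> {}" "fst t' \<noteq> {}"
  shows "\<forall>a\<in>fst t. \<exists>b\<in>fst t'. dist a b < e" "\<forall>b\<in>fst t'. \<exists>a\<in>fst t. dist a b < e"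
    "dist (snd t) (snd t') < e"
proof -
  have lt: "(SUP a\<in>fst t. infdist a (fst t')) < e" "(SUP a\<in>fst t'. infdist a (fst t)) < e"
    using assms(1) by (simp_all add: piece_dist_def hausdorff_distance_def)
  show "\<forall>a\<in>fst t. \<exists>b\<in>fst t'. dist a b < e"
  proof
    fix a assume "a \<in> fst t"
    then have "infdist a (fst t') < e"
      using lt(1) cSUP_upper[OF _ compact_bdd_above_infdist[OF assms(2), of "fst t'"], of a]
      by simp
    then show "\<exists>b\<in>fst t'. dist a b < e" using infdist_lt_iff[OF assms(5)] by blast
  qed
  show "\<forall>b\<in>fst t'. \<exists>a\<in>fst t. dist a b < e"
  proof
    fix b assume "b \<in> fst t'"
    then have "infdist b (fst t) < e"
      using lt(2) cSUP_upper[OF _ compact_bdd_above_infdist[OF assms(3), of "fst t"], of b]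
      by simp
    then show "\<exists>a\<in>fst t. dist a b < e"
      using infdist_lt_iff[OF assms(4)] by (simp add: dist_commute)
  qed
  show "dist (snd t) (snd t') < e"
    using assms(1) by (simp add: piece_dist_def)
qed

lemma piece_dist_shift:
  assumes "fst t \<noteq> {}"
  shows "piece_dist t (shift_piece z t) \<le> norm z"
proof -
  have 1: "infdist a ((\<lambda>y. y - z) ` fst t) \<le> norm z" if "a \<in> fst t" for a
    using infdist_le[of "a - z" "(\<lambda>y. y - z) ` fst t" a] that by (simp add: dist_norm)
  have 2: "infdist b (fst t) \<le> norm z" if b: "b \<in> (\<lambda>y. y - z) ` fst t" for b
  proof -
    obtain a where "a \<in> fst t" "b = a - z" using b by blast
    then show ?thesis using infdist_le[of a "fst t" b] by (simp add: dist_norm)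
  qed
  show ?thesis
    using assms unfolding piece_dist_def hausdorff_distance_def
    by (auto intro!: cSUP_least max.boundedI 1 2)
qed

text \<open>Supports are bounded, hence not invariant under any translation.\<close>

lemma shift_piece_inj:
  assumes "compact (fst t)" "fst t \<noteq> {}" "shift_piece x t = shift_piece y t"
  shows "x = y"
proof (rule ccontr)
  assume "x \<noteq> y"
  define u where "u = x - y"
  have "u \<noteq> 0" using \<open>x \<noteq> y\<close> by (simp add: u_def)
  \<comment> \<open>A point of the support that is extreme in the direction of the shift cannot be moved.\<close>
  obtain a where a: "a \<in> fst t" "\<forall>b\<in>fst t. b \<bullet> u \<le> a \<bullet> u"
  proof -
    have "continuous_on (fst t) (\<lambda>b. b \<bullet> u)" by (intro continuous_intros)
    from continuous_attains_sup[OF assms(1,2) this] show ?thesis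
      by (elim bexE) (rule that)
  qed
  have "(\<lambda>b. b - x) ` fst t = (\<lambda>b. b - y) ` fst t"
    using assms(3) by (metis fst_shift_piece)
  moreover have "a - y \<in> (\<lambda>b. b - y) ` fst t" using a by blast
  ultimately obtain b where "b \<in> fst t" "a - y = b - x" by (metis imageE)
  then have "b = a + u" by (simp add: u_def algebra_simps)
  then have "a \<bullet> u + u \<bullet> u \<le> a \<bullet> u"
    using a \<open>b \<in> fst t\<close> by (simp add: inner_add_left[symmetric])
  then show False using \<open>u \<noteq> 0\<close> inner_gt_zero_iff[of u] by linarith
qed

text \<open>
  The shift that makes the patches equal is the matching. The larger radius \<open>R\<close> leaves room for the
  pieces that the shift moves into the ball of radius \<open>1/\<epsilon>\<close>.
\<close>

lemma agree_imp_close: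
  assumes T: "\<forall>t\<in>T. fst t \<noteq> {}" and "0 < \<epsilon>" "agree R (T' \<ominus> z) T" "1/\<epsilon> + norm z \<le> R" "norm z < \<epsilon>"
  shows "close \<epsilon> T T'"
proof -
  let ?f = "shift_piece (- z)"
  have inT': "?f t \<in> T'" if "t \<in> patch T 0 R" for t
  proof -
    have "t \<in> patch (T' \<ominus> z) 0 R" using that assms(3) by (simp add: agree_def)
    then show ?thesis by (simp add: mem_patch_0 mem_translate)
  qed
  have sub: "patch T' 0 (1/\<epsilon>) \<subseteq> ?f ` patch T 0 R"
  proof
    fix t assume t: "t \<in> patch T' 0 (1/\<epsilon>)"
    then obtain a where a: "a \<in> fst t" "norm a < 1/\<epsilon>" by (auto simp: mem_patch_0)
    have "norm (a - z) \<le> norm a + norm z" by (rule norm_triangle_ineq4)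
    then have "norm (a - z) < R" using a assms(4) by linarith
    moreover have "shift_piece z t \<in> T' \<ominus> z"
      using t by (simp add: mem_translate mem_patch_0)
    ultimately have "shift_piece z t \<in> patch (T' \<ominus> z) 0 R"
      using a by (auto simp: mem_patch_0)
    then have "shift_piece z t \<in> patch T 0 R" using assms(3) by (simp add: agree_def)
    moreover have "t = ?f (shift_piece z t)" by simp
    ultimately show "t \<in> ?f ` patch T 0 R" by blast
  qed
  have inj: "inj_on ?f (patch T 0 R)"
    by (rule inj_on_inverseI[of _ "shift_piece z"]) simp
  have "piece_dist t (?f t) < \<epsilon>" if "t \<in> patch T 0 R" for t
    using piece_dist_shift[of t "- z"] T that assms(5) by (auto simp: mem_patch_0)
  moreover have "1/\<epsilon> \<le> R" using assms(4) norm_ge_zero[of z] by linarith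
  ultimately show ?thesis
    unfolding close_def
    using sub inj inT' patch_mono[of "1/\<epsilon>" R T 0]
    by (intro exI[of _ "patch T 0 R"] exI[of _ "?f ` patch T 0 R"] exI[of _ ?f])
      (auto simp: bij_betw_def mem_patch_0)
qed

section \<open>Spaces of finite local complexity\<close>

lemma compact_eq_if_approx:
  fixes A B :: "'a::metric_space set"
  assumes "closed A" "closed B"
    and "\<And>\<eta>. \<eta> > 0 \<Longrightarrow> (\<forall>a\<in>A. \<exists>b\<in>B. dist a b < \<eta>) \<and> (\<forall>b\<in>B. \<exists>a\<in>A. dist a b < \<eta>)"
  shows "A = B"
proof -
  have "a \<in> closure B" if "a \<in> A" for a
    using assms(3) that unfolding closure_approachable by (metis dist_commute)
  moreover have "b \<in> closure A" if "b \<in> B" for b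
    using assms(3) that unfolding closure_approachable by blast
  ultimately show ?thesis using assms(1,2) by auto
qed

text \<open>
  A piece that is approximated along a cluster of the filter \<open>G\<close> by translates of one prototype is
  itself a translate of it, since the vectors of translation converge.
\<close>

lemma piece_limit:
  fixes y :: "'b \<Rightarrow> 'a::euclidean_space"
  assumes t: "compact (fst t)" "fst t \<noteq> {}" and p: "compact (fst p)" "fst p \<noteq> {}"
    and y: "(y \<longlongrightarrow> y') G" and e: "(e \<longlongrightarrow> 0) G"
    and freq: "\<exists>\<^sub>F k in G. piece_dist t (shift_piece (y k) p) < e k"
  shows "t = shift_piece y' p"
proof -
  have near: "(\<forall>a\<in>fst t. \<exists>b\<in>fst p. dist a (b - y') < \<eta>) \<and>
      (\<forall>b\<in>fst p. \<exists>a\<in>fst t. dist a (b - y') < \<eta>) \<and> dist (snd t) (snd p) < \<eta>"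
    if "\<eta> > 0" for \<eta>
  proof -
    have "\<forall>\<^sub>F k in G. dist (y k) y' < \<eta>/2" by (rule tendstoD[OF y]) (use \<open>\<eta> > 0\<close> in simp)
    moreover have "\<forall>\<^sub>F k in G. e k < \<eta>/2" by (rule order_tendstoD(2)[OF e]) (use \<open>\<eta> > 0\<close> in simp)
    ultimately have "\<forall>\<^sub>F k in G. dist (y k) y' < \<eta>/2 \<and> e k < \<eta>/2" by eventually_elim simp
    with freq have "\<exists>\<^sub>F k in G. piece_dist t (shift_piece (y k) p) < e k \<and>
        (dist (y k) y' < \<eta>/2 \<and> e k < \<eta>/2)"
      by (rule frequently_eventually_frequently)
    then obtain k where k: "piece_dist t (shift_piece (y k) p) < \<eta>/2" "dist (y k) y' < \<eta>/2"
      by (blast dest: frequently_ex intro: less_trans)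
    have "compact (fst (shift_piece (y k) p))"
      using p(1) compact_translation_subtract by simp
    note pd = piece_dist_lessD[OF k(1) t(1) this t(2)]
    have step: "dist a (b - y') < \<eta>" if "dist a (b - y k) < \<eta>/2" for a b
    proof -
      have "dist (b - y k) (b - y') < \<eta>/2" using k(2) by (simp add: dist_norm norm_minus_commute)
      then show ?thesis using that dist_triangle[of a "b - y'" "b - y k"] by linarith
    qed
    have "\<exists>b\<in>fst p. dist a (b - y') < \<eta>" if "a \<in> fst t" for a
      using pd(1) that p(2) step by fastforce
    moreover have "\<exists>a\<in>fst t. dist a (b - y') < \<eta>" if "b \<in> fst p" for b
      using pd(2) that p(2) step by fastforce
    moreover have "dist (snd t) (snd p) < \<eta>"
      using pd(3) p(2) \<open>\<eta> > 0\<close> by simp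
    ultimately show ?thesis by blast
  qed
  have "dist (snd t) (snd p) < \<eta>" if "\<eta> > 0" for \<eta> using near that by blast
  then have "snd t = snd p" by (meson dist_pos_lt less_irrefl)
  moreover have "fst t = fst (shift_piece y' p)"
  proof (rule compact_eq_if_approx)
    show "closed (fst t)" using t(1) by (rule compact_imp_closed)
    show "closed (fst (shift_piece y' p))"
      using compact_imp_closed[OF compact_translation_subtract[OF p(1), of y']] by simp
  qed (use near in fastforce)
  ultimately show ?thesis by (simp add: prod_eq_iff)
qed

text \<open>
  The common features of tilings and labelled Delone sets on which the proof rests. Local finiteness
  is listed on its own, because finitely many patches up to translation may still be infinite sets.
\<close>

locale flc_space =
  fixes \<Omega> :: "('a::euclidean_space, 'l::metric_space) pattern set"
  assumes compact_piece: "T \<in> \<Omega> \<Longrightarrow> t \<in> T \<Longrightarrow> compact (fst t)"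
    and nonempty_piece: "T \<in> \<Omega> \<Longrightarrow> t \<in> T \<Longrightarrow> fst t \<noteq> {}"
    and nonempty: "T \<in> \<Omega> \<Longrightarrow> T \<noteq> {}"
    and finite_patch: "T \<in> \<Omega> \<Longrightarrow> finite (patch T x R)"
    and translate_closed: "T \<in> \<Omega> \<Longrightarrow> T \<ominus> x \<in> \<Omega>"
    and compact: "compact_space (pattern_topology \<Omega>)"
    and minimal: "minimal_space \<Omega>"
    and aperiodic: "aperiodic_space \<Omega>"
    and flc: "FLC \<Omega>"
begin

abbreviation "X \<equiv> pattern_topology \<Omega>"

text \<open>
  This is where finite local complexity turns approximate coincidence into exact coincidence up to
  a small shift. Take patterns converging to \<open>T\<close>. By the pigeonhole principle their central patches
  are translates \<open>P \<ominus> y n\<close> of one finite patch \<open>P\<close>, and along a subsequence \<open>y n\<close> converges to some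
  \<open>y'\<close>. Then \<open>P \<ominus> y'\<close> is the central patch of \<open>T\<close>, so shifting by \<open>y' - y n\<close>, which tends to \<open>0\<close>,
  gives agreement. The patch of \<open>T\<close> is required to be nonempty to keep the sequence \<open>y\<close> bounded.
\<close>

lemma close_imp_agree_aux:
  assumes T: "T \<in> \<Omega>" and d: "0 < d" and R: "0 < R" and ne: "patch T 0 R \<noteq> {}"
  shows "\<exists>\<epsilon>>0. \<forall>T'\<in>\<Omega>. close \<epsilon> T T' \<longrightarrow> (\<exists>z. norm z < d \<and> agree R (T' \<ominus> z) T)"
proof (rule ccontr)
  let ?good = "\<lambda>T'. \<exists>z. norm z < d \<and> agree R (T' \<ominus> z) T"
  assume "\<not> ?thesis"
  then have ex: "\<exists>T'\<in>\<Omega>. close \<epsilon> T T' \<and> \<not> ?good T'" if "\<epsilon> > 0" for \<epsilon> using that by blast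
  obtain F where F: "finite F" "\<forall>T\<in>\<Omega>. \<forall>x. \<exists>P\<in>F. \<exists>y. patch T x (R+1) = P \<ominus> y"
    using flc R unfolding FLC_def by (metis add_pos_pos zero_less_one)
  define bad where "bad \<epsilon> P \<longleftrightarrow>
    (\<exists>T'\<in>\<Omega>. \<exists>y. close \<epsilon> T T' \<and> \<not> ?good T' \<and> patch T' 0 (R+1) = P \<ominus> y)" for \<epsilon> P
  have bad_mono: "bad \<epsilon> P" if "bad \<delta> P" "0 < \<delta>" "\<delta> \<le> \<epsilon>" for \<delta> \<epsilon> P
    using that close_mono unfolding bad_def by blast
  have "\<exists>P\<in>F. \<forall>\<epsilon>>0. bad \<epsilon> P"
  proof (rule ccontr)
    assume "\<not> ?thesis"
    then have "\<forall>P\<in>F. \<exists>\<epsilon>>0. \<not> bad \<epsilon> P" by blast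
    then obtain e where e: "\<forall>P\<in>F. e P > 0 \<and> \<not> bad (e P) P" by metis
    define m where "m = Min (insert 1 (e ` F))"
    have "m > 0" using F(1) e by (simp add: m_def)
    then obtain T' where T': "T' \<in> \<Omega>" "close m T T'" "\<not> ?good T'" using ex by blast
    then obtain P y where "P \<in> F" "patch T' 0 (R+1) = P \<ominus> y" using F(2) by blast
    then have "bad m P" using T' unfolding bad_def by blast
    moreover have "m \<le> e P" using F(1) \<open>P \<in> F\<close> by (simp add: m_def)
    ultimately show False using bad_mono \<open>m > 0\<close> e \<open>P \<in> F\<close> by blast
  qed
  then obtain P where P: "\<forall>\<epsilon>>0. bad \<epsilon> P" by blast
  define e where "e n = inverse (real (Suc n))" for n
  have e: "e n > 0" for n by (simp add: e_def)
  have e0: "e \<longlonglongrightarrow> 0" unfolding e_def by (rule LIMSEQ_inverse_real_of_nat)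
  obtain S y where S: "S n \<in> \<Omega>" "close (e n) T (S n)" "\<not> ?good (S n)" "patch (S n) 0 (R+1) = P \<ominus> y n" for n
  proof -
    have "\<forall>n. \<exists>S y. S \<in> \<Omega> \<and> close (e n) T S \<and> \<not> ?good S \<and> patch S 0 (R+1) = P \<ominus> y"
      using P e unfolding bad_def by blast
    from this[unfolded choice_iff] show ?thesis using that by blast
  qed
  have PS: "shift_piece (y n) p \<in> patch (S n) 0 (R+1)" if "p \<in> P" for p n
    using that S(4) by (simp add: mem_translate)
  \<comment> \<open>\<open>P\<close> comes from the list of patches up to translation; that its pieces are compact and finite
    in number is seen on a translate that occurs in a pattern of the space.\<close>
  have P_compact: "compact (fst p)" and P_ne: "fst p \<noteq> {}" if "p \<in> P" for p
  proof -
    have "shift_piece (y 0) p \<in> S 0" using PS[OF that] by (simp add: mem_patch_0)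
    then have "compact (fst (shift_piece (y 0) p))" "fst (shift_piece (y 0) p) \<noteq> {}"
      using compact_piece nonempty_piece S(1) by blast+
    then show "compact (fst p)" "fst p \<noteq> {}"
      using compact_translation_subtract[of "fst (shift_piece (y 0) p)" "- y 0"]
      by (simp_all add: image_image)
  qed
  have "P = patch (S 0) 0 (R+1) \<ominus> (- y 0)" using S(4)[of 0] by simp
  then have finP: "finite P" using finite_patch[OF S(1)] by (simp add: translate_def)
  have from_T: "\<forall>\<^sub>F n in sequentially. \<exists>p\<in>P. piece_dist t (shift_piece (y n) p) < e n"
    if t: "t \<in> patch T 0 (R+1)" for t
  proof -
    obtain a where a: "a \<in> fst t" "norm a < R+1" "t \<in> T" using t by (auto simp: mem_patch_0)
    have "\<forall>\<^sub>F n in sequentially. e n < R + 1 - norm a"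
      using e0 a(2) order_tendstoD(2)[of e 0 sequentially] by simp
    moreover have "\<forall>\<^sub>F n in sequentially. e n < inverse (R+1)"
      using e0 R order_tendstoD(2)[of e 0 sequentially "inverse (R+1)"] by simp
    ultimately show ?thesis
    proof eventually_elim
      case (elim n)
      have "R + 1 < 1 / e n" using elim(2) e[of n] R by (simp add: field_simps)
      obtain A A' f where A: "patch T 0 (1/e n) \<subseteq> A" "A \<subseteq> T" "A' \<subseteq> S n"
          "bij_betw f A A'" and f: "\<forall>t\<in>A. piece_dist t (f t) < e n"
        using S(2)[of n] unfolding close_def by blast
      have "t \<in> A" using t A(1) patch_mono[of "R+1" "1/e n" T 0] \<open>R + 1 < 1 / e n\<close> by auto
      then have ft: "f t \<in> S n" "piece_dist t (f t) < e n" using A(3) bij_betwE[OF A(4)] f by auto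
      have cmp: "compact (fst t)" "compact (fst (f t))" "fst t \<noteq> {}" "fst (f t) \<noteq> {}"
        using compact_piece[OF T a(3)] compact_piece[OF S(1) ft(1)]
          nonempty_piece[OF T a(3)] nonempty_piece[OF S(1) ft(1)] by simp_all
      obtain b where b: "b \<in> fst (f t)" "dist a b < e n"
        using piece_dist_lessD(1)[OF ft(2) cmp] a(1) by blast
      have "norm b < R + 1"
        using b(2) elim(1) norm_triangle_ineq2[of b a] by (simp add: dist_norm norm_minus_commute)
      then have "f t \<in> patch (S n) 0 (R+1)" unfolding mem_patch_0 using b(1) ft(1) by blast
      then have "f t \<in> P \<ominus> y n" unfolding S(4) .
      then obtain p where "p \<in> P" "f t = shift_piece (y n) p" unfolding translate_def by blast
      then show ?case using ft(2) by auto
    qed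
  qed
  have to_T: "\<forall>\<^sub>F n in sequentially. \<exists>t\<in>patch T 0 (R+2). piece_dist t (shift_piece (y n) p) < e n"
    if p: "p \<in> P" for p
  proof -
    have "\<forall>\<^sub>F n in sequentially. e n < 1"
      using e0 order_tendstoD(2)[of e 0 sequentially] by simp
    moreover have "\<forall>\<^sub>F n in sequentially. e n < inverse (R+1)"
      using e0 R order_tendstoD(2)[of e 0 sequentially "inverse (R+1)"] by simp
    ultimately show ?thesis
    proof eventually_elim
      case (elim n)
      have "R + 1 < 1 / e n" using elim(2) e[of n] R by (simp add: field_simps)
      obtain A A' f where A: "A \<subseteq> T" "patch (S n) 0 (1/e n) \<subseteq> A'" "A' \<subseteq> S n"
          "bij_betw f A A'" and f: "\<forall>t\<in>A. piece_dist t (f t) < e n"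
        using S(2)[of n] unfolding close_def by blast
      have sp: "shift_piece (y n) p \<in> patch (S n) 0 (R+1)" using PS[OF p] .
      then have "shift_piece (y n) p \<in> A'"
        using A(2) patch_mono[of "R+1" "1/e n" "S n" 0] \<open>R + 1 < 1 / e n\<close> by auto
      then obtain t where t: "t \<in> A" "f t = shift_piece (y n) p"
        using A(4) by (metis bij_betw_def imageE)
      then have pd: "piece_dist t (shift_piece (y n) p) < e n" using f by auto
      have tT: "t \<in> T" using t A by blast
      obtain b where b: "b \<in> fst (shift_piece (y n) p)" "norm b < R+1"
        using sp by (auto simp: mem_patch_0)
      have cmp: "compact (fst t)" "compact (fst (shift_piece (y n) p))" "fst t \<noteq> {}"
          "fst (shift_piece (y n) p) \<noteq> {}"
        using compact_piece[OF T tT] nonempty_piece[OF T tT] sp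
          compact_piece[OF S(1), of "shift_piece (y n) p" n]
          nonempty_piece[OF S(1), of "shift_piece (y n) p" n]
        by (auto simp: mem_patch_0)
      obtain a where a: "a \<in> fst t" "dist a b < e n"
        using piece_dist_lessD(2)[OF pd cmp] b(1) by blast
      have "norm a < R + 2"
        using a(2) elim(1) b(2) norm_triangle_ineq2[of a b] by (simp add: dist_norm)
      then have "t \<in> patch T 0 (R+2)" using a tT by (auto simp: mem_patch_0)
      then show ?case using pd by blast
    qed
  qed
  \<comment> \<open>A piece of \<open>P\<close> meets the ball in every \<open>P \<ominus> y n\<close>, which bounds \<open>y n\<close>.\<close>
  obtain p0 where p0: "p0 \<in> P"
  proof -
    obtain t where "t \<in> patch T 0 R" using ne by blast
    then have "t \<in> patch T 0 (R+1)" using patch_mono[of R "R+1" T 0] by auto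
    then have "\<exists>n. \<exists>p\<in>P. piece_dist t (shift_piece (y n) p) < e n"
      using from_T eventually_happens sequentially_bot by blast
    then show ?thesis using that by blast
  qed
  obtain B where B: "\<forall>a\<in>fst p0. norm a \<le> B"
    using compact_imp_bounded[OF P_compact[OF p0]] bounded_iff by blast
  have "y n \<in> cball 0 (B + R + 1)" for n
  proof -
    obtain a where "a \<in> fst p0" "norm (a - y n) < R+1"
      using PS[OF p0, of n] by (auto simp: mem_patch_0)
    moreover have "norm (y n) \<le> norm a + norm (a - y n)"
      using norm_triangle_ineq4[of a "a - y n"] by simp
    ultimately show ?thesis using B by fastforce
  qed
  then obtain y' r where r: "strict_mono r" and lim: "(y \<circ> r) \<longlonglongrightarrow> y'"
    using compact_cball[of "0::'a" "B+R+1"] unfolding compact_def by metis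
  have lim': "((\<lambda>k. y (r k)) \<longlongrightarrow> y') sequentially" using lim by (simp add: comp_def)
  have elim': "((\<lambda>k. e (r k)) \<longlongrightarrow> 0) sequentially"
    using LIMSEQ_subseq_LIMSEQ[OF e0 r] by (simp add: comp_def)
  have T_P: "t \<in> P \<ominus> y'" if t: "t \<in> patch T 0 (R+1)" for t
  proof -
    have fr: "\<exists>\<^sub>F k in sequentially. \<exists>p\<in>P. piece_dist t (shift_piece (y (r k)) p) < e (r k)"
      using from_T[OF t] eventually_subseq[OF r] eventually_frequently sequentially_bot by blast
    obtain p where p: "p \<in> P" "\<exists>\<^sub>F k in sequentially. piece_dist t (shift_piece (y (r k)) p) < e (r k)"
      using frequently_bex_finite[OF finP fr] by (elim bexE) (rule that)
    have "t \<in> T" using t by (simp add: mem_patch_0)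
    then have "t = shift_piece y' p"
      using piece_limit[OF _ _ _ _ lim' elim' p(2)] compact_piece nonempty_piece T P_compact P_ne p(1) by blast
    then show ?thesis using p(1) unfolding translate_def by blast
  qed
  have P_T: "shift_piece y' p \<in> T" if p: "p \<in> P" for p
  proof -
    have fr: "\<exists>\<^sub>F k in sequentially. \<exists>t\<in>patch T 0 (R+2). piece_dist t (shift_piece (y (r k)) p) < e (r k)"
      using to_T[OF p] eventually_subseq[OF r] eventually_frequently sequentially_bot by blast
    obtain t where t: "t \<in> patch T 0 (R+2)"
        "\<exists>\<^sub>F k in sequentially. piece_dist t (shift_piece (y (r k)) p) < e (r k)"
      using frequently_bex_finite[OF finite_patch[OF T] fr] by (elim bexE) (rule that)
    have "t \<in> T" using t by (simp add: mem_patch_0)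
    then have "t = shift_piece y' p"
      using piece_limit[OF _ _ _ _ lim' elim' t(2)] compact_piece nonempty_piece T P_compact P_ne p by blast
    then show ?thesis using \<open>t \<in> T\<close> by simp
  qed
  have "\<forall>\<^sub>F k in sequentially. dist (y (r k)) y' < min d 1"
    by (rule tendstoD[OF lim']) (use d in simp)
  then obtain k where k: "dist (y (r k)) y' < min d 1"
    using eventually_happens sequentially_bot by blast
  define z where "z = y' - y (r k)"
  have z: "norm z < d" "norm z < 1" using k by (simp_all add: z_def dist_norm norm_minus_commute)
  have "agree R (S (r k) \<ominus> z) T"
    unfolding agree_iff
  proof (intro allI impI)
    fix t :: "'a set \<times> 'l" assume "\<exists>a\<in>fst t. norm a < R"
    then obtain a where a: "a \<in> fst t" "norm a < R" by blast
    have "norm (a + z) < R + 1" using a(2) z(2) norm_triangle_ineq[of a z] by linarith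
    then have "t \<in> S (r k) \<ominus> z \<longleftrightarrow> shift_piece (- z) t \<in> patch (S (r k)) 0 (R+1)"
      using a(1) by (auto simp: mem_translate mem_patch_0)
    also have "\<dots> \<longleftrightarrow> t \<in> P \<ominus> y'"
      unfolding S(4) by (simp add: mem_translate z_def)
    also have "\<dots> \<longleftrightarrow> t \<in> T"
    proof
      assume "t \<in> P \<ominus> y'"
      then show "t \<in> T" using P_T[of "shift_piece (- y') t"] by (simp add: mem_translate)
    next
      assume "t \<in> T"
      then have "t \<in> patch T 0 (R+1)" using a by (force simp: mem_patch_0)
      then show "t \<in> P \<ominus> y'" by (rule T_P)
    qed
    finally show "t \<in> S (r k) \<ominus> z \<longleftrightarrow> t \<in> T" .
  qed
  then show False using S(3) z by blast
qed

end

context flc_space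
begin

lemma meets_ball: "T \<in> \<Omega> \<Longrightarrow> \<exists>R>0. patch T 0 R \<noteq> {}"
proof -
  assume T: "T \<in> \<Omega>"
  then obtain t where t: "t \<in> T" using nonempty by blast
  then obtain a where a: "a \<in> fst t" using nonempty_piece T by blast
  have "t \<in> patch T 0 (norm a + 1)" by (rule mem_patch_0I[OF t a]) simp
  moreover have "norm a + 1 > 0" by (simp add: add_nonneg_pos)
  ultimately show ?thesis by blast
qed

lemma close_imp_agree:
  assumes T: "T \<in> \<Omega>" and d: "0 < d"
  shows "\<exists>\<epsilon>>0. \<forall>T'\<in>\<Omega>. close \<epsilon> T T' \<longrightarrow> (\<exists>z. norm z < d \<and> agree R (T' \<ominus> z) T)"
proof -
  obtain R' where R': "R' > 0" "patch T 0 R' \<noteq> {}" using meets_ball[OF T] by blast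
  have ne: "patch T 0 (max R R') \<noteq> {}" using R'(2) patch_mono[of R' "max R R'" T 0] by auto
  obtain \<epsilon> where e: "\<epsilon> > 0"
      "\<forall>T'\<in>\<Omega>. close \<epsilon> T T' \<longrightarrow> (\<exists>z. norm z < d \<and> agree (max R R') (T' \<ominus> z) T)"
    using close_imp_agree_aux[OF T d _ ne] less_max_iff_disj[of 0 R R'] R'(1) by blast
  have "\<exists>z. norm z < d \<and> agree R (T' \<ominus> z) T" if "T' \<in> \<Omega>" "close \<epsilon> T T'" for T'
    using e(2) that agree_mono[OF _ max.cobounded1[of R R']] by blast
  then show ?thesis using e(1) by blast
qed

text \<open>
  The product neighbourhoods: the patterns whose central patch is that of \<open>T\<close>, up to a small shift.
  They form a base of the topology, and all topological arguments below are carried out with them.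
\<close>

definition cylinder :: "('a, 'l) pattern \<Rightarrow> real \<Rightarrow> real \<Rightarrow> ('a, 'l) pattern set" where
  "cylinder T R d = {T' \<in> \<Omega>. \<exists>z. norm z < d \<and> agree R (T' \<ominus> z) T}"

lemma cylinder_self: "T \<in> \<Omega> \<Longrightarrow> d > 0 \<Longrightarrow> T \<in> cylinder T R d"
  unfolding cylinder_def by (auto intro!: exI[of _ 0])

lemma cylinder_mono: "R' \<le> R \<Longrightarrow> d \<le> d' \<Longrightarrow> cylinder T R d \<subseteq> cylinder T R' d'"
  unfolding cylinder_def by (auto intro: agree_mono less_le_trans)

lemma openin_iff:
  "openin X U \<longleftrightarrow> U \<subseteq> \<Omega> \<and> (\<forall>T\<in>U. \<exists>R>0. \<exists>d>0. cylinder T R d \<subseteq> U)"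
proof
  assume U: "openin X U"
  have "\<exists>R>0. \<exists>d>0. cylinder T R d \<subseteq> U" if T: "T \<in> U" for T
  proof -
    obtain \<epsilon> where e: "\<epsilon> > 0" "\<forall>T'\<in>\<Omega>. close \<epsilon> T T' \<longrightarrow> T' \<in> U"
      using U T unfolding openin_pattern_topology by blast
    have "\<forall>t\<in>T. fst t \<noteq> {}" using T U nonempty_piece unfolding openin_pattern_topology by blast
    then have "close \<epsilon> T T'" if "T' \<in> cylinder T (1/\<epsilon> + \<epsilon>) \<epsilon>" for T'
      using that e(1) agree_imp_close[of T \<epsilon> "1/\<epsilon> + \<epsilon>" T'] unfolding cylinder_def by auto
    then have "cylinder T (1/\<epsilon> + \<epsilon>) \<epsilon> \<subseteq> U"
      using e(2) unfolding cylinder_def by blast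
    moreover have "1/\<epsilon> + \<epsilon> > 0" using e(1) by (simp add: add_pos_pos)
    ultimately show ?thesis using e(1) by blast
  qed
  then show "U \<subseteq> \<Omega> \<and> (\<forall>T\<in>U. \<exists>R>0. \<exists>d>0. cylinder T R d \<subseteq> U)"
    using U unfolding openin_pattern_topology by blast
next
  assume U: "U \<subseteq> \<Omega> \<and> (\<forall>T\<in>U. \<exists>R>0. \<exists>d>0. cylinder T R d \<subseteq> U)"
  show "openin X U"
    unfolding openin_pattern_topology
  proof (intro conjI ballI)
    fix T assume T: "T \<in> U"
    then obtain R d where d: "d > 0" and sub: "cylinder T R d \<subseteq> U" using U by blast
    have "T \<in> \<Omega>" using U T by blast
    then obtain \<epsilon> where "\<epsilon> > 0" "\<forall>T'\<in>\<Omega>. close \<epsilon> T T' \<longrightarrow> T' \<in> cylinder T R d"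
      using close_imp_agree[OF _ d, of T R] unfolding cylinder_def by auto
    then show "\<exists>\<epsilon>>0. \<forall>T'\<in>\<Omega>. close \<epsilon> T T' \<longrightarrow> T' \<in> U"
      using sub by (meson subsetD)
  qed (use U in blast)
qed

lemma openin_cylinder: "openin X (cylinder T R d)"
  unfolding openin_iff
proof (intro conjI ballI)
  fix T' assume "T' \<in> cylinder T R d"
  then obtain z where z: "norm z < d" "agree R (T' \<ominus> z) T" unfolding cylinder_def by blast
  have "cylinder T' (\<bar>R\<bar> + norm z + 1) (d - norm z) \<subseteq> cylinder T R d"
  proof
    fix T'' assume "T'' \<in> cylinder T' (\<bar>R\<bar> + norm z + 1) (d - norm z)"
    then obtain w where w: "T'' \<in> \<Omega>" "norm w < d - norm z" "agree (\<bar>R\<bar> + norm z + 1) (T'' \<ominus> w) T'"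
      unfolding cylinder_def by blast
    have "agree R (T'' \<ominus> (w + z)) (T' \<ominus> z)"
      using agree_translate[OF w(3), of R z] by simp
    then have "agree R (T'' \<ominus> (w + z)) T" using z(2) agree_trans by blast
    moreover have "norm (w + z) < d" using w(2) norm_triangle_ineq[of w z] by linarith
    ultimately show "T'' \<in> cylinder T R d" unfolding cylinder_def using w(1) by blast
  qed
  moreover have "\<bar>R\<bar> + norm z + 1 > 0" using norm_ge_zero[of z] by linarith
  ultimately show "\<exists>R'>0. \<exists>d'>0. cylinder T' R' d' \<subseteq> cylinder T R d"
    using z(1) diff_gt_0_iff_gt by blast
qed (auto simp: cylinder_def)

lemma continuous_map_into_iff:
  "continuous_map Z X f \<longleftrightarrow> f \<in> topspace Z \<rightarrow> \<Omega> \<and>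
     (\<forall>x\<in>topspace Z. \<forall>R>0. \<forall>d>0. \<exists>N. openin Z N \<and> x \<in> N \<and> (\<forall>y\<in>N. f y \<in> cylinder (f x) R d))"
  (is "?lhs \<longleftrightarrow> ?rhs")
proof
  assume f: ?lhs
  then have fX: "f \<in> topspace Z \<rightarrow> \<Omega>" by (simp add: continuous_map_def)
  have "\<exists>N. openin Z N \<and> x \<in> N \<and> (\<forall>y\<in>N. f y \<in> cylinder (f x) R d)"
    if "x \<in> topspace Z" "d > 0" for x R d
    using openin_continuous_map_preimage[OF f openin_cylinder[of "f x" R d]] that fX
      cylinder_self[of "f x" d R] by blast
  then show ?rhs using fX by blast
next
  assume f: ?rhs
  show ?lhs
    unfolding continuous_map_def
  proof (intro conjI allI impI)
    fix U assume U: "openin X U"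
    show "openin Z {x \<in> topspace Z. f x \<in> U}"
    proof (subst openin_subopen, intro ballI)
      fix x assume x: "x \<in> {x \<in> topspace Z. f x \<in> U}"
      then obtain R d where Rd: "R > 0" "d > 0" "cylinder (f x) R d \<subseteq> U"
        using U unfolding openin_iff by blast
      then obtain N where "openin Z N" "x \<in> N" "\<forall>y\<in>N. f y \<in> cylinder (f x) R d"
        using f x by blast
      then show "\<exists>N. openin Z N \<and> x \<in> N \<and> N \<subseteq> {x \<in> topspace Z. f x \<in> U}"
        using Rd openin_subset by fast
    qed
  qed (use f in auto)
qed

lemma continuous_map_translate:
  fixes v :: "'z \<Rightarrow> 'a"
  assumes f: "continuous_map Z X f" and v: "continuous_map Z euclidean v"
  shows "continuous_map Z X (\<lambda>z. f z \<ominus> v z)"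
  unfolding continuous_map_into_iff
proof (intro conjI ballI allI impI)
  show "(\<lambda>z. f z \<ominus> v z) \<in> topspace Z \<rightarrow> \<Omega>"
    using f translate_closed by (auto simp: continuous_map_def)
  fix x and R d :: real assume x: "x \<in> topspace Z" and d: "0 < d" and R: "R > 0"
  let ?R = "R + norm (v x)"
  have R': "?R > 0" using R norm_ge_zero[of "v x"] by linarith
  obtain N where N: "openin Z N" "x \<in> N" "\<forall>y\<in>N. f y \<in> cylinder (f x) ?R (d/2)"
    using f x d R' unfolding continuous_map_into_iff by (metis half_gt_zero)
  define N' where "N' = N \<inter> {y \<in> topspace Z. v y \<in> ball (v x) (d/2)}"
  have "openin Z N'"
    unfolding N'_def using N(1) openin_continuous_map_preimage[OF v, of "ball (v x) (d/2)"]
    by (simp add: openin_Int)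
  moreover have "x \<in> N'" using N x d by (simp add: N'_def)
  moreover have "f y \<ominus> v y \<in> cylinder (f x \<ominus> v x) R d" if y: "y \<in> N'" for y
  proof -
    obtain z where z: "f y \<in> \<Omega>" "norm z < d/2" "agree ?R (f y \<ominus> z) (f x)"
      using N(3) y unfolding cylinder_def N'_def by blast
    have "agree R (f y \<ominus> z \<ominus> v x) (f x \<ominus> v x)"
      by (rule agree_translate[OF z(3)]) simp
    then have "agree R (f y \<ominus> v y \<ominus> (z + v x - v y)) (f x \<ominus> v x)" by simp
    moreover have "norm (v x - v y) < d/2" using y by (simp add: N'_def dist_norm)
    then have "norm (z + v x - v y) < d"
      using z(2) norm_triangle_ineq[of z "v x - v y"] by (simp add: algebra_simps)
    ultimately show ?thesis using z(1) translate_closed unfolding cylinder_def by blast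
  qed
  ultimately show "\<exists>N. openin Z N \<and> x \<in> N \<and> (\<forall>y\<in>N. f y \<ominus> v y \<in> cylinder (f x \<ominus> v x) R d)"
    by blast
qed

lemma finite_cylinder_cover:
  assumes "\<And>T. T \<in> \<Omega> \<Longrightarrow> d T > 0"
  obtains F where "finite F" "F \<subseteq> \<Omega>" "\<And>S. S \<in> \<Omega> \<Longrightarrow> \<exists>T\<in>F. S \<in> cylinder T (R T) (d T)"
proof -
  have cpt: "compactin X \<Omega>" using compact by (simp add: compact_space_def)
  have cov: "\<Omega> \<subseteq> \<Union>((\<lambda>T. cylinder T (R T) (d T)) ` \<Omega>)"
    using assms cylinder_self by blast
  have op: "\<forall>U\<in>(\<lambda>T. cylinder T (R T) (d T)) ` \<Omega>. openin X U"
    using openin_cylinder by blast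
  obtain \<F> where \<F>: "finite \<F>" "\<F> \<subseteq> (\<lambda>T. cylinder T (R T) (d T)) ` \<Omega>" "\<Omega> \<subseteq> \<Union>\<F>"
    using cpt[unfolded compactin_def, THEN conjunct2, rule_format, OF conjI[OF op cov]]
    by (elim exE conjE) (rule that)
  obtain F where F: "F \<subseteq> \<Omega>" "finite F" "\<F> = (\<lambda>T. cylinder T (R T) (d T)) ` F"
    using finite_subset_image[OF \<F>(1,2)] by (elim exE conjE) (rule that)
  have "\<exists>T\<in>F. S \<in> cylinder T (R T) (d T)" if "S \<in> \<Omega>" for S
    using \<F>(3) that unfolding F(3) by blast
  with F(2,1) show ?thesis by (rule that)
qed

lemma uniform_meets_ball: "\<exists>R>0. \<forall>T\<in>\<Omega>. patch T 0 R \<noteq> {}"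
proof -
  have "\<forall>T\<in>\<Omega>. \<exists>R. R > 0 \<and> patch T 0 R \<noteq> {}" using meets_ball by blast
  from this[unfolded bchoice_iff] obtain r where r: "\<And>T. T \<in> \<Omega> \<Longrightarrow> r T > 0 \<and> patch T 0 (r T) \<noteq> {}"
    by blast
  obtain F where F: "finite F" "F \<subseteq> \<Omega>" "\<And>S. S \<in> \<Omega> \<Longrightarrow> \<exists>T\<in>F. S \<in> cylinder T (r T) 1"
    using finite_cylinder_cover[of "\<lambda>_. 1" r] by auto
  define M where "M = Max (insert 0 (r ` F))"
  have M: "r T \<le> M" if "T \<in> F" for T using F(1) that by (simp add: M_def)
  have "M \<ge> 0" using F(1) by (simp add: M_def)
  have "patch S 0 (M + 1) \<noteq> {}" if S: "S \<in> \<Omega>" for S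
  proof -
    obtain T z where T: "T \<in> F" and z: "norm z < 1" "agree (r T) (S \<ominus> z) T"
      using F(3)[OF S] unfolding cylinder_def by blast
    have "patch T 0 (r T) \<noteq> {}" using r T F(2) by blast
    then obtain t where "t \<in> patch (S \<ominus> z) 0 (r T)" using z(2) unfolding agree_def by blast
    then obtain a where a: "a \<in> fst t" "norm a < r T" "shift_piece (- z) t \<in> S"
      by (auto simp: mem_patch_0 mem_translate)
    have "norm (a + z) < M + 1" using a(2) z(1) M[OF T] norm_triangle_ineq[of a z] by linarith
    then have "shift_piece (- z) t \<in> patch S 0 (M + 1)"
      using a by (intro mem_patch_0I[of _ _ "a + z"]) auto
    then show ?thesis by blast
  qed
  then show ?thesis using \<open>M \<ge> 0\<close> by (intro exI[of _ "M + 1"]) auto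
qed

text \<open>
  Up to translation only finitely many pairs of pieces occur close to each other, and a piece
  determines the vector by which it is shifted. So small displacements between patterns that agree
  near the origin are unique.
\<close>

lemma discrete_shifts: "\<exists>r>0. \<forall>T\<in>\<Omega>. \<forall>t\<in>T. \<forall>v. shift_piece v t \<in> T \<longrightarrow> norm v < r \<longrightarrow> v = 0"
proof -
  obtain F where F: "finite F" "\<forall>T\<in>\<Omega>. \<forall>x. \<exists>P\<in>F. \<exists>y. patch T x 1 = P \<ominus> y"
    using flc unfolding FLC_def by (metis zero_less_one)
  define F' where "F' = {P \<in> F. \<exists>T\<in>\<Omega>. \<exists>x y. patch T x 1 = P \<ominus> y}"
  define V where "V = (\<Union>P\<in>F'. {v. \<exists>p\<in>P. shift_piece v p \<in> P})"
  have "finite {v. \<exists>p\<in>P. shift_piece v p \<in> P}" if P: "P \<in> F'" for P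
  proof -
    obtain T x y where T: "T \<in> \<Omega>" "patch T x 1 = P \<ominus> y" using P unfolding F'_def by blast
    then have Peq: "P = patch T x 1 \<ominus> (- y)" by simp
    then have fin: "finite P" using finite_patch[OF T(1)] by (simp add: translate_def)
    have "finite {v. shift_piece v p \<in> P}" if p: "p \<in> P" for p
    proof -
      have "shift_piece y p \<in> T"
        using p Peq by (auto simp: mem_translate mem_patch)
      then have "compact (fst (shift_piece y p))" "fst (shift_piece y p) \<noteq> {}"
        using compact_piece nonempty_piece T(1) by blast+
      then have "compact (fst p)" "fst p \<noteq> {}"
        using compact_translation_subtract[of "fst (shift_piece y p)" "- y"]
        by (simp_all add: image_image)
      then have "inj_on (\<lambda>v. shift_piece v p) UNIV"
        using shift_piece_inj by (blast intro: inj_onI)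
      then have "finite ((\<lambda>v. shift_piece v p) -` P \<inter> UNIV)"
        using finite_vimage_IntI[OF fin] by blast
      then show ?thesis by (simp add: vimage_def)
    qed
    then have "finite (\<Union>p\<in>P. {v. shift_piece v p \<in> P})" using fin by blast
    moreover have "{v. \<exists>p\<in>P. shift_piece v p \<in> P} = (\<Union>p\<in>P. {v. shift_piece v p \<in> P})" by blast
    ultimately show ?thesis by simp
  qed
  then have "finite V" using F(1) by (simp add: V_def F'_def)
  define r where "r = Min (insert 1 (norm ` (V - {0})))"
  have "r > 0" using \<open>finite V\<close> by (simp add: r_def)
  moreover have r1: "r \<le> 1" using \<open>finite V\<close> by (simp add: r_def)
  have "v = 0" if T: "T \<in> \<Omega>" and t: "t \<in> T" "shift_piece v t \<in> T" and v: "norm v < r" for T t v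
  proof -
    obtain x where x: "x \<in> fst t" using nonempty_piece T t by blast
    obtain P y where P: "P \<in> F" "patch T x 1 = P \<ominus> y" using F(2) T by blast
    then have "P \<in> F'" using T unfolding F'_def by blast
    have "t \<in> patch T x 1" using t x by (auto simp: mem_patch intro!: bexI[of _ x])
    moreover have "shift_piece v t \<in> patch T x 1"
      using t x v r1 by (auto simp: mem_patch dist_norm intro!: bexI[of _ x])
    ultimately have "shift_piece (- y) t \<in> P" "shift_piece v (shift_piece (- y) t) \<in> P"
      using P(2) by (simp_all add: mem_translate add.commute)
    then have "v \<in> V" unfolding V_def using \<open>P \<in> F'\<close> by blast
    then have "v \<noteq> 0 \<Longrightarrow> r \<le> norm v" using \<open>finite V\<close> by (simp add: r_def)
    then show "v = 0" using v by force
  qed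
  ultimately show ?thesis by blast
qed

lemma rigid:
  "\<exists>R>0. \<exists>r>0. \<forall>T\<in>\<Omega>. \<forall>z z'. agree R (T \<ominus> z) (T \<ominus> z') \<longrightarrow> norm (z - z') < r \<longrightarrow> z = z'"
proof -
  obtain R where R: "R > 0" "\<forall>T\<in>\<Omega>. patch T 0 R \<noteq> {}" using uniform_meets_ball by blast
  obtain r where r: "r > 0" "\<forall>T\<in>\<Omega>. \<forall>t\<in>T. \<forall>v. shift_piece v t \<in> T \<longrightarrow> norm v < r \<longrightarrow> v = 0"
    using discrete_shifts by blast
  have "z = z'" if T: "T \<in> \<Omega>" and ag: "agree R (T \<ominus> z) (T \<ominus> z')" and zz: "norm (z - z') < r" for T z z'
  proof -
    obtain t where "t \<in> patch (T \<ominus> z) 0 R" using R(2) translate_closed[OF T] by blast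
    then have "t \<in> T \<ominus> z" "t \<in> T \<ominus> z'" using ag by (auto simp: agree_def mem_patch_0)
    then have "shift_piece (- z) t \<in> T" "shift_piece (z - z') (shift_piece (- z) t) \<in> T"
      by (simp_all add: mem_translate)
    then have "z - z' = 0" using r(2) T zz by blast
    then show ?thesis by simp
  qed
  then show ?thesis using R(1) r(1) by blast
qed

lemma agree_everywhere_eq: "T \<in> \<Omega> \<Longrightarrow> T' \<in> \<Omega> \<Longrightarrow> (\<And>R. R > 0 \<Longrightarrow> agree R T T') \<Longrightarrow> T = T'"
  using agree_everywhere[of T T'] nonempty_piece by blast

lemma Hausdorff: "Hausdorff_space X"
  unfolding Hausdorff_space_def topspace_pattern_topology
proof (intro allI impI)
  fix S T assume ST: "S \<in> \<Omega> \<and> T \<in> \<Omega> \<and> S \<noteq> T"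
  obtain R0 r where R0: "R0 > 0" and r: "r > 0"
    "\<forall>T\<in>\<Omega>. \<forall>z z'. agree R0 (T \<ominus> z) (T \<ominus> z') \<longrightarrow> norm (z - z') < r \<longrightarrow> z = z'"
    using rigid by blast
  have "\<exists>R>0. \<exists>d>0. cylinder S R d \<inter> cylinder T R d = {}"
  proof (rule ccontr)
    assume "\<not> ?thesis"
    then have no: "R > 0 \<Longrightarrow> d > 0 \<Longrightarrow> cylinder S R d \<inter> cylinder T R d \<noteq> {}" for R d by blast
    \<comment> \<open>Otherwise arbitrarily small shifts of \<open>S\<close> agree with \<open>T\<close> on arbitrarily large balls; by rigidity
      all these shifts coincide, hence vanish.\<close>
    have ex: "\<exists>w. norm w < d \<and> agree R (S \<ominus> w) T" if "R > 0" "d > 0" for R d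
    proof -
      obtain U where "U \<in> cylinder S (R + 2*d) (d/2)" "U \<in> cylinder T (R + 2*d) (d/2)"
        using no[of "R + 2*d" "d/2"] \<open>R > 0\<close> \<open>d > 0\<close> by auto
      then obtain z z' where z: "norm z < d/2" "agree (R + 2*d) (U \<ominus> z) S"
        and z': "norm z' < d/2" "agree (R + 2*d) (U \<ominus> z') T"
        unfolding cylinder_def by blast
      let ?w = "z' - z"
      have w: "norm ?w < d" using z(1) z'(1) norm_triangle_ineq4[of z' z] by linarith
      have "agree R (U \<ominus> z \<ominus> ?w) (S \<ominus> ?w)"
        by (rule agree_translate[OF z(2)]) (use w \<open>d > 0\<close> in linarith)
      moreover have "agree R (U \<ominus> z') T" by (rule agree_mono[OF z'(2)]) (use \<open>d > 0\<close> in linarith)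
      ultimately have "agree R (S \<ominus> ?w) T" using agree_sym agree_trans by fastforce
      then show ?thesis using w by blast
    qed
    obtain w where w: "norm w < r/2" "agree R0 (S \<ominus> w) T" using ex[OF R0, of "r/2"] r by auto
    have "w = 0"
    proof (rule ccontr)
      assume "w \<noteq> 0"
      then obtain w' where w': "norm w' < min (r/2) (norm w)" "agree R0 (S \<ominus> w') T"
        using ex[OF R0, of "min (r/2) (norm w)"] r by auto
      have "agree R0 (S \<ominus> w) (S \<ominus> w')" using w w' agree_sym agree_trans by blast
      moreover have "norm (w - w') < r" using w w' norm_triangle_ineq4[of w w'] by linarith
      ultimately have "w = w'" using r ST by blast
      then show False using w' by simp
    qed
    have "agree R S T" if "R > 0" for R
    proof -
      obtain w' where w': "norm w' < r/2" "agree (max R R0) (S \<ominus> w') T"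
        using ex[of "max R R0" "r/2"] r R0 less_max_iff_disj[of 0 R R0] half_gt_zero[OF r(1)] by blast
      have "agree R0 (S \<ominus> w') T" by (rule agree_mono[OF w'(2)]) simp
      then have "agree R0 (S \<ominus> w) (S \<ominus> w')" using w agree_sym agree_trans by blast
      moreover have "norm (w - w') < r" using w w' norm_triangle_ineq4[of w w'] by linarith
      ultimately have "w = w'" using r ST by blast
      then show ?thesis using w'(2) \<open>w = 0\<close> agree_mono[of "max R R0" S T R] by simp
    qed
    then show False using agree_everywhere_eq ST by blast
  qed
  then obtain R d where "R > 0" "d > 0" "cylinder S R d \<inter> cylinder T R d = {}" by blast
  then show "\<exists>U V. openin X U \<and> openin X V \<and> S \<in> U \<and> T \<in> V \<and> disjnt U V"
    by (intro exI[of _ "cylinder S R d"] exI[of _ "cylinder T R d"])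
      (simp add: openin_cylinder cylinder_self ST disjnt_def)
qed

end

section \<open>Flow boxes\<close>

lemma flow_box_function_shape:
  assumes "inj_on (\<lambda>(S, x). S \<ominus> x) (\<Xi> \<times> ball 0 \<epsilon>)" "S \<in> \<Xi>" "norm x < \<epsilon>"
  shows "flow_box_function shape_cocycle (\<Xi>, \<epsilon>) (S \<ominus> x) = x"
  using the_inv_into_f_f[OF assms(1), of "(S, x)"] assms(2,3)
  by (simp add: flow_box_function_def shape_cocycle_def)

text \<open>
  The occurrences of the central patch of \<open>T0\<close> in \<open>T\<close>. The constant label has type \<open>real\<close> because
  FLC transversals are defined through Delone sets with real labels.
\<close>

definition return_set ::
    "('a::euclidean_space, 'l) pattern \<Rightarrow> real \<Rightarrow> ('a, 'l) pattern \<Rightarrow> ('a, real) pattern" where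
  "return_set T0 R T = {({x}, 0) | x. agree R (T \<ominus> x) T0}"

lemma mem_return_set: "({x}, l) \<in> return_set T0 R T \<longleftrightarrow> l = 0 \<and> agree R (T \<ominus> x) T0"
  by (auto simp: return_set_def)

lemma mem_return_setE:
  assumes "t \<in> return_set T0 R T"
  obtains x where "t = ({x}, 0)" "agree R (T \<ominus> x) T0"
  using assms by (auto simp: return_set_def)

lemma return_set_translate: "return_set T0 R (T \<ominus> y) = return_set T0 R T \<ominus> y"
proof -
  have "t \<in> return_set T0 R (T \<ominus> y) \<longleftrightarrow> t \<in> return_set T0 R T \<ominus> y" for t :: "'a set \<times> real"
  proof
    assume "t \<in> return_set T0 R (T \<ominus> y)"
    then obtain x where "t = ({x}, 0)" "agree R (T \<ominus> y \<ominus> x) T0" by (rule mem_return_setE)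
    then show "t \<in> return_set T0 R T \<ominus> y"
      by (simp add: mem_translate shift_piece_def mem_return_set add.commute)
  next
    assume "t \<in> return_set T0 R T \<ominus> y"
    then obtain x where x: "shift_piece (- y) t = ({x}, 0)" "agree R (T \<ominus> x) T0"
      unfolding mem_translate by (rule mem_return_setE)
    have "t = shift_piece y (shift_piece (- y) t)" by simp
    then have "t = ({x - y}, 0)" unfolding x(1) by (simp add: shift_piece_def)
    then show "t \<in> return_set T0 R (T \<ominus> y)" using x(2) by (simp add: mem_return_set)
  qed
  then show ?thesis by blast
qed

lemma agree_return_set:
  assumes "agree (R' + R) T T'"
  shows "agree R' (return_set T0 R T) (return_set T0 R T')"
proof -
  have "t \<in> return_set T0 R T'" if t: "t \<in> return_set T0 R T" "\<exists>a\<in>fst t. norm a < R'" "agree (R' + R) T T'"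
    for t and T T' :: "('a, 'b) pattern"
  proof -
    obtain x where x: "t = ({x}, 0)" "agree R (T \<ominus> x) T0" using t(1) by (rule mem_return_setE)
    then have "norm x < R'" using t(2) by simp
    then have "agree R (T' \<ominus> x) (T \<ominus> x)" using agree_translate[OF agree_sym[OF t(3)], of R x] by simp
    then have "agree R (T' \<ominus> x) T0" using x(2) by (rule agree_trans)
    then show ?thesis unfolding x(1) mem_return_set by simp
  qed
  note * = this
  show ?thesis
    unfolding agree_iff
    by (intro allI impI iffI) (erule (1) *[OF _ _ assms], erule (1) *[OF _ _ agree_sym[OF assms]])
qed

context flc_space
begin

text \<open>Every orbit visits the cylinder of \<open>T0\<close> by minimality, within bounded distance by compactness.\<close>

lemma relatively_dense_returns:
  assumes T0: "T0 \<in> \<Omega>"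
  shows "\<exists>M>0. \<forall>T\<in>\<Omega>. \<exists>x. norm x \<le> M \<and> agree R (T \<ominus> x) T0"
proof -
  have "\<exists>v. agree R (T \<ominus> v) T0" if T: "T \<in> \<Omega>" for T
  proof -
    have "T0 \<in> X closure_of (range (\<lambda>x. T \<ominus> x))"
      using minimal T0 T unfolding minimal_space_def by blast
    then obtain x where "T \<ominus> x \<in> cylinder T0 R 1"
      unfolding in_closure_of using openin_cylinder[of T0 R 1] cylinder_self[OF T0, of 1 R] by auto
    then show ?thesis unfolding cylinder_def by auto
  qed
  then have "\<forall>T\<in>\<Omega>. \<exists>v. agree R (T \<ominus> v) T0" by blast
  from this[unfolded bchoice_iff] obtain v where v: "\<And>T. T \<in> \<Omega> \<Longrightarrow> agree R (T \<ominus> v T) T0" by blast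
  obtain F where F: "finite F" "F \<subseteq> \<Omega>" "\<And>S. S \<in> \<Omega> \<Longrightarrow> \<exists>T\<in>F. S \<in> cylinder T (R + norm (v T)) 1"
    using finite_cylinder_cover[of "\<lambda>_. 1" "\<lambda>T. R + norm (v T)"] by auto
  define M where "M = Max (insert 0 ((\<lambda>T. norm (v T)) ` F))"
  have M: "norm (v T) \<le> M" if "T \<in> F" for T using F(1) that by (simp add: M_def)
  have "M \<ge> 0" using F(1) by (simp add: M_def)
  have "\<exists>x. norm x \<le> M + 1 \<and> agree R (S \<ominus> x) T0" if S: "S \<in> \<Omega>" for S
  proof -
    obtain T z where T: "T \<in> F" and z: "norm z < 1" "agree (R + norm (v T)) (S \<ominus> z) T"
      using F(3)[OF S] unfolding cylinder_def by blast
    have "agree R (S \<ominus> z \<ominus> v T) (T \<ominus> v T)" by (rule agree_translate[OF z(2)]) simp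
    then have "agree R (S \<ominus> (z + v T)) T0" using v T F(2) agree_trans by fastforce
    moreover have "norm (z + v T) \<le> M + 1"
      using z(1) M[OF T] norm_triangle_ineq[of z "v T"] by linarith
    ultimately show ?thesis by blast
  qed
  then show ?thesis using \<open>M \<ge> 0\<close> by (intro exI[of _ "M + 1"]) auto
qed

text \<open>
  Recording the occurrences of the central patch of \<open>T0\<close> is a local derivation onto a space of Delone
  sets: rigidity makes the occurrences uniformly discrete, minimality makes them relatively dense.
  The patterns that agree with \<open>T0\<close> on the patch thus form an FLC transversal, and by rigidity
  a cylinder of small width is a product over it.
\<close>

lemma flow_box_exists:
  assumes T0: "T0 \<in> \<Omega>"
  shows "\<exists>u\<in>flow_boxes \<Omega>. T0 \<in> flow_box u"
proof -
  obtain R r where R: "R > 0" and r: "r > 0"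
    and rig: "\<forall>T\<in>\<Omega>. \<forall>z z'. agree R (T \<ominus> z) (T \<ominus> z') \<longrightarrow> norm (z - z') < r \<longrightarrow> z = z'"
    using rigid by blast
  obtain M where M: "M > 0" "\<forall>T\<in>\<Omega>. \<exists>x. norm x \<le> M \<and> agree R (T \<ominus> x) T0"
    using relatively_dense_returns[OF T0, of R] by blast
  let ?D = "return_set T0 R"
  define \<Omega>0 where "\<Omega>0 = ?D ` \<Omega>"
  have del: "delone (?D T)" if T: "T \<in> \<Omega>" for T
    unfolding delone_def
  proof (intro conjI)
    show "\<forall>t\<in>?D T. \<exists>x. fst t = {x}" by (auto elim: mem_return_setE)
    show "\<exists>r>0. \<forall>x l y m. ({x}, l) \<in> ?D T \<and> ({y}, m) \<in> ?D T \<and> ({x}, l) \<noteq> ({y}, m) \<longrightarrow> r \<le> dist x y"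
    proof (intro exI[of _ r] conjI allI impI)
      fix x l y m assume *: "({x}, l) \<in> ?D T \<and> ({y}, m) \<in> ?D T \<and> ({x}, l) \<noteq> ({y}, m)"
      then have "x \<noteq> y" "agree R (T \<ominus> x) T0" "agree R (T \<ominus> y) T0" by (auto simp: mem_return_set)
      moreover from this have "agree R (T \<ominus> x) (T \<ominus> y)" using agree_sym agree_trans by blast
      ultimately show "r \<le> dist x y" using rig T unfolding dist_norm by (meson not_le)
    qed (rule r)
    show "\<exists>R>0. \<forall>y. \<exists>x l. ({x}, l) \<in> ?D T \<and> dist x y \<le> R"
    proof (intro exI[of _ M] conjI allI)
      fix y
      obtain x where "norm x \<le> M" "agree R (T \<ominus> y \<ominus> x) T0" using M(2) translate_closed[OF T] by blast
      then have "({y + x}, 0) \<in> ?D T \<and> dist (y + x) y \<le> M" by (simp add: mem_return_set dist_norm)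
      then show "\<exists>x l. ({x}, l) \<in> ?D T \<and> dist x y \<le> M" by blast
    qed (rule M)
  qed
  have cont: "continuous_map X (pattern_topology \<Omega>0) ?D"
    unfolding continuous_map_def topspace_pattern_topology
  proof (intro conjI allI impI)
    show "?D \<in> \<Omega> \<rightarrow> \<Omega>0" by (simp add: \<Omega>0_def)
    fix U assume U: "openin (pattern_topology \<Omega>0) U"
    show "openin X {T \<in> \<Omega>. ?D T \<in> U}"
      unfolding openin_iff
    proof (intro conjI ballI)
      fix T assume T: "T \<in> {T \<in> \<Omega>. ?D T \<in> U}"
      then obtain \<epsilon> where e: "\<epsilon> > 0" "\<forall>T'\<in>\<Omega>0. close \<epsilon> (?D T) T' \<longrightarrow> T' \<in> U"
        using U unfolding openin_pattern_topology by blast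
      have "T' \<in> {T \<in> \<Omega>. ?D T \<in> U}" if T': "T' \<in> cylinder T (1/\<epsilon> + \<epsilon> + R) \<epsilon>" for T'
      proof -
        obtain z where z: "T' \<in> \<Omega>" "norm z < \<epsilon>" "agree (1/\<epsilon> + \<epsilon> + R) (T' \<ominus> z) T"
          using T' unfolding cylinder_def by blast
        have "agree (1/\<epsilon> + \<epsilon>) (?D T' \<ominus> z) (?D T)"
          using agree_return_set[OF z(3)] by (simp add: return_set_translate)
        moreover have "\<forall>t\<in>?D T. fst t \<noteq> {}" by (auto elim: mem_return_setE)
        ultimately have "close \<epsilon> (?D T) (?D T')"
          using agree_imp_close e(1) z(2) by (metis add_left_mono less_imp_le)
        then show ?thesis using e(2) z(1) by (simp add: \<Omega>0_def)
      qed
      moreover have "1/\<epsilon> + \<epsilon> + R > 0" using e(1) R by (simp add: add_pos_pos)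
      ultimately show "\<exists>R>0. \<exists>d>0. cylinder T R d \<subseteq> {T \<in> \<Omega>. ?D T \<in> U}" using e(1) by blast
    qed simp
  qed
  have "compact_space (pattern_topology \<Omega>0)"
    using image_compactin[OF _ cont, of \<Omega>] compact by (simp add: compact_space_def \<Omega>0_def)
  moreover have "?D T \<ominus> x \<in> \<Omega>0" if "T \<in> \<Omega>" for T x
    using translate_closed[OF that, of x] unfolding \<Omega>0_def return_set_translate[symmetric] by (rule imageI)
  moreover have "\<forall>S\<in>\<Omega>0. snd ` S \<subseteq> {0}" by (auto simp: \<Omega>0_def elim: mem_return_setE)
  ultimately have sd: "space_of_delone_sets \<Omega>0"
    using del unfolding space_of_delone_sets_def \<Omega>0_def
    by (intro conjI exI[of _ "{0}"]) auto
  have ld: "local_derivation \<Omega> \<Omega>0 ?D"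
    unfolding local_derivation_def factor_map_def
  proof (intro conjI allI impI ballI)
    show "continuous_map X (pattern_topology \<Omega>0) ?D" by (rule cont)
    show "?D ` \<Omega> = \<Omega>0" by (simp add: \<Omega>0_def)
    show "?D (T \<ominus> x) = ?D T \<ominus> x" for T x by (rule return_set_translate)
    fix \<rho> :: real assume "\<rho> > 0"
    then have "\<rho> + R > 0" using R by simp
    moreover have "\<forall>T\<in>\<Omega>. \<forall>T'\<in>\<Omega>. patch T 0 (\<rho> + R) = patch T' 0 (\<rho> + R) \<longrightarrow>
        patch (?D T) 0 \<rho> = patch (?D T') 0 \<rho>"
      using agree_return_set[of \<rho> R _ _ T0] unfolding agree_def by blast
    ultimately show "\<exists>R>0. \<forall>T\<in>\<Omega>. \<forall>T'\<in>\<Omega>. patch T 0 R = patch T' 0 R \<longrightarrow> patch (?D T) 0 \<rho> = patch (?D T') 0 \<rho>"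
      by (intro exI conjI)
  qed
  define \<Xi> where "\<Xi> = {T \<in> \<Omega>. agree R T T0}"
  have "\<Xi> = {T \<in> \<Omega>. ?D T \<in> canonical_transversal \<Omega>0}"
    by (auto simp: \<Xi>_def canonical_transversal_def \<Omega>0_def mem_return_set)
  then have tr: "FLC_transversal \<Omega> \<Xi>" unfolding FLC_transversal_def using sd ld by blast
  have inj: "inj_on (\<lambda>(S, x). S \<ominus> x) (\<Xi> \<times> ball 0 (r/2))"
  proof (rule inj_onI, clarify)
    fix S x S' x' assume S: "S \<in> \<Xi>" "S' \<in> \<Xi>" and x: "x \<in> ball 0 (r/2)" "x' \<in> ball 0 (r/2)"
      and eq: "S \<ominus> x = S' \<ominus> x'"
    have "S' = S' \<ominus> x' \<ominus> (- x')" by simp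
    then have S': "S' = S \<ominus> (x - x')" unfolding eq[symmetric] by simp
    have "agree R (S \<ominus> (x - x')) (S \<ominus> 0)"
      using S unfolding \<Xi>_def S' by (auto intro: agree_sym agree_trans)
    moreover have "norm (x - x' - 0) < r" using x norm_triangle_ineq4[of x x'] by simp
    ultimately have "x - x' = 0" using rig S(1) unfolding \<Xi>_def by blast
    then show "S = S' \<and> x = x'" using S' by simp
  qed
  have box: "flow_box (\<Xi>, r/2) = cylinder T0 R (r/2)"
  proof (intro equalityI subsetI)
    fix T assume "T \<in> flow_box (\<Xi>, r/2)"
    then obtain S x where "S \<in> \<Xi>" "norm x < r/2" "T = S \<ominus> x" unfolding flow_box_def by auto
    then show "T \<in> cylinder T0 R (r/2)"
      unfolding cylinder_def \<Xi>_def using translate_closed by (auto intro!: exI[of _ "- x"])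
  next
    fix T assume "T \<in> cylinder T0 R (r/2)"
    then obtain z where "T \<in> \<Omega>" "norm z < r/2" "agree R (T \<ominus> z) T0" unfolding cylinder_def by blast
    then have "(T \<ominus> z, - z) \<in> \<Xi> \<times> ball 0 (r/2)" using translate_closed by (simp add: \<Xi>_def)
    then have "(\<lambda>(S, x). S \<ominus> x) (T \<ominus> z, - z) \<in> flow_box (\<Xi>, r/2)"
      unfolding flow_box_def by blast
    then show "T \<in> flow_box (\<Xi>, r/2)" by simp
  qed
  have "(\<Xi>, r/2) \<in> flow_boxes \<Omega>"
    unfolding flow_boxes_def using tr inj r openin_cylinder by (simp add: box)
  moreover have "T0 \<in> flow_box (\<Xi>, r/2)" unfolding box using cylinder_self[OF T0] r by simp
  ultimately show ?thesis by blast
qed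

lemma FLC_transversal_agree:
  assumes "FLC_transversal \<Omega> \<Xi>"
  shows "\<Xi> \<subseteq> \<Omega>" "\<exists>R>0. \<forall>T\<in>\<Xi>. \<forall>T'\<in>\<Omega>. agree R T T' \<longrightarrow> T' \<in> \<Xi>"
proof -
  obtain \<Omega>0 :: "('a, real) pattern set" and \<D> where D: "local_derivation \<Omega> \<Omega>0 \<D>"
      "\<Xi> = {T \<in> \<Omega>. \<D> T \<in> canonical_transversal \<Omega>0}"
    using assms unfolding FLC_transversal_def by blast
  show "\<Xi> \<subseteq> \<Omega>" using D(2) by blast
  obtain R where R: "R > 0" "\<forall>T\<in>\<Omega>. \<forall>T'\<in>\<Omega>. patch T 0 R = patch T' 0 R \<longrightarrow> patch (\<D> T) 0 1 = patch (\<D> T') 0 1"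
    using D(1) unfolding local_derivation_def by (meson zero_less_one)
  have "T' \<in> \<Xi>" if T: "T \<in> \<Xi>" "T' \<in> \<Omega>" "agree R T T'" for T T'
  proof -
    have "T \<in> \<Omega>" using T(1) D(2) by blast
    then have eq: "patch (\<D> T) 0 1 = patch (\<D> T') 0 1" using R(2) T unfolding agree_def by blast
    obtain l where "({0}, l) \<in> \<D> T" using T(1) D(2) unfolding canonical_transversal_def by blast
    then have "({0}, l) \<in> patch (\<D> T) 0 1" by (simp add: mem_patch_0)
    then have "({0}, l) \<in> \<D> T'" unfolding eq by (simp add: mem_patch_0)
    moreover have "\<D> T' \<in> \<Omega>0" using D(1) T(2) unfolding local_derivation_def factor_map_def by blast
    ultimately show ?thesis using D(2) T(2) unfolding canonical_transversal_def by blast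
  qed
  then show "\<exists>R>0. \<forall>T\<in>\<Xi>. \<forall>T'\<in>\<Omega>. agree R T T' \<longrightarrow> T' \<in> \<Xi>" using R(1) by blast
qed

text \<open>
  A flow box is a product of a transversal, on which membership is decided by a patch, and a ball;
  moving by a small vector changes only the coordinate in the ball.
\<close>

lemma flow_box_function_displacement:
  assumes u: "u \<in> flow_boxes \<Omega>" and T: "T \<in> flow_box u"
  shows "\<exists>R>0. \<exists>d>0. \<forall>T'\<in>\<Omega>. \<forall>z. norm z < d \<longrightarrow> agree R (T' \<ominus> z) T \<longrightarrow>
    T' \<in> flow_box u \<and>
    flow_box_function shape_cocycle u T' = flow_box_function shape_cocycle u T - z"
proof -
  obtain \<Xi> \<epsilon> where u_eq: "u = (\<Xi>, \<epsilon>)" by (cases u)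
  then have tr: "FLC_transversal \<Omega> \<Xi>" and inj: "inj_on (\<lambda>(S, x). S \<ominus> x) (\<Xi> \<times> ball 0 \<epsilon>)"
    using u by (auto simp: flow_boxes_def)
  obtain R where R: "R > 0" "\<forall>T\<in>\<Xi>. \<forall>T'\<in>\<Omega>. agree R T T' \<longrightarrow> T' \<in> \<Xi>"
    using FLC_transversal_agree(2)[OF tr] by blast
  obtain S x where S: "S \<in> \<Xi>" "norm x < \<epsilon>" "T = S \<ominus> x" using T unfolding u_eq flow_box_def by auto
  have "T' \<in> flow_box u \<and>
      flow_box_function shape_cocycle u T' = flow_box_function shape_cocycle u T - z"
    if T': "T' \<in> \<Omega>" and z: "norm z < \<epsilon> - norm x" "agree (R + norm x) (T' \<ominus> z) T" for T' z
  proof -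
    define S' where "S' = T' \<ominus> z \<ominus> (- x)"
    have "agree R S' (T \<ominus> (- x))" unfolding S'_def by (rule agree_translate[OF z(2)]) simp
    then have "agree R S S'" using S(3) agree_sym by simp
    then have S': "S' \<in> \<Xi>" using R(2) S(1) translate_closed[OF T', of "z - x"] by (simp add: S'_def)
    have xz: "norm (x - z) < \<epsilon>" using z(1) norm_triangle_ineq4[of x z] by linarith
    have T'_eq: "T' = S' \<ominus> (x - z)" by (simp add: S'_def)
    have "(S', x - z) \<in> \<Xi> \<times> ball 0 \<epsilon>" using S' xz by simp
    then have "(\<lambda>(S, x). S \<ominus> x) (S', x - z) \<in> flow_box u" unfolding u_eq flow_box_def by blast
    then have "T' \<in> flow_box u" using T'_eq by simp
    then show ?thesis
      using flow_box_function_shape[OF inj S' xz] flow_box_function_shape[OF inj S(1,2)]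
      unfolding u_eq T'_eq S(3) by simp
  qed
  moreover have "R + norm x > 0" "\<epsilon> - norm x > 0"
    using R(1) S(2) by (simp_all add: add_pos_nonneg)
  ultimately show ?thesis by blast
qed

lemma openin_flow_box: "u \<in> flow_boxes \<Omega> \<Longrightarrow> openin X (flow_box u)"
  by (auto simp: flow_boxes_def)

end

section \<open>Cech cocycles and their splittings\<close>

lemma locally_constant_onD:
  assumes "locally_constant_on X S f" "openin X S" "x \<in> S"
  shows "\<exists>N. openin X N \<and> x \<in> N \<and> N \<subseteq> S \<and> (\<forall>y\<in>N. f y = f x)"
proof -
  have eq: "topspace (subtopology X S) = S"
    using openin_subset[OF assms(2)] by (rule topspace_subtopology_subset)
  have "openin (subtopology X S) {y \<in> topspace (subtopology X S). f y \<in> {f x}}"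
    using assms(1) unfolding locally_constant_on_def
    by (rule openin_continuous_map_preimage) simp
  then have "openin (subtopology X S) {y \<in> S. f y = f x}" unfolding eq singleton_iff .
  then have "openin X {y \<in> S. f y = f x}"
    using openin_open_subtopology[OF assms(2)] by blast
  then show ?thesis using assms(3) by (intro exI[of _ "{y \<in> S. f y = f x}"]) auto
qed

lemma locally_constant_onI:
  fixes f :: "'x \<Rightarrow> 'b"
  assumes "\<And>x. x \<in> S \<Longrightarrow> \<exists>N. openin X N \<and> x \<in> N \<and> (\<forall>y\<in>N. y \<in> S \<longrightarrow> f y = f x)"
  shows "locally_constant_on X S f"
  unfolding locally_constant_on_def continuous_map_def
proof (intro conjI allI impI)
  fix U :: "'b set"
  show "openin (subtopology X S) {x \<in> topspace (subtopology X S). f x \<in> U}"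
  proof (subst openin_subopen, intro ballI)
    fix x assume x: "x \<in> {x \<in> topspace (subtopology X S). f x \<in> U}"
    then obtain N where N: "openin X N" "x \<in> N" "\<forall>y\<in>N. y \<in> S \<longrightarrow> f y = f x"
      using assms[of x] by auto
    have "openin (subtopology X S) (N \<inter> S)" using N(1) by (auto simp: openin_subtopology)
    moreover have "x \<in> N \<inter> S" using x N by auto
    moreover have "N \<inter> S \<subseteq> {x \<in> topspace (subtopology X S). f x \<in> U}"
      using N x openin_subset[OF N(1)] by auto
    ultimately show "\<exists>T. openin (subtopology X S) T \<and> x \<in> T \<and>
        T \<subseteq> {x \<in> topspace (subtopology X S). f x \<in> U}" by blast
  qed
qed simp

text \<open>
  Over the sheaf of all functions every cocycle is a coboundary. A 0-cochain \<open>f\<close> of arbitrary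
  functions with coboundary \<open>g\<close> records how far \<open>g\<close> is from being a coboundary of locally constant
  functions: only its local variation matters, and that is carried along by cohomologous cocycles.
\<close>

definition splitting ::
    "'i set \<Rightarrow> ('i \<Rightarrow> 'x set) \<Rightarrow> ('i \<Rightarrow> 'i \<Rightarrow> 'x \<Rightarrow> 'b::ab_group_add) \<Rightarrow> ('i \<Rightarrow> 'x \<Rightarrow> 'b) \<Rightarrow> bool" where
  "splitting I U g f \<longleftrightarrow> (\<forall>i\<in>I. \<forall>j\<in>I. \<forall>x \<in> U i \<inter> U j. f i x - f j x = g i j x)"

definition same_variation ::
    "'x topology \<Rightarrow> 'i set \<Rightarrow> ('i \<Rightarrow> 'x set) \<Rightarrow> ('i \<Rightarrow> 'x \<Rightarrow> 'b::ab_group_add) \<Rightarrow>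
     'j set \<Rightarrow> ('j \<Rightarrow> 'x set) \<Rightarrow> ('j \<Rightarrow> 'x \<Rightarrow> 'b) \<Rightarrow> bool" where
  "same_variation X I U f J V f' \<longleftrightarrow>
     (\<forall>i\<in>I. \<forall>j\<in>J. \<forall>x \<in> U i \<inter> V j. \<exists>N. openin X N \<and> x \<in> N \<and> N \<subseteq> U i \<inter> V j \<and>
        (\<forall>y\<in>N. f i y - f' j y = f i x - f' j x))"

lemma same_variationD:
  assumes "same_variation X I U f J V f'" "i \<in> I" "j \<in> J" "x \<in> U i" "x \<in> V j"
  obtains N where "openin X N" "x \<in> N" "N \<subseteq> U i" "N \<subseteq> V j"
    "\<forall>y\<in>N. f i y - f' j y = f i x - f' j x"
proof -
  have "x \<in> U i \<inter> V j" using assms(4,5) by blast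
  then have "\<exists>N. openin X N \<and> x \<in> N \<and> N \<subseteq> U i \<inter> V j \<and>
        (\<forall>y\<in>N. f i y - f' j y = f i x - f' j x)"
    using assms(1-3) unfolding same_variation_def by blast
  then obtain N where N: "openin X N" "x \<in> N" "N \<subseteq> U i \<inter> V j"
      "\<forall>y\<in>N. f i y - f' j y = f i x - f' j x" by (elim exE conjE)
  show ?thesis by (rule that[OF N(1,2)]) (use N(3,4) in auto)
qed

lemma same_variation_trans:
  assumes 1: "same_variation X I U f J V f'" and 2: "same_variation X J V f' K W f''"
    and cover: "(\<Union>j\<in>J. V j) = topspace X" and open_U: "\<And>i. i \<in> I \<Longrightarrow> openin X (U i)"
  shows "same_variation X I U f K W f''"
  unfolding same_variation_def
proof (intro ballI)
  fix i k x assume i: "i \<in> I" and k: "k \<in> K" and x: "x \<in> U i \<inter> W k"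
  have "x \<in> topspace X" using openin_subset[OF open_U[OF i]] x by blast
  then obtain j where j: "j \<in> J" "x \<in> V j" using cover by blast
  have xU: "x \<in> U i" and xW: "x \<in> W k" using x by simp_all
  obtain N where N: "openin X N" "x \<in> N" "N \<subseteq> U i" "N \<subseteq> V j"
      "\<forall>y\<in>N. f i y - f' j y = f i x - f' j x"
    by (rule same_variationD[OF 1 i j(1) xU j(2)])
  obtain M where M: "openin X M" "x \<in> M" "M \<subseteq> V j" "M \<subseteq> W k"
      "\<forall>y\<in>M. f' j y - f'' k y = f' j x - f'' k x"
    by (rule same_variationD[OF 2 j(1) k j(2) xW])
  have "f i y - f'' k y = f i x - f'' k x" if y: "y \<in> N \<inter> M" for y
  proof -
    have "f i y - f'' k y = (f i y - f' j y) + (f' j y - f'' k y)" by simp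
    also have "\<dots> = (f i x - f' j x) + (f' j x - f'' k x)" using N(5) M(5) y by simp
    finally show ?thesis by simp
  qed
  moreover have "openin X (N \<inter> M)" using N(1) M(1) by (rule openin_Int)
  moreover have "x \<in> N \<inter> M" "N \<inter> M \<subseteq> U i \<inter> W k" using N(2,3) M(2,4) by auto
  ultimately show "\<exists>N. openin X N \<and> x \<in> N \<and> N \<subseteq> U i \<inter> W k \<and>
      (\<forall>y\<in>N. f i y - f'' k y = f i x - f'' k x)"
    by (intro exI[of _ "N \<inter> M"] conjI ballI)
qed

lemma same_variation_pullback:
  assumes h: "continuous_map X Y h" and var: "same_variation Y I U f J V f'"
  shows "same_variation X I (\<lambda>i. {x \<in> topspace X. h x \<in> U i}) (\<lambda>i x. f i (h x))
    J (\<lambda>j. {x \<in> topspace X. h x \<in> V j}) (\<lambda>j x. f' j (h x))"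
  unfolding same_variation_def
proof (intro ballI)
  fix i j x assume ij: "i \<in> I" "j \<in> J"
    and x: "x \<in> {x \<in> topspace X. h x \<in> U i} \<inter> {x \<in> topspace X. h x \<in> V j}"
  have hx: "h x \<in> U i" "h x \<in> V j" using x by simp_all
  obtain N where N: "openin Y N" "h x \<in> N" "N \<subseteq> U i" "N \<subseteq> V j"
      "\<forall>y\<in>N. f i y - f' j y = f i (h x) - f' j (h x)"
    by (rule same_variationD[OF var ij hx])
  let ?N = "{x \<in> topspace X. h x \<in> N}"
  have "x \<in> ?N" "?N \<subseteq> {x \<in> topspace X. h x \<in> U i} \<inter> {x \<in> topspace X. h x \<in> V j}"
    using N(2-4) x by auto
  moreover have "\<forall>y\<in>?N. f i (h y) - f' j (h y) = f i (h x) - f' j (h x)" using N(5) by simp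
  ultimately show "\<exists>N. openin X N \<and> x \<in> N \<and>
      N \<subseteq> {x \<in> topspace X. h x \<in> U i} \<inter> {x \<in> topspace X. h x \<in> V j} \<and>
      (\<forall>y\<in>N. f i (h y) - f' j (h y) = f i (h x) - f' j (h x))"
    using openin_continuous_map_preimage[OF h N(1)] by blast
qed

text \<open>
  On a member \<open>W\<close> of the common refinement the functions \<open>f (\<rho> W) - b W\<close> have coboundary \<open>g'\<close>; from
  there \<open>g'\<close> itself extends them to all of \<open>V j\<close>. Both corrections \<open>b\<close> and \<open>g'\<close> are locally constant.
\<close>

lemma splitting_transport:
  fixes f :: "'i \<Rightarrow> 'x \<Rightarrow> 'b::ab_group_add"
  assumes coh: "cech_cohomologous X (I, U, g) (J, V, g')" and f: "splitting I U g f"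
  shows "\<exists>f'. splitting J V g' f' \<and> same_variation X I U f J V f'"
proof -
  have cU: "\<And>i. i \<in> I \<Longrightarrow> openin X (U i)"
      "\<And>i j. i \<in> I \<Longrightarrow> j \<in> I \<Longrightarrow> locally_constant_on X (U i \<inter> U j) (g i j)"
    using coh by auto
  have cV: "\<And>j. j \<in> J \<Longrightarrow> openin X (V j)"
      "\<And>i j. i \<in> J \<Longrightarrow> j \<in> J \<Longrightarrow> locally_constant_on X (V i \<inter> V j) (g' i j)"
      "\<And>i j k x. i \<in> J \<Longrightarrow> j \<in> J \<Longrightarrow> k \<in> J \<Longrightarrow> x \<in> V i \<Longrightarrow> x \<in> V j \<Longrightarrow> x \<in> V k \<Longrightarrow>
        g' i j x + g' j k x = g' i k x"
    using coh by auto
  obtain \<W> \<rho> \<sigma> b where W: "\<And>W. W \<in> \<W> \<Longrightarrow> openin X W" "\<Union>\<W> = topspace X"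
      "\<And>W. W \<in> \<W> \<Longrightarrow> \<rho> W \<in> I \<and> W \<subseteq> U (\<rho> W) \<and> \<sigma> W \<in> J \<and> W \<subseteq> V (\<sigma> W)"
      "\<And>W. W \<in> \<W> \<Longrightarrow> locally_constant_on X W (b W)"
      "\<And>W W' x. W \<in> \<W> \<Longrightarrow> W' \<in> \<W> \<Longrightarrow> x \<in> W \<Longrightarrow> x \<in> W' \<Longrightarrow>
         g (\<rho> W) (\<rho> W') x - g' (\<sigma> W) (\<sigma> W') x = b W x - b W' x"
  proof -
    obtain \<W> \<rho> \<sigma> b where W: "\<forall>W\<in>\<W>. openin X W" "\<Union>\<W> = topspace X"
      "\<forall>W\<in>\<W>. \<rho> W \<in> I \<and> W \<subseteq> U (\<rho> W) \<and> \<sigma> W \<in> J \<and> W \<subseteq> V (\<sigma> W)"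
      "\<forall>W\<in>\<W>. locally_constant_on X W (b W)"
      "\<forall>W\<in>\<W>. \<forall>W'\<in>\<W>. \<forall>x \<in> W \<inter> W'.
           g (\<rho> W) (\<rho> W') x - g' (\<sigma> W) (\<sigma> W') x = b W x - b W' x"
      using coh unfolding cech_cohomologous.simps by (elim exE conjE) (rule that)
    show ?thesis by (rule that[of \<W> \<rho> \<sigma> b]) (use W in simp_all)
  qed
  have "\<forall>x\<in>topspace X. \<exists>W. W \<in> \<W> \<and> x \<in> W" using W(2) by blast
  from this[unfolded bchoice_iff] obtain w where w: "\<And>x. x \<in> topspace X \<Longrightarrow> w x \<in> \<W> \<and> x \<in> w x"
    by blast
  define f' where "f' j x = f (\<rho> (w x)) x - b (w x) x + g' j (\<sigma> (w x)) x" for j x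
  \<comment> \<open>The definition does not depend on the chosen member of the refinement.\<close>
  have f'_eq: "f' j x = f (\<rho> W) x - b W x + g' j (\<sigma> W) x"
    if j: "j \<in> J" "x \<in> V j" and Wx: "W \<in> \<W>" "x \<in> W" for j x W
  proof -
    have "x \<in> topspace X" using W(2) Wx by blast
    then have wx: "w x \<in> \<W>" "x \<in> w x" using w by blast+
    have "f (\<rho> (w x)) x - f (\<rho> W) x = g (\<rho> (w x)) (\<rho> W) x"
      using f W(3)[OF wx(1)] W(3)[OF Wx(1)] wx(2) Wx(2) unfolding splitting_def by blast
    then have "f (\<rho> (w x)) x = f (\<rho> W) x + g (\<rho> (w x)) (\<rho> W) x" by (simp add: algebra_simps)
    moreover have "g (\<rho> (w x)) (\<rho> W) x - g' (\<sigma> (w x)) (\<sigma> W) x = b (w x) x - b W x"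
      using W(5) wx Wx by blast
    then have "b (w x) x = b W x + (g (\<rho> (w x)) (\<rho> W) x - g' (\<sigma> (w x)) (\<sigma> W) x)" by simp
    moreover have "g' j (\<sigma> (w x)) x + g' (\<sigma> (w x)) (\<sigma> W) x = g' j (\<sigma> W) x"
      by (rule cV(3)) (use W(3)[OF wx(1)] W(3)[OF Wx(1)] wx(2) Wx(2) j in auto)
    then have "g' j (\<sigma> W) x = g' j (\<sigma> (w x)) x + g' (\<sigma> (w x)) (\<sigma> W) x" by simp
    ultimately show ?thesis unfolding f'_def by simp
  qed
  have "splitting J V g' f'"
    unfolding splitting_def
  proof (intro ballI)
    fix i j x assume ij: "i \<in> J" "j \<in> J" and x: "x \<in> V i \<inter> V j"
    have "x \<in> topspace X" using openin_subset[OF cV(1)[OF ij(1)]] x by blast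
    then have wx: "w x \<in> \<W>" "x \<in> w x" using w by blast+
    have "g' i j x + g' j (\<sigma> (w x)) x = g' i (\<sigma> (w x)) x"
      by (rule cV(3)) (use W(3)[OF wx(1)] wx(2) ij x in auto)
    then show "f' i x - f' j x = g' i j x" unfolding f'_def by (simp add: algebra_simps)
  qed
  moreover have "same_variation X I U f J V f'"
    unfolding same_variation_def
  proof (intro ballI)
    fix i j x assume i: "i \<in> I" and j: "j \<in> J" and x: "x \<in> U i \<inter> V j"
    have "x \<in> topspace X" using openin_subset[OF cU(1)[OF i]] x by blast
    then obtain W where WW: "W \<in> \<W>" "x \<in> W" using W(2) by blast
    note r = W(3)[OF WW(1)]
    have diff: "f i y - f' j y = g i (\<rho> W) y + b W y - g' j (\<sigma> W) y"
      if y: "y \<in> U i" "y \<in> V j" "y \<in> W" for y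
    proof -
      have "f i y - f (\<rho> W) y = g i (\<rho> W) y" using f i r y unfolding splitting_def by blast
      then show ?thesis using f'_eq[OF j y(2) WW(1) y(3)] by (simp add: algebra_simps)
    qed
    obtain N1 where N1: "openin X N1" "x \<in> N1" "N1 \<subseteq> U i \<inter> U (\<rho> W)" "\<forall>y\<in>N1. g i (\<rho> W) y = g i (\<rho> W) x"
      using locally_constant_onD[OF cU(2)[of i "\<rho> W"] openin_Int[OF cU(1) cU(1)], of x] i r x WW(2) by blast
    obtain N2 where N2: "openin X N2" "x \<in> N2" "N2 \<subseteq> V j \<inter> V (\<sigma> W)" "\<forall>y\<in>N2. g' j (\<sigma> W) y = g' j (\<sigma> W) x"
      using locally_constant_onD[OF cV(2)[of j "\<sigma> W"] openin_Int[OF cV(1) cV(1)], of x] j r x WW(2) by blast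
    obtain N3 where N3: "openin X N3" "x \<in> N3" "N3 \<subseteq> W" "\<forall>y\<in>N3. b W y = b W x"
      using locally_constant_onD[OF W(4) W(1)] WW by blast
    let ?N = "N1 \<inter> N2 \<inter> N3"
    have "f i y - f' j y = f i x - f' j x" if "y \<in> ?N" for y
    proof -
      have y: "y \<in> N1" "y \<in> N2" "y \<in> N3" using that by simp_all
      have "f i y - f' j y = g i (\<rho> W) y + b W y - g' j (\<sigma> W) y"
        by (rule diff) (use y N1(3) N2(3) N3(3) in blast)+
      also have "\<dots> = g i (\<rho> W) x + b W x - g' j (\<sigma> W) x"
        using y N1(4) N2(4) N3(4) by simp
      also have "\<dots> = f i x - f' j x" by (rule diff[symmetric]) (use x WW(2) in blast)+
      finally show ?thesis .
    qed
    moreover have "openin X ?N" using N1(1) N2(1) N3(1) by (intro openin_Int)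
    moreover have "x \<in> ?N" "?N \<subseteq> U i \<inter> V j" using N1(2,3) N2(2,3) N3(2) by auto
    ultimately show "\<exists>N. openin X N \<and> x \<in> N \<and> N \<subseteq> U i \<inter> V j \<and>
        (\<forall>y\<in>N. f i y - f' j y = f i x - f' j x)"
      by (intro exI[of _ ?N] conjI ballI)
  qed
  ultimately show ?thesis by blast
qed

text \<open>
  Classes contain only cocycles indexed by subsets of the space, so that a cocycle with other indices
  has to be reindexed by the members of its cover.
\<close>

lemma cech_class_nonempty:
  fixes g :: "'i \<Rightarrow> 'i \<Rightarrow> 'x \<Rightarrow> 'b::ab_group_add"
  assumes c: "cech_cocycle X (I, U, g)"
  shows "cech_class X (I, U, g) \<noteq> {}"
proof -
  define \<iota> where "\<iota> W = (SOME i. i \<in> I \<and> U i = W)" for W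
  have i: "\<iota> W \<in> I" "U (\<iota> W) = W" if "W \<in> U ` I" for W
  proof -
    have "\<exists>i. i \<in> I \<and> U i = W" using that by blast
    then have "\<iota> W \<in> I \<and> U (\<iota> W) = W" unfolding \<iota>_def by (rule someI_ex)
    then show "\<iota> W \<in> I" "U (\<iota> W) = W" by blast+
  qed
  define g' where "g' V W = g (\<iota> V) (\<iota> W)" for V W
  have op: "\<forall>W\<in>U ` I. openin X W" and cov: "\<Union>(U ` I) = topspace X" using c by auto
  have "locally_constant_on X (V \<inter> W) (g' V W)" if "V \<in> U ` I" "W \<in> U ` I" for V W
    using c i[OF that(1)] i[OF that(2)] unfolding g'_def by force
  moreover have "g' V W x + g' W Z x = g' V Z x"
    if V: "V \<in> U ` I" and W: "W \<in> U ` I" and Z: "Z \<in> U ` I" and x: "x \<in> V \<inter> W \<inter> Z" for V W Z x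
  proof -
    have "x \<in> U (\<iota> V) \<inter> U (\<iota> W) \<inter> U (\<iota> Z)" using i V W Z x by simp
    then show ?thesis using c i(1)[OF V] i(1)[OF W] i(1)[OF Z] unfolding g'_def by simp
  qed
  ultimately have "cech_cocycle X (U ` I, \<lambda>W. W, g')" using op cov by simp
  moreover have "locally_constant_on X W (\<lambda>x. 0::'b)" if "W \<in> U ` I" for W
    using op that by (intro locally_constant_onI) auto
  ultimately have "cech_cohomologous X (I, U, g) (U ` I, \<lambda>W. W, g')"
    using c op cov i unfolding cech_cohomologous.simps
    by (intro conjI exI[of _ "U ` I"] exI[of _ \<iota>] exI[of _ "\<lambda>W. W"] exI[of _ "\<lambda>_ _. 0"])
      (simp_all add: g'_def)
  then show ?thesis unfolding cech_class_def by blast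
qed

lemma cech_cocycle_pullback:
  assumes h: "continuous_map X Y h" and c: "cech_cocycle Y (I, U, g)"
  shows "cech_cocycle X (cech_pullback_cochain X h (I, U, g))"
proof -
  have hY: "h x \<in> topspace Y" if "x \<in> topspace X" for x using h that by (auto simp: continuous_map_def)
  have op: "openin Y (U i)" if "i \<in> I" for i using c that by simp
  have "locally_constant_on X ({x \<in> topspace X. h x \<in> U i} \<inter> {x \<in> topspace X. h x \<in> U j}) (\<lambda>x. g i j (h x))"
    if ij: "i \<in> I" "j \<in> I" for i j
  proof (rule locally_constant_onI)
    fix x assume x: "x \<in> {x \<in> topspace X. h x \<in> U i} \<inter> {x \<in> topspace X. h x \<in> U j}"
    have "locally_constant_on Y (U i \<inter> U j) (g i j)" using c ij by simp
    then obtain N where N: "openin Y N" "h x \<in> N" "\<forall>y\<in>N. g i j y = g i j (h x)"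
      using locally_constant_onD[OF _ openin_Int[OF op op], of i j "g i j" "h x"] ij x by blast
    have "x \<in> {x \<in> topspace X. h x \<in> N}" using N(2) x by simp
    then show "\<exists>N. openin X N \<and> x \<in> N \<and> 
        (\<forall>y\<in>N. y \<in> {x \<in> topspace X. h x \<in> U i} \<inter> {x \<in> topspace X. h x \<in> U j} \<longrightarrow>
          g i j (h y) = g i j (h x))"
      using openin_continuous_map_preimage[OF h N(1)] N(3) by blast
  qed
  moreover have "openin X {x \<in> topspace X. h x \<in> U i}" if "i \<in> I" for i
    using openin_continuous_map_preimage[OF h op[OF that]] .
  moreover have "(\<Union>i\<in>I. {x \<in> topspace X. h x \<in> U i}) = topspace X"
  proof -
    have "(\<Union>i\<in>I. U i) = topspace Y" using c by simp
    then show ?thesis using hY by blast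
  qed
  moreover have "\<forall>i\<in>I. \<forall>j\<in>I. \<forall>k\<in>I. \<forall>x \<in> U i \<inter> U j \<inter> U k. g i j x + g j k x = g i k x"
    using c by simp
  ultimately show ?thesis by simp
qed

context flc_space
begin

lemma cech_cocycle_shape: "cech_cocycle X (cech_cochain_of_strong \<Omega> shape_cocycle)"
proof -
  let ?c = "flow_box_function shape_cocycle"
  have "locally_constant_on X (flow_box u \<inter> flow_box v) (\<lambda>T. ?c u T - ?c v T)"
    if u: "u \<in> flow_boxes \<Omega>" and v: "v \<in> flow_boxes \<Omega>" for u v
  proof (rule locally_constant_onI)
    fix T assume T: "T \<in> flow_box u \<inter> flow_box v"
    then have T\<Omega>: "T \<in> \<Omega>" using openin_subset[OF openin_flow_box[OF u]] by auto
    obtain R d where Rd: "d > 0"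
      "\<forall>T'\<in>\<Omega>. \<forall>z. norm z < d \<longrightarrow> agree R (T' \<ominus> z) T \<longrightarrow> T' \<in> flow_box u \<and> ?c u T' = ?c u T - z"
      using flow_box_function_displacement[OF u] T by blast
    obtain R' d' where Rd': "d' > 0"
      "\<forall>T'\<in>\<Omega>. \<forall>z. norm z < d' \<longrightarrow> agree R' (T' \<ominus> z) T \<longrightarrow> T' \<in> flow_box v \<and> ?c v T' = ?c v T - z"
      using flow_box_function_displacement[OF v] T by blast
    have "?c u T' - ?c v T' = ?c u T - ?c v T" if T': "T' \<in> cylinder T (max R R') (min d d')" for T'
    proof -
      obtain z where z: "T' \<in> \<Omega>" "norm z < min d d'" "agree (max R R') (T' \<ominus> z) T"
        using T' unfolding cylinder_def by blast
      have "agree R (T' \<ominus> z) T" "agree R' (T' \<ominus> z) T" by (rule agree_mono[OF z(3)], simp)+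
      then have "?c u T' = ?c u T - z" "?c v T' = ?c v T - z" using Rd(2) Rd'(2) z(1,2) by auto
      then show ?thesis by simp
    qed
    moreover have "T \<in> cylinder T (max R R') (min d d')"
      using cylinder_self[OF T\<Omega>] Rd(1) Rd'(1) by simp
    ultimately show "\<exists>N. openin X N \<and> T \<in> N \<and> (\<forall>T'\<in>N. T' \<in> flow_box u \<inter> flow_box v \<longrightarrow>
        ?c u T' - ?c v T' = ?c u T - ?c v T)"
      using openin_cylinder by blast
  qed
  moreover have "(\<Union>u\<in>flow_boxes \<Omega>. flow_box u) = \<Omega>"
    using flow_box_exists openin_subset[OF openin_flow_box] by fastforce
  ultimately show ?thesis
    unfolding cech_cochain_of_strong_def by (simp add: openin_flow_box)
qed

lemma shape_pullback_nonempty: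
  assumes h: "continuous_map Z X h"
  shows "cech_pullback Z h (shape_class \<Omega>) \<noteq> {}"
proof -
  obtain c where c: "c \<in> shape_class \<Omega>"
    using cech_class_nonempty cech_cocycle_shape unfolding shape_class_def cech_cochain_of_strong_def by blast
  obtain J V g where c_eq: "c = (J, V, g)" by (cases c)
  have "cech_cocycle X (J, V, g)"
    using c unfolding shape_class_def cech_class_def cech_cochain_of_strong_def c_eq by simp
  then have "cech_cocycle Z (cech_pullback_cochain Z h c)"
    unfolding c_eq by (rule cech_cocycle_pullback[OF h])
  then have "cech_class Z (cech_pullback_cochain Z h c) \<noteq> {}"
    unfolding c_eq cech_pullback_cochain.simps by (rule cech_class_nonempty)
  then show ?thesis using c unfolding cech_pullback_def by blast
qed

text \<open>
  Every representative of the pulled back shape class has a splitting that varies like the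
  coordinates of \<open>h x\<close> in flow boxes.
\<close>

lemma shape_pullback_splitting:
  assumes h: "continuous_map Z X h" and c: "(K, W, \<gamma>) \<in> cech_pullback Z h (shape_class \<Omega>)"
  shows "cech_cocycle Z (K, W, \<gamma>)"
    "\<exists>F. splitting K W \<gamma> F \<and>
      same_variation Z (flow_boxes \<Omega>) (\<lambda>u. {x \<in> topspace Z. h x \<in> flow_box u})
        (\<lambda>u x. flow_box_function shape_cocycle u (h x)) K W F"
proof -
  let ?c = "flow_box_function shape_cocycle"
  obtain c0 where c0: "c0 \<in> shape_class \<Omega>" "(K, W, \<gamma>) \<in> cech_class Z (cech_pullback_cochain Z h c0)"
    using c unfolding cech_pullback_def by (rule UN_E)
  obtain J V g where "c0 = (J, V, g)" by (cases c0)
  then have 1: "(J, V, g) \<in> shape_class \<Omega>"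
      and 2: "(K, W, \<gamma>) \<in> cech_class Z (cech_pullback_cochain Z h (J, V, g))"
    using c0 by simp_all
  show "cech_cocycle Z (K, W, \<gamma>)" using 2 unfolding cech_class_def by simp
  have "splitting (flow_boxes \<Omega>) flow_box (\<lambda>u v T. ?c u T - ?c v T) ?c"
    unfolding splitting_def by simp
  then obtain f where f: "splitting J V g f" "same_variation X (flow_boxes \<Omega>) flow_box ?c J V f"
    using splitting_transport 1 unfolding shape_class_def cech_class_def cech_cochain_of_strong_def by blast
  have "splitting J (\<lambda>j. {x \<in> topspace Z. h x \<in> V j}) (\<lambda>i j x. g i j (h x)) (\<lambda>j x. f j (h x))"
    using f(1) unfolding splitting_def by auto
  then obtain F where F: "splitting K W \<gamma> F"
      "same_variation Z J (\<lambda>j. {x \<in> topspace Z. h x \<in> V j}) (\<lambda>j x. f j (h x)) K W F"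
    using splitting_transport 2 unfolding cech_class_def cech_pullback_cochain.simps by blast
  have cV: "(\<Union>j\<in>J. {x \<in> topspace Z. h x \<in> V j}) = topspace Z"
    using 2 unfolding cech_class_def by simp
  have "same_variation Z (flow_boxes \<Omega>) (\<lambda>u. {x \<in> topspace Z. h x \<in> flow_box u})
        (\<lambda>u x. ?c u (h x)) K W F"
    by (rule same_variation_trans[OF same_variation_pullback[OF h f(2)] F(2) cV])
      (rule openin_continuous_map_preimage[OF h openin_flow_box])
  then show "\<exists>F. splitting K W \<gamma> F \<and>
      same_variation Z (flow_boxes \<Omega>) (\<lambda>u. {x \<in> topspace Z. h x \<in> flow_box u})
        (\<lambda>u x. ?c u (h x)) K W F"
    using F(1) by blast
qed

end

section \<open>Maps that preserve displacements\<close>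

text \<open>
  Passing from \<open>S\<close> to a nearby \<open>S'\<close>, the pieces of \<open>S'\<close> near the origin are those of \<open>S\<close> moved by
  a small vector, and those of \<open>\<phi> S'\<close> are the pieces of \<open>\<phi> S\<close> moved by the same vector.
\<close>

definition displacement_preserving ::
    "('a::euclidean_space, 'l::metric_space) pattern set \<Rightarrow>
     (('a, 'l) pattern \<Rightarrow> ('a, 'm::metric_space) pattern) \<Rightarrow> bool" where
  "displacement_preserving \<Omega> \<phi> \<longleftrightarrow>
     (\<forall>S\<in>\<Omega>. \<forall>R R' d. d > 0 \<longrightarrow> (\<exists>N. openin (pattern_topology \<Omega>) N \<and> S \<in> N \<and>
        (\<forall>S'\<in>N. \<exists>z. norm z < d \<and> agree R (S' \<ominus> z) S \<and> agree R' (\<phi> S' \<ominus> z) (\<phi> S))))"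

locale displacement_map = A: flc_space \<Omega> + B: flc_space \<Omega>'
  for \<Omega> :: "('a::euclidean_space, 'l::metric_space) pattern set"
    and \<Omega>' :: "('a, 'm::metric_space) pattern set" +
  fixes \<phi> :: "('a, 'l) pattern \<Rightarrow> ('a, 'm) pattern"
  assumes maps_to: "S \<in> \<Omega> \<Longrightarrow> \<phi> S \<in> \<Omega>'"
    and preserving: "displacement_preserving \<Omega> \<phi>"
begin

text \<open>
  The vector \<open>z\<close> in the definition depends on \<open>S'\<close> and on the radii. By rigidity it is the only small
  vector for which \<open>S' \<ominus> z\<close> agrees with \<open>S\<close> near the origin, so that any such vector will do.
\<close>

lemma local_at:
  assumes S: "S \<in> \<Omega>"
  shows "\<exists>R>0. \<exists>d>0. \<forall>S'\<in>\<Omega>. \<forall>z. norm z < d \<longrightarrow> agree R (S' \<ominus> z) S \<longrightarrow>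
    agree \<rho> (\<phi> S' \<ominus> z) (\<phi> S)"
proof -
  obtain R0 r where R0: "R0 > 0" and r: "r > 0"
    and rig: "\<forall>T\<in>\<Omega>. \<forall>z z'. agree R0 (T \<ominus> z) (T \<ominus> z') \<longrightarrow> norm (z - z') < r \<longrightarrow> z = z'"
    using A.rigid by blast
  have r2: "r/2 > 0" using r by simp
  obtain N where N: "openin A.X N" "S \<in> N"
      "\<forall>S'\<in>N. \<exists>z. norm z < r/2 \<and> agree R0 (S' \<ominus> z) S \<and> agree \<rho> (\<phi> S' \<ominus> z) (\<phi> S)"
    using preserving[unfolded displacement_preserving_def, rule_format, OF S r2, of R0 \<rho>]
    by (elim exE conjE) (rule that)
  obtain R1 d1 where 1: "R1 > 0" "d1 > 0" "A.cylinder S R1 d1 \<subseteq> N"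
    using N(1,2) unfolding A.openin_iff by blast
  have "agree \<rho> (\<phi> S' \<ominus> z) (\<phi> S)"
    if S': "S' \<in> \<Omega>" and z: "norm z < min d1 (r/2)" "agree (max R1 R0) (S' \<ominus> z) S" for S' z
  proof -
    have ag: "agree R1 (S' \<ominus> z) S" "agree R0 (S' \<ominus> z) S" by (rule agree_mono[OF z(2)], simp)+
    then have "S' \<in> A.cylinder S R1 d1" using S' z(1) unfolding A.cylinder_def by auto
    then obtain w where w: "norm w < r/2" "agree R0 (S' \<ominus> w) S" "agree \<rho> (\<phi> S' \<ominus> w) (\<phi> S)"
      using N(3) 1(3) by blast
    have "agree R0 (S' \<ominus> z) (S' \<ominus> w)" using ag(2) agree_sym[OF w(2)] by (rule agree_trans)
    moreover have "norm (z - w) < r" using z(1) w(1) norm_triangle_ineq4[of z w] by simp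
    ultimately have "z = w" using rig S' by blast
    then show ?thesis using w(3) by simp
  qed
  moreover have "max R1 R0 > 0" "min d1 (r/2) > 0" using 1 R0 r by simp_all
  ultimately show ?thesis by blast
qed

lemma uniformly_local:
  "\<exists>R>0. \<exists>d>0. \<forall>S\<in>\<Omega>. \<forall>S'\<in>\<Omega>. \<forall>z. norm z < d \<longrightarrow> agree R (S' \<ominus> z) S \<longrightarrow>
    agree \<rho> (\<phi> S' \<ominus> z) (\<phi> S)"
proof -
  have "\<forall>S\<in>\<Omega>. \<exists>p. fst p > 0 \<and> snd p > 0 \<and> (\<forall>S'\<in>\<Omega>. \<forall>z. norm z < snd p \<longrightarrow>
      agree (fst p) (S' \<ominus> z) S \<longrightarrow> agree (\<rho> + 1) (\<phi> S' \<ominus> z) (\<phi> S))"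
  proof
    fix S assume "S \<in> \<Omega>"
    then obtain R d where "R > 0" "d > 0" "\<forall>S'\<in>\<Omega>. \<forall>z. norm z < d \<longrightarrow>
        agree R (S' \<ominus> z) S \<longrightarrow> agree (\<rho> + 1) (\<phi> S' \<ominus> z) (\<phi> S)"
      using local_at[of S "\<rho> + 1"] by blast
    then show "\<exists>p. fst p > 0 \<and> snd p > 0 \<and> (\<forall>S'\<in>\<Omega>. \<forall>z. norm z < snd p \<longrightarrow>
      agree (fst p) (S' \<ominus> z) S \<longrightarrow> agree (\<rho> + 1) (\<phi> S' \<ominus> z) (\<phi> S))"
      by (intro exI[of _ "(R, d)"]) simp
  qed
  from this[unfolded bchoice_iff] obtain p where p: "\<forall>S\<in>\<Omega>. fst (p S) > 0 \<and> snd (p S) > 0 \<and>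
      (\<forall>S'\<in>\<Omega>. \<forall>z. norm z < snd (p S) \<longrightarrow>
      agree (fst (p S)) (S' \<ominus> z) S \<longrightarrow> agree (\<rho> + 1) (\<phi> S' \<ominus> z) (\<phi> S))" ..
  define R d where "R S = fst (p S)" and "d S = snd (p S)" for S
  have pos: "R S > 0" "d S > 0" if "S \<in> \<Omega>" for S using p that by (simp_all add: R_def d_def)
  have loc: "agree (\<rho> + 1) (\<phi> S' \<ominus> z) (\<phi> S)"
    if "S \<in> \<Omega>" "S' \<in> \<Omega>" "norm z < d S" "agree (R S) (S' \<ominus> z) S" for S S' z
    using p that by (simp add: R_def d_def)
  have mpos: "min (d S / 2) 1 > 0" if "S \<in> \<Omega>" for S using pos(2)[OF that] by simp
  obtain F where F: "finite F" "F \<subseteq> \<Omega>" "\<And>S. S \<in> \<Omega> \<Longrightarrow> \<exists>T\<in>F. S \<in> A.cylinder T (R T) (min (d T / 2) 1)"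
    using A.finite_cylinder_cover[of "\<lambda>S. min (d S / 2) 1" R] mpos by metis
  define R' where "R' = Max (insert 1 (R ` F)) + 1"
  define d' where "d' = Min (insert 1 ((\<lambda>T. d T / 2) ` F))"
  have R': "R T + 1 \<le> R'" if "T \<in> F" for T using F(1) that by (simp add: R'_def)
  have d': "d' \<le> d T / 2" if "T \<in> F" for T
    unfolding d'_def by (rule Min_le) (use F(1) that in auto)
  have "1 \<le> Max (insert 1 (R ` F))" using F(1) by simp
  then have "R' > 0" by (simp add: R'_def)
  have "d' > 0" using F(1,2) pos(2) by (auto simp: d'_def)
  have "agree \<rho> (\<phi> S' \<ominus> z) (\<phi> S)"
    if S: "S \<in> \<Omega>" "S' \<in> \<Omega>" and z: "norm z < d'" "agree R' (S' \<ominus> z) S" for S S' z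
  proof -
    obtain T where T: "T \<in> F" "S \<in> A.cylinder T (R T) (min (d T / 2) 1)" using F(3)[OF S(1)] ..
    then obtain w where w: "norm w < min (d T / 2) 1" "agree (R T) (S \<ominus> w) T"
      unfolding A.cylinder_def by blast
    have T\<Omega>: "T \<in> \<Omega>" using T(1) F(2) by blast
    have "agree (R T) (S' \<ominus> z \<ominus> w) (S \<ominus> w)"
      by (rule agree_translate[OF z(2)]) (use w(1) R'[OF T(1)] in simp)
    then have "agree (R T) (S' \<ominus> (z + w)) T" using w(2) agree_trans by simp
    moreover have "norm (z + w) < d T"
      using w(1) z(1) d'[OF T(1)] norm_triangle_ineq[of z w] by simp
    ultimately have 1: "agree (\<rho> + 1) (\<phi> S' \<ominus> (z + w)) (\<phi> T)" using loc T\<Omega> S(2) by blast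
    have "norm w < d T" using w(1) pos(2)[OF T\<Omega>] by simp
    then have 2: "agree (\<rho> + 1) (\<phi> S \<ominus> w) (\<phi> T)" using loc T\<Omega> S(1) w(2) by blast
    have "agree (\<rho> + 1) (\<phi> S' \<ominus> z \<ominus> w) (\<phi> S \<ominus> w)"
      using agree_trans[OF 1 agree_sym[OF 2]] by simp
    then show ?thesis by (rule agree_translate_cancel) (use w(1) in simp)
  qed
  then show ?thesis using \<open>R' > 0\<close> \<open>d' > 0\<close> by blast
qed

lemma continuous: "continuous_map A.X B.X \<phi>"
  unfolding B.continuous_map_into_iff topspace_pattern_topology
proof (intro conjI ballI allI impI)
  show "\<phi> \<in> \<Omega> \<rightarrow> \<Omega>'" using maps_to by blast
  fix S and R d :: real assume S: "S \<in> \<Omega>" and d: "d > 0"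
  obtain N where N: "openin A.X N" "S \<in> N"
      "\<forall>S'\<in>N. \<exists>z. norm z < d \<and> agree R (S' \<ominus> z) S \<and> agree R (\<phi> S' \<ominus> z) (\<phi> S)"
    using preserving[unfolded displacement_preserving_def, rule_format, OF S d, of R R]
    by (elim exE conjE) (rule that)
  have "\<phi> S' \<in> B.cylinder (\<phi> S) R d" if "S' \<in> N" for S'
    using N(3) that maps_to[of S'] openin_subset[OF N(1)] unfolding B.cylinder_def by auto
  then show "\<exists>N. openin A.X N \<and> S \<in> N \<and> (\<forall>S'\<in>N. \<phi> S' \<in> B.cylinder (\<phi> S) R d)"
    using N(1,2) by blast
qed

text \<open>
  A long translation is made of steps so short that each of them is matched on a given ball; the ball
  is arbitrary.
\<close>

lemma equivariant:
  assumes S: "S \<in> \<Omega>"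
  shows "\<phi> (S \<ominus> x) = \<phi> S \<ominus> x"
proof (rule B.agree_everywhere_eq)
  show "\<phi> (S \<ominus> x) \<in> \<Omega>'" by (intro maps_to A.translate_closed S)
  show "\<phi> S \<ominus> x \<in> \<Omega>'" by (intro maps_to B.translate_closed S)
  fix R :: real
  let ?R = "R + norm x"
  obtain d where d: "d > 0" and loc: "\<forall>S\<in>\<Omega>. \<forall>S'\<in>\<Omega>. \<forall>z. norm z < d \<longrightarrow> S' \<ominus> z = S \<longrightarrow>
      agree ?R (\<phi> S' \<ominus> z) (\<phi> S)"
    using uniformly_local[of ?R] agree_refl by (metis (no_types, lifting))
  obtain n :: nat where n: "norm x / d < real n" using reals_Archimedean2 by blast
  have "real n > 0" using n d by (meson divide_nonneg_pos norm_ge_zero le_less_trans)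
  define y where "y = x /\<^sub>R real n"
  have ny: "real n * norm y = norm x" using \<open>real n > 0\<close> by (simp add: y_def)
  have "real n * norm y < real n * d" unfolding ny using n d by (simp add: pos_divide_less_eq)
  then have y: "norm y < d" using \<open>real n > 0\<close> by simp
  have "agree (?R - real j * norm y) (\<phi> (S \<ominus> (real j *\<^sub>R y))) (\<phi> S \<ominus> (real j *\<^sub>R y))" for j
  proof (induction j)
    case (Suc j)
    let ?T = "S \<ominus> (real j *\<^sub>R y)"
    have T: "?T \<in> \<Omega>" "?T \<ominus> y \<in> \<Omega>" using S A.translate_closed by simp_all
    have split: "real (Suc j) *\<^sub>R y = real j *\<^sub>R y + y" by (simp add: algebra_simps)
    have "agree ?R (\<phi> (?T \<ominus> y) \<ominus> (- y)) (\<phi> ?T)"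
      using loc[rule_format, OF T, of "- y"] y by simp
    then have "agree (?R - norm y) (\<phi> (?T \<ominus> y) \<ominus> (- y) \<ominus> y) (\<phi> ?T \<ominus> y)"
      by (rule agree_translate) simp
    then have "agree (?R - norm y) (\<phi> (?T \<ominus> y)) (\<phi> ?T \<ominus> y)" by simp
    then have 1: "agree (?R - real (Suc j) * norm y) (\<phi> (?T \<ominus> y)) (\<phi> ?T \<ominus> y)"
      by (rule agree_mono) (simp add: algebra_simps)
    have 2: "agree (?R - real (Suc j) * norm y) (\<phi> ?T \<ominus> y) (\<phi> S \<ominus> (real j *\<^sub>R y) \<ominus> y)"
      by (rule agree_translate[OF Suc.IH]) (simp add: algebra_simps)
    show ?case using agree_trans[OF 1 2] unfolding split by simp
  qed simp
  moreover have "real n *\<^sub>R y = x" using \<open>real n > 0\<close> by (simp add: y_def)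
  ultimately show "agree R (\<phi> (S \<ominus> x)) (\<phi> S \<ominus> x)"
    using ny by (metis add_diff_cancel_right')
qed

lemma local_derivation:
  assumes "\<phi> ` \<Omega> = \<Omega>'"
  shows "local_derivation \<Omega> \<Omega>' \<phi>"
  unfolding local_derivation_def factor_map_def
proof (intro conjI ballI allI impI)
  fix \<rho> :: real
  obtain R d where R: "R > 0" "d > 0" "\<forall>S\<in>\<Omega>. \<forall>S'\<in>\<Omega>. \<forall>z. norm z < d \<longrightarrow> agree R (S' \<ominus> z) S \<longrightarrow>
      agree \<rho> (\<phi> S' \<ominus> z) (\<phi> S)"
    using uniformly_local[of \<rho>] by blast
  have "patch (\<phi> T) 0 \<rho> = patch (\<phi> T') 0 \<rho>" if "T \<in> \<Omega>" "T' \<in> \<Omega>" "patch T 0 R = patch T' 0 R" for T T'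
    using R(3)[rule_format, OF that(2,1), of 0] R(2) that(3) by (simp add: agree_def)
  then show "\<exists>R>0. \<forall>T\<in>\<Omega>. \<forall>T'\<in>\<Omega>. patch T 0 R = patch T' 0 R \<longrightarrow>
      patch (\<phi> T) 0 \<rho> = patch (\<phi> T') 0 \<rho>"
    using R(1) by blast
qed (use assms continuous equivariant in simp_all)

text \<open>The image is closed and, by equivariance, a union of orbits, which are dense.\<close>

lemma surjective:
  assumes ne: "\<Omega> = {} \<Longrightarrow> \<Omega>' = {}"
  shows "\<phi> ` \<Omega> = \<Omega>'"
proof
  show "\<phi> ` \<Omega> \<subseteq> \<Omega>'" using maps_to by blast
  show "\<Omega>' \<subseteq> \<phi> ` \<Omega>"
  proof (cases "\<Omega> = {}")
    case True
    then show ?thesis using ne by simp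
  next
    case False
    then obtain S where S: "S \<in> \<Omega>" by blast
    have "compactin A.X \<Omega>" using A.compact by (simp add: compact_space_def)
    then have "closedin B.X (\<phi> ` \<Omega>)"
      using image_compactin[OF _ continuous] compactin_imp_closedin[OF B.Hausdorff] by blast
    moreover have "\<phi> S \<ominus> x \<in> \<phi> ` \<Omega>" for x
      using A.translate_closed[OF S, of x] equivariant[OF S, of x] by (metis imageI)
    moreover from this have "range (\<lambda>x. \<phi> S \<ominus> x) \<subseteq> \<phi> ` \<Omega>" by blast
    ultimately have "B.X closure_of range (\<lambda>x. \<phi> S \<ominus> x) \<subseteq> \<phi> ` \<Omega>" by (intro closure_of_minimal)
    then show ?thesis using B.minimal maps_to[OF S] unfolding minimal_space_def by simp
  qed
qed

end

text \<open>
  For a homeomorphism the property of preserving displacements is symmetric in \<open>S\<close> and \<open>\<phi> S\<close>, so it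
  passes to the inverse, which is therefore local as well.
\<close>

lemma (in displacement_map) MLD:
  assumes ne: "\<Omega> = {} \<Longrightarrow> \<Omega>' = {}" and inj: "inj_on \<phi> \<Omega>"
  shows "MLD_equivalence \<Omega> \<Omega>' \<phi>"
proof -
  have "homeomorphic_map A.X B.X \<phi>"
    using continuous_imp_homeomorphic_map[OF continuous A.compact B.Hausdorff] surjective[OF ne] inj by simp
  then obtain \<psi> where \<psi>: "homeomorphic_maps A.X B.X \<phi> \<psi>" using homeomorphic_map_maps by blast
  then have cont: "continuous_map B.X A.X \<psi>" and \<psi>\<phi>: "\<And>S. S \<in> \<Omega> \<Longrightarrow> \<psi> (\<phi> S) = S"
    and \<phi>\<psi>: "\<And>Q. Q \<in> \<Omega>' \<Longrightarrow> \<phi> (\<psi> Q) = Q"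
    by (simp_all add: homeomorphic_maps_def)
  have \<psi>_maps: "\<psi> Q \<in> \<Omega>" if "Q \<in> \<Omega>'" for Q using cont that by (auto simp: continuous_map_def)
  have "displacement_preserving \<Omega>' \<psi>"
    unfolding displacement_preserving_def
  proof (intro ballI allI impI)
    fix Q and R R' d :: real assume Q: "Q \<in> \<Omega>'" and d: "0 < d"
    obtain N where N: "openin A.X N" "\<psi> Q \<in> N"
        "\<forall>S'\<in>N. \<exists>z. norm z < d \<and> agree R' (S' \<ominus> z) (\<psi> Q) \<and> agree R (\<phi> S' \<ominus> z) (\<phi> (\<psi> Q))"
      using preserving[unfolded displacement_preserving_def, rule_format, OF \<psi>_maps[OF Q] d, of R' R]
      by (elim exE conjE) (rule that)
    let ?N = "{Q \<in> topspace B.X. \<psi> Q \<in> N}"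
    have "\<exists>z. norm z < d \<and> agree R (Q' \<ominus> z) Q \<and> agree R' (\<psi> Q' \<ominus> z) (\<psi> Q)" if Q': "Q' \<in> ?N" for Q'
    proof -
      have "\<psi> Q' \<in> N" "Q' \<in> \<Omega>'" using Q' by simp_all
      from N(3)[rule_format, OF this(1)] show ?thesis
        unfolding \<phi>\<psi>[OF Q] \<phi>\<psi>[OF \<open>Q' \<in> \<Omega>'\<close>] by blast
    qed
    moreover have "openin B.X ?N" using cont N(1) by (rule openin_continuous_map_preimage)
    moreover have "Q \<in> ?N" using Q N(2) by simp
    ultimately show "\<exists>N. openin B.X N \<and> Q \<in> N \<and>
        (\<forall>Q'\<in>N. \<exists>z. norm z < d \<and> agree R (Q' \<ominus> z) Q \<and> agree R' (\<psi> Q' \<ominus> z) (\<psi> Q))"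
      by (intro exI[of _ ?N] conjI ballI)
  qed
  then interpret inverse: displacement_map \<Omega>' \<Omega> \<psi> by unfold_locales (use \<psi>_maps in auto)
  have "\<psi> ` \<Omega>' = \<Omega>"
    using inverse.surjective maps_to ne by blast
  then show ?thesis
    unfolding MLD_equivalence_def
    by (intro conjI exI[of _ \<psi>] local_derivation inverse.local_derivation surjective ne \<psi>)
qed

section \<open>Lifting translations through a continuous map\<close>

lemma continuous_map_into_metric:
  fixes f :: "'z \<Rightarrow> 'a::metric_space"
  assumes "\<And>x \<epsilon>. x \<in> topspace Z \<Longrightarrow> \<epsilon> > 0 \<Longrightarrow>
    \<exists>N. openin Z N \<and> x \<in> N \<and> (\<forall>y\<in>N. dist (f y) (f x) < \<epsilon>)"
  shows "continuous_map Z euclidean f"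
  using assms Met_TC.continuous_map_to_metric[of Z f]
  by (simp add: Met_TC.in_mball dist_commute)

lemma continuous_map_scaleR:
  fixes f :: "'z \<Rightarrow> 'a::real_normed_vector"
  assumes "continuous_map Z euclidean c" "continuous_map Z euclidean f"
  shows "continuous_map Z euclidean (\<lambda>z. c z *\<^sub>R f z)"
  using assms by (simp add: continuous_map_atin tendsto_scaleR)

locale continuous_pair = A: flc_space \<Omega> + B: flc_space \<Omega>'
  for \<Omega> :: "('a::euclidean_space, 'l::metric_space) pattern set"
    and \<Omega>' :: "('a, 'm::metric_space) pattern set" +
  fixes g :: "('a, 'l) pattern \<Rightarrow> ('a, 'm) pattern"
  assumes cont: "continuous_map (pattern_topology \<Omega>) (pattern_topology \<Omega>') g"
begin

lemma g_maps: "S \<in> \<Omega> \<Longrightarrow> g S \<in> \<Omega>'"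
  using cont by (auto simp: continuous_map_def)

lemma uniformly_near:
  assumes R: "R > 0" and d: "d > 0"
  shows "\<exists>\<delta>>0. \<forall>S\<in>\<Omega>. \<forall>x. norm x < \<delta> \<longrightarrow> g (S \<ominus> x) \<in> B.cylinder (g S) R d"
proof -
  \<comment> \<open>The two displacements from \<open>g T\<close> below are bounded by \<open>e\<close>: their difference has to be less
    than \<open>d\<close>, and undoing one of them costs at most \<open>1\<close> of the radius.\<close>
  define e where "e = min (d/2) 1"
  have e: "e > 0" "e \<le> d/2" "e \<le> 1" using d by (simp_all add: e_def)
  have "\<forall>T\<in>\<Omega>. \<exists>p. snd p > 0 \<and> (\<forall>S\<in>A.cylinder T (fst p) (snd p). g S \<in> B.cylinder (g T) (R + 1) e)"
  proof
    fix T assume T: "T \<in> \<Omega>"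
    have "openin A.X {S \<in> topspace A.X. g S \<in> B.cylinder (g T) (R + 1) e}"
      by (rule openin_continuous_map_preimage[OF cont B.openin_cylinder])
    moreover have "T \<in> {S \<in> topspace A.X. g S \<in> B.cylinder (g T) (R + 1) e}"
      using T B.cylinder_self[OF g_maps[OF T] e(1)] by simp
    ultimately obtain R' d' where "d' > 0"
        "A.cylinder T R' d' \<subseteq> {S \<in> topspace A.X. g S \<in> B.cylinder (g T) (R + 1) e}"
      unfolding A.openin_iff by blast
    then show "\<exists>p. snd p > 0 \<and> (\<forall>S\<in>A.cylinder T (fst p) (snd p). g S \<in> B.cylinder (g T) (R + 1) e)"
      by (intro exI[of _ "(R', d')"]) auto
  qed
  from this[unfolded bchoice_iff] obtain p where p: "\<forall>T\<in>\<Omega>. snd (p T) > 0 \<and>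
      (\<forall>S\<in>A.cylinder T (fst (p T)) (snd (p T)). g S \<in> B.cylinder (g T) (R + 1) e)" ..
  define \<rho> \<eta> where "\<rho> T = fst (p T)" and "\<eta> T = snd (p T)" for T
  have \<eta>: "\<eta> T > 0" if "T \<in> \<Omega>" for T using p that by (simp add: \<eta>_def)
  have cyl: "g S \<in> B.cylinder (g T) (R + 1) e" if "T \<in> \<Omega>" "S \<in> A.cylinder T (\<rho> T) (\<eta> T)" for S T
    using p that by (simp add: \<rho>_def \<eta>_def)
  obtain F where F: "finite F" "F \<subseteq> \<Omega>" "\<And>S. S \<in> \<Omega> \<Longrightarrow> \<exists>T\<in>F. S \<in> A.cylinder T (\<rho> T) (\<eta> T / 2)"
    using A.finite_cylinder_cover[of "\<lambda>T. \<eta> T / 2" \<rho>] \<eta> half_gt_zero by metis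
  define \<delta> where "\<delta> = Min (insert 1 ((\<lambda>T. \<eta> T / 2) ` F))"
  have \<delta>: "\<delta> \<le> \<eta> T / 2" if "T \<in> F" for T
    unfolding \<delta>_def by (rule Min_le) (use F(1) that in auto)
  have "\<delta> > 0" using F(1,2) \<eta> by (auto simp: \<delta>_def)
  moreover have "g (S \<ominus> x) \<in> B.cylinder (g S) R d" if S: "S \<in> \<Omega>" and x: "norm x < \<delta>" for S x
  proof -
    obtain T where T: "T \<in> F" "S \<in> A.cylinder T (\<rho> T) (\<eta> T / 2)" using F(3)[OF S] ..
    then obtain z where z: "norm z < \<eta> T / 2" "agree (\<rho> T) (S \<ominus> z) T" unfolding A.cylinder_def by blast
    have T\<Omega>: "T \<in> \<Omega>" using T(1) F(2) by blast
    have "S \<in> A.cylinder T (\<rho> T) (\<eta> T)"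
      using T(2) A.cylinder_mono[of "\<rho> T" "\<rho> T" "\<eta> T / 2" "\<eta> T" T] \<eta>[OF T\<Omega>] by auto
    then obtain a where a: "norm a < e" "agree (R + 1) (g S \<ominus> a) (g T)"
      using cyl[OF T\<Omega>] unfolding B.cylinder_def by blast
    have "norm (z - x) < \<eta> T" using z(1) x \<delta>[OF T(1)] norm_triangle_ineq4[of z x] by simp
    then have "S \<ominus> x \<in> A.cylinder T (\<rho> T) (\<eta> T)"
      using z(2) A.translate_closed[OF S] unfolding A.cylinder_def by (auto intro!: exI[of _ "z - x"])
    then obtain b where b: "norm b < e" "agree (R + 1) (g (S \<ominus> x) \<ominus> b) (g T)"
      using cyl[OF T\<Omega>] unfolding B.cylinder_def by blast
    have "agree (R + 1) (g (S \<ominus> x) \<ominus> b) (g S \<ominus> a)" using b(2) agree_sym[OF a(2)] by (rule agree_trans)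
    then have "agree R (g (S \<ominus> x) \<ominus> b \<ominus> (- a)) (g S \<ominus> a \<ominus> (- a))"
      by (rule agree_translate) (use a(1) e in simp)
    then have "agree R (g (S \<ominus> x) \<ominus> (b - a)) (g S)" by simp
    moreover have "norm (b - a) < d" using a(1) b(1) e norm_triangle_ineq4[of b a] by linarith
    ultimately show ?thesis
      using g_maps[OF A.translate_closed[OF S]] unfolding B.cylinder_def by blast
  qed
  ultimately show ?thesis by blast
qed

text \<open>
  The displacement of \<open>g (S \<ominus> x)\<close> relative to \<open>g S\<close> is unique, and removing it leaves a patch that
  is locally constant in \<open>x\<close>, hence constant on a ball. So the image of an orbit lies in an orbit:
  transversals are totally disconnected.
\<close>

lemma small_lift:
  assumes e: "e > 0"
  shows "\<exists>\<delta>>0. \<forall>S\<in>\<Omega>. \<forall>x. norm x < \<delta> \<longrightarrow> (\<exists>w. norm w < e \<and> g (S \<ominus> x) = g S \<ominus> w)"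
proof -
  obtain R0 r where R0: "R0 > 0" and r: "r > 0"
    and rig: "\<forall>T\<in>\<Omega>'. \<forall>z z'. agree R0 (T \<ominus> z) (T \<ominus> z') \<longrightarrow> norm (z - z') < r \<longrightarrow> z = z'"
    using B.rigid by blast
  define d where "d = min e (r/4)"
  have d: "d > 0" "d \<le> e" "d \<le> r/4" using e r by (simp_all add: d_def)
  obtain \<delta> where \<delta>: "\<delta> > 0" "\<forall>S\<in>\<Omega>. \<forall>x. norm x < \<delta> \<longrightarrow> g (S \<ominus> x) \<in> B.cylinder (g S) R0 d"
    using uniformly_near[OF R0 d(1)] by blast
  have "\<exists>w. norm w < e \<and> g (S \<ominus> x) = g S \<ominus> w" if S: "S \<in> \<Omega>" and x: "norm x < \<delta>" for S x
  proof -
    let ?B = "ball (0::'a) \<delta>"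
    have "\<forall>x\<in>?B. \<exists>w. norm w < d \<and> agree R0 (g (S \<ominus> x) \<ominus> w) (g S)"
      using \<delta>(2) S unfolding B.cylinder_def by simp
    from this[unfolded bchoice_iff] obtain v where
      v: "\<forall>x\<in>?B. norm (v x) < d \<and> agree R0 (g (S \<ominus> x) \<ominus> v x) (g S)" ..
    have gS: "g (S \<ominus> x) \<in> \<Omega>'" for x by (intro g_maps A.translate_closed S)
    have v_unique: "w = v x" if "x \<in> ?B" "norm (w - v x) < r" "agree R0 (g (S \<ominus> x) \<ominus> w) (g S)" for x w
    proof -
      have "agree R0 (g (S \<ominus> x) \<ominus> w) (g (S \<ominus> x) \<ominus> v x)"
        using that(3) agree_sym[OF v[rule_format, OF that(1), THEN conjunct2]] by (rule agree_trans)
      then show ?thesis using rig gS that(2) by blast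
    qed
    have path: "continuous_map euclidean B.X (\<lambda>x. g (S \<ominus> x))"
    proof -
      have "continuous_map euclidean A.X (\<lambda>x. S \<ominus> x)"
        by (rule A.continuous_map_translate) (simp_all add: S)
      from continuous_map_compose[OF this cont] show ?thesis by (simp add: comp_def)
    qed
    have const: "patch (g (S \<ominus> x) \<ominus> v x) 0 R = patch (g (S \<ominus> 0) \<ominus> v 0) 0 R"
      if x: "x \<in> ?B" and R: "R \<ge> R0" for R x
    proof (rule connected_local_const[OF connected_ball x])
      show "(0::'a) \<in> ?B" using \<delta>(1) by simp
      show "\<forall>a\<in>?B. \<forall>\<^sub>F b in at a within ?B.
          patch (g (S \<ominus> a) \<ominus> v a) 0 R = patch (g (S \<ominus> b) \<ominus> v b) 0 R"
      proof
        fix a assume a: "a \<in> ?B"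
        have va: "norm (v a) < d" "agree R0 (g (S \<ominus> a) \<ominus> v a) (g S)" using v a by blast+
        have "R + d > 0" using R R0 d(1) by linarith
        then obtain N where N: "openin euclidean N" "a \<in> N"
            "\<forall>b\<in>N. g (S \<ominus> b) \<in> B.cylinder (g (S \<ominus> a)) (R + d) d"
          using path[unfolded B.continuous_map_into_iff, THEN conjunct2, rule_format, of a "R + d" d] d(1)
          by auto
        have "patch (g (S \<ominus> a) \<ominus> v a) 0 R = patch (g (S \<ominus> b) \<ominus> v b) 0 R" if b: "b \<in> N" "b \<in> ?B" for b
        proof -
          obtain c where c: "norm c < d" "agree (R + d) (g (S \<ominus> b) \<ominus> c) (g (S \<ominus> a))"
            using N(3) b(1) unfolding B.cylinder_def by blast
          have ag: "agree R (g (S \<ominus> b) \<ominus> c \<ominus> v a) (g (S \<ominus> a) \<ominus> v a)"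
            by (rule agree_translate[OF c(2)]) (use va(1) in simp)
          then have "agree R0 (g (S \<ominus> b) \<ominus> (c + v a)) (g S)"
            using agree_trans[OF agree_mono[OF ag R] va(2)] by simp
          moreover have "norm (c + v a - v b) < r"
          proof -
            have "norm (v b) < d" using v b(2) by blast
            then show ?thesis
              using va(1) c(1) d(3) norm_triangle_ineq[of c "v a"] norm_triangle_ineq4[of "c + v a" "v b"] r
              by linarith
          qed
          ultimately have "c + v a = v b" using v_unique b(2) by blast
          then show ?thesis using ag by (simp add: agree_def)
        qed
        then show "\<forall>\<^sub>F b in at a within ?B.
          patch (g (S \<ominus> a) \<ominus> v a) 0 R = patch (g (S \<ominus> b) \<ominus> v b) 0 R"
          using N(1,2) unfolding eventually_at_topological by (auto intro!: exI[of _ N])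
      qed
    qed
    have "norm (v 0) < d" using v \<delta>(1) by simp
    then have "0 = v 0" by (intro v_unique) (use \<delta>(1) d r in auto)
    have "g (S \<ominus> x) \<ominus> v x = g S"
    proof (rule B.agree_everywhere_eq)
      show "g (S \<ominus> x) \<ominus> v x \<in> \<Omega>'" "g S \<in> \<Omega>'" using gS g_maps[OF S] B.translate_closed by blast+
      fix R
      have "agree (max R R0) (g (S \<ominus> x) \<ominus> v x) (g S)"
        using const[of x "max R R0"] x \<open>0 = v 0\<close>[symmetric] by (simp add: agree_def)
      then show "agree R (g (S \<ominus> x) \<ominus> v x) (g S)" by (rule agree_mono) simp
    qed
    then have "g (S \<ominus> x) = g S \<ominus> (- v x)" by (simp add: translate_eq_iff)
    moreover have "norm (v x) < d" using v x by simp
    then have "norm (- v x) < e" using d(2) by simp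
    ultimately show ?thesis by blast
  qed
  then show ?thesis using \<delta>(1) by blast
qed

lemma lift:
  assumes S: "S \<in> \<Omega>"
  shows "\<exists>w. g (S \<ominus> x) = g S \<ominus> w"
proof -
  obtain \<delta> where \<delta>: "\<delta> > 0" "\<forall>S\<in>\<Omega>. \<forall>x. norm x < \<delta> \<longrightarrow> (\<exists>w. norm w < 1 \<and> g (S \<ominus> x) = g S \<ominus> w)"
    using small_lift[of 1] by auto
  obtain n :: nat where n: "norm x / \<delta> < real n" using reals_Archimedean2 by blast
  have "real n > 0" using n \<delta>(1) by (meson divide_nonneg_pos norm_ge_zero le_less_trans)
  define y where "y = x /\<^sub>R real n"
  have ny: "real n * norm y = norm x" using \<open>real n > 0\<close> by (simp add: y_def)
  have "real n * norm y < real n * \<delta>" unfolding ny using n \<delta>(1) by (simp add: pos_divide_less_eq)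
  then have y: "norm y < \<delta>" using \<open>real n > 0\<close> by simp
  have "\<exists>w. g (S \<ominus> (real j *\<^sub>R y)) = g S \<ominus> w" for j
  proof (induction j)
    case 0
    show ?case by (intro exI[of _ 0]) simp
  next
    case (Suc j)
    then obtain w where w: "g (S \<ominus> (real j *\<^sub>R y)) = g S \<ominus> w" ..
    obtain w' where "g (S \<ominus> (real j *\<^sub>R y) \<ominus> y) = g (S \<ominus> (real j *\<^sub>R y)) \<ominus> w'"
      using \<delta>(2) A.translate_closed[OF S] y by blast
    then have "g (S \<ominus> (real (Suc j) *\<^sub>R y)) = g S \<ominus> (w + w')"
      using w by (simp add: algebra_simps)
    then show ?case ..
  qed
  from this[of n] show ?thesis using \<open>real n > 0\<close> by (simp add: y_def)
qed

text \<open>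
  The lifted vector \<open>V z\<close> is small, hence determined by the patches of \<open>g (k z)\<close> and
  \<open>g (k z \<ominus> \<sigma> z)\<close>; these move by small vectors \<open>a\<close> and \<open>b\<close> when \<open>z\<close> varies, and \<open>V z\<close> changes by
  \<open>a - b\<close>.
\<close>

lemma continuous_small_lift:
  "\<exists>\<delta>>0. \<forall>(Z :: 'z topology) k \<sigma>. continuous_map Z (pattern_topology \<Omega>) k \<longrightarrow>
     continuous_map Z euclidean \<sigma> \<longrightarrow> (\<forall>z\<in>topspace Z. norm (\<sigma> z) < \<delta>) \<longrightarrow>
     (\<exists>V. continuous_map Z euclidean V \<and> (\<forall>z\<in>topspace Z. g (k z \<ominus> \<sigma> z) = g (k z) \<ominus> V z))"
proof -
  obtain R0 r where R0: "R0 > 0" and r: "r > 0"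
    and rig: "\<forall>T\<in>\<Omega>'. \<forall>z z'. agree R0 (T \<ominus> z) (T \<ominus> z') \<longrightarrow> norm (z - z') < r \<longrightarrow> z = z'"
    using B.rigid by blast
  have "r/4 > 0" using r by simp
  then obtain \<delta> where \<delta>: "\<delta> > 0"
    "\<forall>S\<in>\<Omega>. \<forall>x. norm x < \<delta> \<longrightarrow> (\<exists>w. norm w < r/4 \<and> g (S \<ominus> x) = g S \<ominus> w)"
    using small_lift by blast
  have "\<exists>V. continuous_map Z euclidean V \<and> (\<forall>z\<in>topspace Z. g (k z \<ominus> \<sigma> z) = g (k z) \<ominus> V z)"
    if k: "continuous_map Z (pattern_topology \<Omega>) k" and \<sigma>: "continuous_map Z euclidean \<sigma>"
      and small: "\<forall>z\<in>topspace Z. norm (\<sigma> z) < \<delta>" for Z :: "'z topology" and k \<sigma>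
  proof -
    have kZ: "k z \<in> \<Omega>" if "z \<in> topspace Z" for z using k that by (auto simp: continuous_map_def)
    have "\<forall>z\<in>topspace Z. \<exists>w. norm w < r/4 \<and> g (k z \<ominus> \<sigma> z) = g (k z) \<ominus> w"
      using \<delta>(2) kZ small by blast
    from this[unfolded bchoice_iff] obtain V where
      V: "\<forall>z\<in>topspace Z. norm (V z) < r/4 \<and> g (k z \<ominus> \<sigma> z) = g (k z) \<ominus> V z" ..
    have contG: "continuous_map Z B.X (\<lambda>z. g (k z))"
      using continuous_map_compose[OF k cont] by (simp add: comp_def)
    have contH: "continuous_map Z B.X (\<lambda>z. g (k z \<ominus> \<sigma> z))"
      using continuous_map_compose[OF A.continuous_map_translate[OF k \<sigma>] cont] by (simp add: comp_def)
    have near: "\<exists>N. openin Z N \<and> z0 \<in> N \<and> (\<forall>z\<in>N. dist (V z) (V z0) < \<epsilon>)"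
      if z0: "z0 \<in> topspace Z" and \<epsilon>: "\<epsilon> > 0" for z0 \<epsilon>
    proof -
      define e where "e = min (\<epsilon>/2) (r/4)"
      have e: "e > 0" "e \<le> \<epsilon>/2" "e \<le> r/4" using \<epsilon> r by (simp_all add: e_def)
      let ?R = "R0 + r"
      have "?R > 0" using R0 r by simp
      obtain N1 where N1: "openin Z N1" "z0 \<in> N1" "\<forall>z\<in>N1. g (k z) \<in> B.cylinder (g (k z0)) ?R e"
        using contG[unfolded B.continuous_map_into_iff, THEN conjunct2, rule_format, OF z0 \<open>?R > 0\<close> e(1)]
        by (elim exE conjE) (rule that)
      obtain N2 where N2: "openin Z N2" "z0 \<in> N2"
          "\<forall>z\<in>N2. g (k z \<ominus> \<sigma> z) \<in> B.cylinder (g (k z0 \<ominus> \<sigma> z0)) ?R e"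
        using contH[unfolded B.continuous_map_into_iff, THEN conjunct2, rule_format, OF z0 \<open>?R > 0\<close> e(1)]
        by (elim exE conjE) (rule that)
      have "dist (V z) (V z0) < \<epsilon>" if z: "z \<in> N1" "z \<in> N2" for z
      proof -
        have zZ: "z \<in> topspace Z" using openin_subset[OF N1(1)] z(1) by blast
        note Vz = V[rule_format, OF zZ] and Vz0 = V[rule_format, OF z0]
        obtain a where a: "norm a < e" "agree ?R (g (k z) \<ominus> a) (g (k z0))"
          using N1(3) z(1) unfolding B.cylinder_def by blast
        obtain b where b: "norm b < e" "agree ?R (g (k z \<ominus> \<sigma> z) \<ominus> b) (g (k z0 \<ominus> \<sigma> z0))"
          using N2(3) z(2) unfolding B.cylinder_def by blast
        have "agree R0 (g (k z) \<ominus> a \<ominus> V z0) (g (k z0) \<ominus> V z0)"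
          by (rule agree_translate[OF a(2)]) (use Vz0 r in simp)
        moreover have "agree R0 (g (k z) \<ominus> (V z + b)) (g (k z0) \<ominus> V z0)"
          using agree_mono[OF b(2), of R0] Vz Vz0 r by simp
        ultimately have "agree R0 (g (k z) \<ominus> (V z + b)) (g (k z) \<ominus> (a + V z0))"
          using agree_sym agree_trans by fastforce
        moreover have "norm ((V z + b) - (a + V z0)) < r"
          using norm_triangle_ineq4[of "V z + b" "a + V z0"] norm_triangle_ineq[of "V z" b]
            norm_triangle_ineq[of a "V z0"] Vz Vz0 a(1) b(1) e(3) by linarith
        ultimately have "V z + b = a + V z0" using rig g_maps[OF kZ[OF zZ]] by blast
        then have "V z - V z0 = a - b" by (simp add: algebra_simps)
        then show ?thesis
          unfolding dist_norm using a(1) b(1) e(2) norm_triangle_ineq4[of a b] by simp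
      qed
      then show ?thesis
        using N1(1,2) N2(1,2) by (intro exI[of _ "N1 \<inter> N2"]) (auto simp: openin_Int)
    qed
    have "continuous_map Z euclidean V" by (rule continuous_map_into_metric) (rule near)
    then show ?thesis using V by blast
  qed
  then show ?thesis using \<delta>(1) by blast
qed

lemma continuous_lift:
  fixes k :: "'z \<Rightarrow> ('a, 'l) pattern"
  assumes k: "continuous_map Z (pattern_topology \<Omega>) k" and \<sigma>: "continuous_map Z euclidean \<sigma>"
    and Z: "compact_space Z"
  shows "\<exists>V. continuous_map Z euclidean V \<and> (\<forall>z\<in>topspace Z. g (k z \<ominus> \<sigma> z) = g (k z) \<ominus> V z)"
proof -
  obtain \<delta> where \<delta>: "\<delta> > 0" and lift: "\<And>k \<sigma>. continuous_map Z (pattern_topology \<Omega>) k \<Longrightarrow>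
     continuous_map Z euclidean \<sigma> \<Longrightarrow> (\<forall>z\<in>topspace Z. norm (\<sigma> z) < \<delta>) \<Longrightarrow>
     (\<exists>V. continuous_map Z euclidean V \<and> (\<forall>z\<in>topspace Z. g (k z \<ominus> \<sigma> z) = g (k z) \<ominus> V z))"
  proof -
    from continuous_small_lift obtain \<delta> where \<delta>: "\<delta> > 0" "\<forall>(Z :: 'z topology) k \<sigma>.
       continuous_map Z (pattern_topology \<Omega>) k \<longrightarrow>
       continuous_map Z euclidean \<sigma> \<longrightarrow> (\<forall>z\<in>topspace Z. norm (\<sigma> z) < \<delta>) \<longrightarrow>
       (\<exists>V. continuous_map Z euclidean V \<and> (\<forall>z\<in>topspace Z. g (k z \<ominus> \<sigma> z) = g (k z) \<ominus> V z))"
      by (elim exE conjE) (rule that)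
    show ?thesis by (rule that[OF \<delta>(1)])
      (rule \<delta>(2)[THEN spec, THEN spec, THEN spec, THEN mp, THEN mp, THEN mp])
  qed
  have "compactin euclidean (\<sigma> ` topspace Z)"
    using Z \<sigma> by (intro image_compactin) (simp_all add: compact_space_def)
  then have "bounded (\<sigma> ` topspace Z)" by (simp add: compact_imp_bounded)
  then obtain M where "\<forall>v\<in>\<sigma> ` topspace Z. norm v \<le> M" unfolding bounded_iff ..
  then have M: "\<forall>z\<in>topspace Z. norm (\<sigma> z) \<le> M" by blast
  obtain n :: nat where n: "max M 0 / \<delta> < real n" using reals_Archimedean2 by blast
  have "0 \<le> max M 0 / \<delta>" using \<delta> by simp
  then have n0: "real n > 0" using n by linarith
  have Mn: "M < real n * \<delta>" using n \<delta> by (simp add: pos_divide_less_eq)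
  define \<tau> where "\<tau> z = \<sigma> z /\<^sub>R real n" for z
  have \<tau>: "continuous_map Z euclidean \<tau>"
    unfolding \<tau>_def by (intro continuous_map_scaleR \<sigma>) simp
  have small: "norm (\<tau> z) < \<delta>" if "z \<in> topspace Z" for z
  proof -
    have "real n * norm (\<tau> z) = norm (\<sigma> z)" using n0 by (simp add: \<tau>_def)
    then have "real n * norm (\<tau> z) < real n * \<delta>" using M that Mn by fastforce
    then show ?thesis using n0 by simp
  qed
  have "\<exists>V. continuous_map Z euclidean V \<and> (\<forall>z\<in>topspace Z. g (k z \<ominus> (real j *\<^sub>R \<tau> z)) = g (k z) \<ominus> V z)" for j
  proof (induction j)
    case 0
    show ?case by (intro exI[of _ "\<lambda>_. 0"]) simp
  next
    case (Suc j)
    then obtain V where V: "continuous_map Z euclidean V"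
        "\<forall>z\<in>topspace Z. g (k z \<ominus> (real j *\<^sub>R \<tau> z)) = g (k z) \<ominus> V z" by blast
    have "continuous_map Z A.X (\<lambda>z. k z \<ominus> (real j *\<^sub>R \<tau> z))"
      by (intro A.continuous_map_translate k continuous_map_scaleR \<tau>) simp
    from lift[OF this \<tau>] obtain V' where V': "continuous_map Z euclidean V'"
        "\<forall>z\<in>topspace Z. g (k z \<ominus> (real j *\<^sub>R \<tau> z) \<ominus> \<tau> z) = g (k z \<ominus> (real j *\<^sub>R \<tau> z)) \<ominus> V' z"
      using small by blast
    have "g (k z \<ominus> (real (Suc j) *\<^sub>R \<tau> z)) = g (k z) \<ominus> (V z + V' z)" if "z \<in> topspace Z" for z
    proof -
      have "real (Suc j) *\<^sub>R \<tau> z = real j *\<^sub>R \<tau> z + \<tau> z" by (simp add: algebra_simps)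
      then show ?thesis using V(2) V'(2) that by simp
    qed
    moreover have "continuous_map Z euclidean (\<lambda>z. V z + V' z)"
      using V(1) V'(1) by (intro continuous_intros)
    ultimately show ?case by blast
  qed
  from this[of n] show ?thesis using n0 by (simp add: \<tau>_def)
qed

end

section \<open>Local finiteness of tilings and Delone sets\<close>

lemma convex_contains_ball_if_near:
  fixes A B :: "'a::euclidean_space set"
  assumes A: "ball c (2 * \<rho>) \<subseteq> A" and near: "\<forall>a\<in>A. \<exists>b\<in>B. dist a b < \<rho>"
    and B: "convex B" "closed B" and \<rho>: "\<rho> > 0"
  shows "ball c \<rho> \<subseteq> B"
proof
  fix y assume y: "y \<in> ball c \<rho>"
  show "y \<in> B"
  proof (rule ccontr)
    assume "y \<notin> B"
    then obtain a b where a: "a \<bullet> y < b" "\<forall>x\<in>B. b < a \<bullet> x"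
      using separating_hyperplane_closed_point[OF B] by blast
    \<comment> \<open>Moving \<open>y\<close> away from the hyperplane by \<open>\<rho>\<close> gives a point of \<open>A\<close> too far from \<open>B\<close>.\<close>
    define q where "q = y - \<rho> *\<^sub>R sgn a"
    have "dist y q \<le> \<rho>" using \<rho> by (simp add: q_def dist_norm norm_sgn)
    then have "dist c q < 2 * \<rho>" using y dist_triangle[of c q y] by simp
    then obtain b' where b': "b' \<in> B" "dist q b' < \<rho>" using A near by (meson mem_ball subsetD)
    have "a \<bullet> sgn a = norm a" 
      by (cases "a = 0") (simp_all add: sgn_div_norm dot_square_norm power2_eq_square)
    then have "a \<bullet> q = a \<bullet> y - \<rho> * norm a" by (simp add: q_def inner_diff_right)
    moreover have "a \<bullet> (b' - q) \<le> norm a * norm (b' - q)" by (rule norm_cauchy_schwarz)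
    moreover have "norm a * norm (b' - q) \<le> norm a * \<rho>"
      using b'(2) by (intro mult_left_mono) (simp_all add: dist_norm norm_minus_commute)
    ultimately have "a \<bullet> b' \<le> a \<bullet> y" by (simp add: inner_diff_right algebra_simps)
    then show False using a b'(1) by force
  qed
qed

lemma delone_finite_patch:
  assumes "delone T"
  shows "finite (patch T x R)"
proof (rule ccontr)
  assume "infinite (patch T x R)"
  then obtain t :: "nat \<Rightarrow> 'a set \<times> 'b" where t: "inj t" "range t \<subseteq> patch T x R"
    using infinite_countable_subset by blast
  obtain r where r: "r > 0" "\<forall>x l y m. ({x}, l) \<in> T \<and> ({y}, m) \<in> T \<and> ({x}, l) \<noteq> ({y}, m) \<longrightarrow> r \<le> dist x y"
    using assms unfolding delone_def by blast
  have "\<forall>n. \<exists>a. t n = ({a}, snd (t n)) \<and> a \<in> cball x R"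
  proof
    fix n
    have "t n \<in> patch T x R" using t(2) by blast
    then have tn: "t n \<in> T" "\<exists>a\<in>fst (t n). dist x a < R" by (simp_all add: mem_patch)
    then obtain a where "fst (t n) = {a}" using assms unfolding delone_def by blast
    then show "\<exists>a. t n = ({a}, snd (t n)) \<and> a \<in> cball x R"
      using tn(2) by (intro exI[of _ a]) (simp add: prod_eq_iff)
  qed
  from this[unfolded choice_iff] obtain a where a: "\<forall>n. t n = ({a n}, snd (t n)) \<and> a n \<in> cball x R" ..
  then obtain l s where s: "strict_mono s" "(a \<circ> s) \<longlonglongrightarrow> l"
    using compact_cball[of x R] unfolding compact_def by metis
  have "Cauchy (a \<circ> s)" using s(2) by (rule LIMSEQ_imp_Cauchy)
  then obtain N where N: "dist (a (s N)) (a (s (Suc N))) < r"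
    using r(1) unfolding Cauchy_def by (metis comp_apply le_refl lessI less_imp_le)
  have "s N \<noteq> s (Suc N)" using s(1) by (simp add: strict_mono_eq)
  then have ne: "t (s N) \<noteq> t (s (Suc N))" using t(1) by (simp add: inj_eq)
  have "t n \<in> T" for n
  proof -
    have "t n \<in> patch T x R" using t(2) by blast
    then show ?thesis by (simp add: mem_patch)
  qed
  then have "r \<le> dist (a (s N)) (a (s (Suc N)))" using r(2) a ne by metis
  then show False using N by simp
qed

text \<open>
  Infinitely many tiles meeting a ball would accumulate, by compactness of the set of prototiles, at
  a tile with interior; tiles close to that one contain a common interior point.
\<close>

lemma tiling_finite_patch:
  fixes T :: "('a::euclidean_space, 'l::metric_space) pattern"
  assumes T: "tiling T"
    and P: "compactin (Metric_space.mtopology (Collect tile) piece_dist) P"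
    and proto: "\<forall>t\<in>T. \<exists>p\<in>P. \<exists>x. t = shift_piece x p"
  shows "finite (patch T x R)"
proof (rule ccontr)
  interpret M: Metric_space "Collect tile" "piece_dist :: 'a set \<times> 'l \<Rightarrow> _" by (rule Metric_space_tile)
  assume "infinite (patch T x R)"
  then obtain t :: "nat \<Rightarrow> 'a set \<times> 'l" where t: "inj t" "range t \<subseteq> patch T x R"
    using infinite_countable_subset by blast
  have "t n \<in> patch T x R" for n using t(2) by blast
  then have tT: "t n \<in> T" and meet: "\<exists>a\<in>fst (t n). dist x a < R" for n
    by (simp_all add: mem_patch)
  have "\<forall>n. \<exists>q. fst q \<in> P \<and> t n = shift_piece (snd q) (fst q)"
  proof
    fix n
    obtain p y where "p \<in> P" "t n = shift_piece y p" using proto tT by blast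
    then show "\<exists>q. fst q \<in> P \<and> t n = shift_piece (snd q) (fst q)" by (intro exI[of _ "(p, y)"]) simp
  qed
  from this[unfolded choice_iff] obtain q where
    q: "\<forall>n. fst (q n) \<in> P \<and> t n = shift_piece (snd (q n)) (fst (q n))" ..
  define p y where "p n = fst (q n)" and "y n = snd (q n)" for n
  have pP: "p n \<in> P" and t_eq: "t n = shift_piece (y n) (p n)" for n using q by (simp_all add: p_def y_def)
  have "range p \<subseteq> P" using pP by blast
  then obtain p' s where p': "p' \<in> P" and s: "strict_mono s"
      and lim: "limitin M.mtopology (p \<circ> s) p' sequentially"
    using P unfolding M.compactin_sequentially by blast
  have tileP: "tile p" if "p \<in> P" for p using compactin_subset_topspace[OF P] that by auto
  have geo: "compact (fst p)" "fst p \<noteq> {}" "convex (fst p)" if "p \<in> P" for p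
    using tileP[OF that] by (auto simp: tile_def polytope_imp_compact polytope_imp_convex)
  obtain c \<rho>' where c: "\<rho>' > 0" "ball c \<rho>' \<subseteq> fst p'"
  proof -
    obtain c where "c \<in> interior (fst p')" using tileP[OF p'] unfolding tile_def by blast
    then show ?thesis using that unfolding mem_interior by blast
  qed
  define \<rho> where "\<rho> = \<rho>' / 2"
  have \<rho>: "\<rho> > 0" "ball c (2 * \<rho>) \<subseteq> fst p'" using c by (simp_all add: \<rho>_def)
  obtain N where N: "\<And>n. n \<ge> N \<Longrightarrow> piece_dist p' (p (s n)) < \<rho>"
  proof -
    obtain N where "\<forall>n\<ge>N. piece_dist ((p \<circ> s) n) p' < \<rho>"
      using lim \<rho>(1) unfolding M.limitin_metric eventually_sequentially by blast
    then show ?thesis using that[of N] M.commute by auto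
  qed
  define u where "u n = s (n + N)" for n
  have u: "strict_mono u" using s by (simp add: u_def strict_mono_def)
  have near: "piece_dist p' (p (u n)) < \<rho>" for n using N[of "n + N"] by (simp add: u_def)
  note pd = piece_dist_lessD[OF near geo(1)[OF p'] geo(1)[OF pP] geo(2)[OF p'] geo(2)[OF pP]]
  have ball_p: "ball c \<rho> \<subseteq> fst (p (u n))" for n
    by (rule convex_contains_ball_if_near[OF \<rho>(2) pd(1) geo(3)[OF pP]
          compact_imp_closed[OF geo(1)[OF pP]] \<rho>(1)])
  obtain K where K: "\<forall>a\<in>fst p'. norm a \<le> K"
    using compact_imp_bounded[OF geo(1)[OF p']] bounded_iff by blast
  have "y (u n) \<in> cball 0 (K + \<rho> + R + norm x)" for n
  proof -
    obtain b where b: "b \<in> fst (p (u n))" "dist x (b - y (u n)) < R"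
      using meet[of "u n"] unfolding t_eq by auto
    obtain a where a: "a \<in> fst p'" "dist a b < \<rho>" using pd(2) b(1) by blast
    have "norm b \<le> norm a + dist a b"
      using norm_triangle_ineq2[of b a] by (simp add: dist_norm norm_minus_commute)
    moreover have "norm (y (u n)) \<le> norm b + norm (b - y (u n))"
      using norm_triangle_ineq4[of b "b - y (u n)"] by simp
    moreover have "norm (b - y (u n)) \<le> norm x + dist x (b - y (u n))"
      using norm_triangle_ineq2[of "b - y (u n)" x] by (simp add: dist_norm norm_minus_commute)
    ultimately show ?thesis using K a b(2) by fastforce
  qed
  then obtain l v where v: "strict_mono v" "((\<lambda>n. y (u n)) \<circ> v) \<longlonglongrightarrow> l"
    using compact_cball[of "0::'a" "K + \<rho> + R + norm x"] unfolding compact_def by metis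
  have "\<rho>/2 > 0" using \<rho>(1) by simp
  then obtain m where m: "\<And>n. n \<ge> m \<Longrightarrow> dist (y (u (v n))) l < \<rho>/2"
    using v(2) unfolding lim_sequentially comp_def by blast
  have interior: "c - l \<in> interior (fst (t (u (v n))))" if n: "n \<ge> m" for n
    unfolding mem_interior
  proof (intro exI[of _ "\<rho>/2"] conjI subsetI)
    fix z assume z: "z \<in> ball (c - l) (\<rho>/2)"
    let ?y = "y (u (v n))"
    have "c - (z + ?y) = (c - l - z) - (?y - l)" by simp
    then have "norm (c - (z + ?y)) \<le> norm (c - l - z) + norm (?y - l)" using norm_triangle_ineq4 by metis
    then have "z + ?y \<in> ball c \<rho>" using z m[OF n] by (simp add: dist_norm)
    then have "z + ?y \<in> fst (p (u (v n)))" using ball_p by blast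
    then show "z \<in> fst (t (u (v n)))" unfolding t_eq by (auto intro!: image_eqI[of _ _ "z + ?y"])
  qed (use \<rho>(1) in simp)
  have "u (v m) \<noteq> u (v (Suc m))" using u v(1) by (simp add: strict_mono_eq)
  then have ne: "t (u (v m)) \<noteq> t (u (v (Suc m)))" using t(1) by (simp add: inj_eq)
  have "c - l \<in> fst (t (u (v m))) \<inter> fst (t (u (v (Suc m))))"
    using interior[of m] interior[of "Suc m"] interior_subset by fastforce
  moreover have "fst (t (u (v m))) \<inter> fst (t (u (v (Suc m)))) \<subseteq> frontier (fst (t (u (v m))))"
    using T ne tT unfolding tiling_def pairwise_def by blast
  ultimately have "c - l \<in> frontier (fst (t (u (v m))))" by blast
  then show False using interior[of m] by (simp add: frontier_def)
qed

lemma flc_space_if_tiling_space: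
  fixes \<Omega> :: "('a::euclidean_space, 'l::metric_space) pattern set"
  assumes \<Omega>: "tiling_space \<Omega>" and more: "minimal_space \<Omega>" "aperiodic_space \<Omega>" "FLC \<Omega>"
  shows "flc_space \<Omega>"
  using \<Omega> unfolding tiling_space_def
proof
  assume \<Omega>: "space_of_tilings \<Omega>"
  then obtain P where P: "compactin (Metric_space.mtopology (Collect tile) piece_dist) P"
      "\<forall>T\<in>\<Omega>. \<forall>t\<in>T. \<exists>p\<in>P. \<exists>x. t = shift_piece x p"
    unfolding space_of_tilings_def by (elim exE conjE) (rule that)
  have til: "tiling T" if "T \<in> \<Omega>" for T using \<Omega> that by (simp add: space_of_tilings_def)
  have tile: "tile t" if "T \<in> \<Omega>" "t \<in> T" for T t using til that unfolding tiling_def by blast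
  show ?thesis
  proof
    fix T assume T: "T \<in> \<Omega>"
    show "T \<noteq> {}" using til[OF T] unfolding tiling_def by auto
    show "finite (patch T x R)" for x R
      by (rule tiling_finite_patch[OF til[OF T] P(1)]) (use P(2) T in blast)
    show "T \<ominus> x \<in> \<Omega>" for x using \<Omega> T by (simp add: space_of_tilings_def)
    fix t assume "t \<in> T"
    then have "tile t" using tile T by blast
    then show "compact (fst t)" "fst t \<noteq> {}" unfolding tile_def by (auto simp: polytope_imp_compact)
  next
    show "compact_space (pattern_topology \<Omega>)" using \<Omega> by (simp add: space_of_tilings_def)
  qed (fact more)+
next
  assume \<Omega>: "space_of_delone_sets \<Omega>"
  have del: "delone T" if "T \<in> \<Omega>" for T using \<Omega> that by (simp add: space_of_delone_sets_def)
  show ?thesis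
  proof
    fix T assume T: "T \<in> \<Omega>"
    show "T \<noteq> {}" using del[OF T] unfolding delone_def by auto
    show "finite (patch T x R)" for x R by (rule delone_finite_patch[OF del[OF T]])
    show "T \<ominus> x \<in> \<Omega>" for x using \<Omega> T by (simp add: space_of_delone_sets_def)
    fix t assume "t \<in> T"
    then obtain x where "fst t = {x}" using del[OF T] unfolding delone_def by blast
    then show "compact (fst t)" "fst t \<noteq> {}" by simp_all
  next
    show "compact_space (pattern_topology \<Omega>)" using \<Omega> by (simp add: space_of_delone_sets_def)
  qed (fact more)+
qed

section \<open>Comparing two homeomorphisms with the same class\<close>

lemma (in flc_space) displacement_of_splitting:
  assumes h: "continuous_map Z X h"
    and var: "same_variation Z (flow_boxes \<Omega>) (\<lambda>u. {x \<in> topspace Z. h x \<in> flow_box u})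
        (\<lambda>u x. flow_box_function shape_cocycle u (h x)) K W F"
    and k: "k \<in> K" and x: "x \<in> topspace Z" "x \<in> W k" and d: "d > 0"
  shows "\<exists>N. openin Z N \<and> x \<in> N \<and> N \<subseteq> W k \<and>
    (\<forall>y\<in>N. \<exists>z. norm z < d \<and> agree R (h y \<ominus> z) (h x) \<and> F k y = F k x - z)"
proof -
  let ?c = "flow_box_function shape_cocycle"
  have hx: "h x \<in> \<Omega>" using h x(1) by (auto simp: continuous_map_def)
  then obtain u where u: "u \<in> flow_boxes \<Omega>" "h x \<in> flow_box u" using flow_box_exists by blast
  obtain R1 d1 where 1: "R1 > 0" "d1 > 0" "\<forall>T'\<in>\<Omega>. \<forall>z. norm z < d1 \<longrightarrow> agree R1 (T' \<ominus> z) (h x) \<longrightarrow>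
      T' \<in> flow_box u \<and> ?c u T' = ?c u (h x) - z"
    using flow_box_function_displacement[OF u] by (elim exE conjE) (rule that)
  have "x \<in> {x \<in> topspace Z. h x \<in> flow_box u}" using x(1) u(2) by simp
  then obtain N where N: "openin Z N" "x \<in> N" "N \<subseteq> {x \<in> topspace Z. h x \<in> flow_box u}" "N \<subseteq> W k"
      "\<forall>y\<in>N. ?c u (h y) - F k y = ?c u (h x) - F k x"
    by (rule same_variationD[OF var u(1) k _ x(2)])
  let ?R = "max R R1" and ?d = "min d d1"
  have Rd: "?R > 0" "?d > 0" using 1 d by simp_all
  obtain M where M: "openin Z M" "x \<in> M" "\<forall>y\<in>M. h y \<in> cylinder (h x) ?R ?d"
    using h[unfolded continuous_map_into_iff, THEN conjunct2, rule_format, OF x(1) Rd]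
    by (elim exE conjE) (rule that)
  have "\<exists>z. norm z < d \<and> agree R (h y \<ominus> z) (h x) \<and> F k y = F k x - z" if y: "y \<in> N" "y \<in> M" for y
  proof -
    obtain z where z: "h y \<in> \<Omega>" "norm z < ?d" "agree ?R (h y \<ominus> z) (h x)"
      using M(3) y(2) unfolding cylinder_def by blast
    have ag: "agree R (h y \<ominus> z) (h x)" "agree R1 (h y \<ominus> z) (h x)" by (rule agree_mono[OF z(3)], simp)+
    have "?c u (h y) = ?c u (h x) - z" using 1(3) z(1,2) ag(2) by simp
    moreover have "?c u (h y) - F k y = ?c u (h x) - F k x" using N(5) y(1) by blast
    then have "F k y = ?c u (h y) - (?c u (h x) - F k x)" by (simp add: algebra_simps)
    ultimately have "F k y = F k x - z" by simp
    then show ?thesis using ag(1) z(2) by auto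
  qed
  moreover have "openin Z (N \<inter> M)" using N(1) M(1) by (rule openin_Int)
  ultimately show ?thesis using N(2,4) M(2) by (intro exI[of _ "N \<inter> M"]) auto
qed

text \<open>
  The common value of the two classes contains a cocycle, which inherits a splitting from either
  side; \<open>s\<close> is the difference of the two splittings, which does not depend on the member of the
  cover. The splittings vary like the coordinates of \<open>h1 x\<close> and \<open>h2 x\<close> in flow boxes, so \<open>s\<close> varies
  like the difference of the displacements of \<open>h1 x\<close> and \<open>h2 x\<close>.
\<close>

lemma common_displacement:
  fixes \<Omega>1 :: "('a::euclidean_space, 'l1::metric_space) pattern set"
    and \<Omega>2 :: "('a, 'l2::metric_space) pattern set"
    and Z :: "'z topology"
  assumes 1: "flc_space \<Omega>1" and 2: "flc_space \<Omega>2"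
    and h1: "continuous_map Z (pattern_topology \<Omega>1) h1"
    and h2: "continuous_map Z (pattern_topology \<Omega>2) h2"
    and eq: "cech_pullback Z h1 (shape_class \<Omega>1) = cech_pullback Z h2 (shape_class \<Omega>2)"
  shows "\<exists>s :: 'z \<Rightarrow> 'a. \<forall>x\<in>topspace Z. \<forall>R1 R2 d. d > 0 \<longrightarrow> (\<exists>N. openin Z N \<and> x \<in> N \<and>
    (\<forall>y\<in>N. \<exists>z1 z2. norm z1 < d \<and> norm z2 < d \<and> agree R1 (h1 y \<ominus> z1) (h1 x) \<and>
       agree R2 (h2 y \<ominus> z2) (h2 x) \<and> s y - s x = z2 - z1))"
proof -
  interpret A1: flc_space \<Omega>1 by (rule 1)
  interpret A2: flc_space \<Omega>2 by (rule 2)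
  obtain c where c: "c \<in> cech_pullback Z h1 (shape_class \<Omega>1)"
    using A1.shape_pullback_nonempty[OF h1] by blast
  obtain K W \<gamma> where c_eq: "c = (K, W, \<gamma>)" by (cases c)
  have c1: "(K, W, \<gamma>) \<in> cech_pullback Z h1 (shape_class \<Omega>1)" using c unfolding c_eq .
  have c2: "(K, W, \<gamma>) \<in> cech_pullback Z h2 (shape_class \<Omega>2)" using c1 unfolding eq .
  have cover: "(\<Union>k\<in>K. W k) = topspace Z" using A1.shape_pullback_splitting(1)[OF h1 c1] by simp
  obtain F1 where F1: "splitting K W \<gamma> F1"
      and var1: "same_variation Z (flow_boxes \<Omega>1) (\<lambda>u. {x \<in> topspace Z. h1 x \<in> flow_box u})
        (\<lambda>u x. flow_box_function shape_cocycle u (h1 x)) K W F1"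
    using A1.shape_pullback_splitting(2)[OF h1 c1] by (elim exE conjE) (rule that)
  obtain F2 where F2: "splitting K W \<gamma> F2"
      and var2: "same_variation Z (flow_boxes \<Omega>2) (\<lambda>u. {x \<in> topspace Z. h2 x \<in> flow_box u})
        (\<lambda>u x. flow_box_function shape_cocycle u (h2 x)) K W F2"
    using A2.shape_pullback_splitting(2)[OF h2 c2] by (elim exE conjE) (rule that)
  have "\<forall>x\<in>topspace Z. \<exists>k. k \<in> K \<and> x \<in> W k" using cover by blast
  from this[unfolded bchoice_iff] obtain \<kappa> where \<kappa>: "\<forall>x\<in>topspace Z. \<kappa> x \<in> K \<and> x \<in> W (\<kappa> x)" ..
  define s where "s x = F1 (\<kappa> x) x - F2 (\<kappa> x) x" for x
  have s_eq: "s x = F1 k x - F2 k x" if k: "k \<in> K" "x \<in> W k" for k x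
  proof -
    have "x \<in> topspace Z" using cover k by blast
    then have "\<kappa> x \<in> K" "x \<in> W (\<kappa> x) \<inter> W k" using \<kappa> k(2) by blast+
    then have "F1 (\<kappa> x) x - F1 k x = \<gamma> (\<kappa> x) k x" "F2 (\<kappa> x) x - F2 k x = \<gamma> (\<kappa> x) k x"
      using F1 F2 k(1) unfolding splitting_def by blast+
    then have "F1 (\<kappa> x) x - F1 k x = F2 (\<kappa> x) x - F2 k x" by simp
    then show ?thesis unfolding s_def by (simp add: algebra_simps)
  qed
  have "\<exists>N. openin Z N \<and> x \<in> N \<and>
    (\<forall>y\<in>N. \<exists>z1 z2. norm z1 < d \<and> norm z2 < d \<and> agree R1 (h1 y \<ominus> z1) (h1 x) \<and>
       agree R2 (h2 y \<ominus> z2) (h2 x) \<and> s y - s x = z2 - z1)"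
    if x: "x \<in> topspace Z" and d: "d > 0" for x R1 R2 d
  proof -
    have k: "\<kappa> x \<in> K" "x \<in> W (\<kappa> x)" using \<kappa> x by blast+
    obtain N1 where N1: "openin Z N1" "x \<in> N1" "N1 \<subseteq> W (\<kappa> x)"
        "\<forall>y\<in>N1. \<exists>z. norm z < d \<and> agree R1 (h1 y \<ominus> z) (h1 x) \<and> F1 (\<kappa> x) y = F1 (\<kappa> x) x - z"
      using A1.displacement_of_splitting[OF h1 var1 k(1) x k(2) d, of R1] by (elim exE conjE) (rule that)
    obtain N2 where N2: "openin Z N2" "x \<in> N2" "N2 \<subseteq> W (\<kappa> x)"
        "\<forall>y\<in>N2. \<exists>z. norm z < d \<and> agree R2 (h2 y \<ominus> z) (h2 x) \<and> F2 (\<kappa> x) y = F2 (\<kappa> x) x - z"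
      using A2.displacement_of_splitting[OF h2 var2 k(1) x k(2) d, of R2] by (elim exE conjE) (rule that)
    have "\<exists>z1 z2. norm z1 < d \<and> norm z2 < d \<and> agree R1 (h1 y \<ominus> z1) (h1 x) \<and>
       agree R2 (h2 y \<ominus> z2) (h2 x) \<and> s y - s x = z2 - z1" if y: "y \<in> N1" "y \<in> N2" for y
    proof -
      obtain z1 where z1: "norm z1 < d" "agree R1 (h1 y \<ominus> z1) (h1 x)" "F1 (\<kappa> x) y = F1 (\<kappa> x) x - z1"
        using N1(4) y(1) by blast
      obtain z2 where z2: "norm z2 < d" "agree R2 (h2 y \<ominus> z2) (h2 x)" "F2 (\<kappa> x) y = F2 (\<kappa> x) x - z2"
        using N2(4) y(2) by blast
      have "y \<in> W (\<kappa> x)" using N1(3) y(1) by blast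
      then have "s y - s x = (F1 (\<kappa> x) y - F2 (\<kappa> x) y) - (F1 (\<kappa> x) x - F2 (\<kappa> x) x)"
        by (simp only: s_eq[OF k] s_eq[OF k(1)])
      then have "s y - s x = z2 - z1" unfolding z1(3) z2(3) by simp
      then show ?thesis using z1 z2 by blast
    qed
    moreover have "openin Z (N1 \<inter> N2)" using N1(1) N2(1) by (rule openin_Int)
    ultimately show ?thesis using N1(2) N2(2) by (intro exI[of _ "N1 \<inter> N2"]) auto
  qed
  then show ?thesis by blast
qed

lemma (in flc_space) quasi_translation_translate:
  assumes s: "continuous_map X euclidean s"
  shows "quasi_translation \<Omega> (\<lambda>T. T \<ominus> s T)"
  unfolding quasi_translation_def
proof (subst homotopic_with_sym, simp only: homotopic_with_def, intro exI conjI allI ballI)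
  let ?Z = "prod_topology (top_of_set {0..1::real}) X"
  let ?H = "\<lambda>p. snd p \<ominus> (fst p *\<^sub>R s (snd p))"
  have 1: "continuous_map ?Z X snd" by (rule continuous_map_snd)
  have 2: "continuous_map ?Z euclidean (\<lambda>p. s (snd p))"
    using continuous_map_compose[OF 1 s] by (simp add: comp_def)
  have 3: "continuous_map ?Z euclidean fst"
    using continuous_map_fst continuous_map_into_fulltopology by blast
  show "continuous_map ?Z X ?H" by (intro continuous_map_translate continuous_map_scaleR 1 2 3)
qed simp_all

theorem theorem1p3:
  fixes \<Omega> :: "('a::euclidean_space, 'l::metric_space) pattern set"
    and \<Omega>\<^sub>1 :: "('a, 'l1::metric_space) pattern set"
    and \<Omega>\<^sub>2 :: "('a, 'l2::metric_space) pattern set"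
    and h\<^sub>1 :: "('a, 'l) pattern \<Rightarrow> ('a, 'l1) pattern"
    and h\<^sub>2 :: "('a, 'l) pattern \<Rightarrow> ('a, 'l2) pattern"
  assumes "tiling_space \<Omega>" "minimal_space \<Omega>" "aperiodic_space \<Omega>" "FLC \<Omega>"
    and "tiling_space \<Omega>\<^sub>1" "minimal_space \<Omega>\<^sub>1" "aperiodic_space \<Omega>\<^sub>1" "FLC \<Omega>\<^sub>1"
    and "tiling_space \<Omega>\<^sub>2" "minimal_space \<Omega>\<^sub>2" "aperiodic_space \<Omega>\<^sub>2" "FLC \<Omega>\<^sub>2"
    and "homeomorphic_map (pattern_topology \<Omega>) (pattern_topology \<Omega>\<^sub>1) h\<^sub>1"
    and "homeomorphic_map (pattern_topology \<Omega>) (pattern_topology \<Omega>\<^sub>2) h\<^sub>2"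
    and "homeo_class \<Omega> \<Omega>\<^sub>1 h\<^sub>1 = homeo_class \<Omega> \<Omega>\<^sub>2 h\<^sub>2"
  shows "\<exists>(s :: ('a, 'l) pattern \<Rightarrow> 'a) (\<phi> :: ('a, 'l1) pattern \<Rightarrow> ('a, 'l2) pattern).
           continuous_map (pattern_topology \<Omega>) euclidean s \<and>
           quasi_translation \<Omega> (\<lambda>T. T \<ominus> s T) \<and>
           MLD_equivalence \<Omega>\<^sub>1 \<Omega>\<^sub>2 \<phi> \<and>
           (\<forall>T\<in>\<Omega>. h\<^sub>2 (T \<ominus> s T) = \<phi> (h\<^sub>1 T))"
proof -
  interpret A: flc_space \<Omega> using assms(1-4) by (rule flc_space_if_tiling_space)
  interpret A1: flc_space \<Omega>\<^sub>1 using assms(5-8) by (rule flc_space_if_tiling_space)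
  interpret A2: flc_space \<Omega>\<^sub>2 using assms(9-12) by (rule flc_space_if_tiling_space)
  obtain g\<^sub>1 where "homeomorphic_maps A.X A1.X h\<^sub>1 g\<^sub>1" using assms(13) homeomorphic_map_maps by blast
  then have h1: "continuous_map A.X A1.X h\<^sub>1" and g1: "continuous_map A1.X A.X g\<^sub>1"
    and g1h1: "\<And>T. T \<in> \<Omega> \<Longrightarrow> g\<^sub>1 (h\<^sub>1 T) = T" and h1g1: "\<And>S. S \<in> \<Omega>\<^sub>1 \<Longrightarrow> h\<^sub>1 (g\<^sub>1 S) = S"
    by (simp_all add: homeomorphic_maps_def)
  obtain g\<^sub>2 where "homeomorphic_maps A.X A2.X h\<^sub>2 g\<^sub>2" using assms(14) homeomorphic_map_maps by blast
  then have h2: "continuous_map A.X A2.X h\<^sub>2" and g2: "continuous_map A2.X A.X g\<^sub>2"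
    and g2h2: "\<And>T. T \<in> \<Omega> \<Longrightarrow> g\<^sub>2 (h\<^sub>2 T) = T" and h2g2: "\<And>S. S \<in> \<Omega>\<^sub>2 \<Longrightarrow> h\<^sub>2 (g\<^sub>2 S) = S"
    by (simp_all add: homeomorphic_maps_def)
  have h1_maps: "h\<^sub>1 T \<in> \<Omega>\<^sub>1" and h2_maps: "h\<^sub>2 T \<in> \<Omega>\<^sub>2" if "T \<in> \<Omega>" for T
    using h1 h2 that by (auto simp: continuous_map_def)
  have g1_maps: "g\<^sub>1 S \<in> \<Omega>" if "S \<in> \<Omega>\<^sub>1" for S using g1 that by (auto simp: continuous_map_def)
  obtain s where s: "\<forall>T\<in>topspace A.X. \<forall>R1 R2 d. d > 0 \<longrightarrow> (\<exists>N. openin A.X N \<and> T \<in> N \<and>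
    (\<forall>T'\<in>N. \<exists>z1 z2. norm z1 < d \<and> norm z2 < d \<and> agree R1 (h\<^sub>1 T' \<ominus> z1) (h\<^sub>1 T) \<and>
       agree R2 (h\<^sub>2 T' \<ominus> z2) (h\<^sub>2 T) \<and> s T' - s T = z2 - z1))"
    using common_displacement[OF A1.flc_space_axioms A2.flc_space_axioms h1 h2
      assms(15)[unfolded homeo_class_def]] ..
  have near: "\<exists>N. openin A.X N \<and> T \<in> N \<and>
    (\<forall>T'\<in>N. \<exists>z1 z2. norm z1 < d \<and> norm z2 < d \<and> agree R1 (h\<^sub>1 T' \<ominus> z1) (h\<^sub>1 T) \<and>
       agree R2 (h\<^sub>2 T' \<ominus> z2) (h\<^sub>2 T) \<and> s T' - s T = z2 - z1)"
    if "T \<in> \<Omega>" "d > 0" for T R1 R2 d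
    using s[unfolded topspace_pattern_topology, rule_format, OF that, of R1 R2] .
  have s_cont: "continuous_map A.X euclidean s"
  proof (rule continuous_map_into_metric)
    fix T and \<epsilon> :: real assume T: "T \<in> topspace A.X" and \<epsilon>: "\<epsilon> > 0"
    have T\<Omega>: "T \<in> \<Omega>" and e: "\<epsilon>/2 > 0" using T \<epsilon> by simp_all
    obtain N where N: "openin A.X N" "T \<in> N"
        "\<forall>T'\<in>N. \<exists>z1 z2. norm z1 < \<epsilon>/2 \<and> norm z2 < \<epsilon>/2 \<and> agree 0 (h\<^sub>1 T' \<ominus> z1) (h\<^sub>1 T) \<and>
           agree 0 (h\<^sub>2 T' \<ominus> z2) (h\<^sub>2 T) \<and> s T' - s T = z2 - z1"
      using near[OF T\<Omega> e, of 0 0] by (elim exE conjE) (rule that)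
    have "dist (s T') (s T) < \<epsilon>" if T': "T' \<in> N" for T'
    proof -
      obtain z1 z2 where z: "norm z1 < \<epsilon>/2" "norm z2 < \<epsilon>/2" "s T' - s T = z2 - z1"
        using N(3) T' by blast
      then show ?thesis unfolding dist_norm using norm_triangle_ineq4[of z2 z1] by simp
    qed
    then show "\<exists>N. openin A.X N \<and> T \<in> N \<and> (\<forall>T'\<in>N. dist (s T') (s T) < \<epsilon>)" using N(1,2) by blast
  qed
  \<comment> \<open>After this correction the images move like those under \<open>h\<^sub>1\<close>.\<close>
  define k where "k T = h\<^sub>2 T \<ominus> s T" for T
  define \<phi> where "\<phi> S = k (g\<^sub>1 S)" for S
  have k_maps: "k T \<in> \<Omega>\<^sub>2" if "T \<in> \<Omega>" for T
    unfolding k_def by (intro A2.translate_closed h2_maps that)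
  have "displacement_preserving \<Omega>\<^sub>1 \<phi>"
    unfolding displacement_preserving_def
  proof (intro ballI allI impI)
    fix S and R R' d :: real assume S: "S \<in> \<Omega>\<^sub>1" and d: "d > 0"
    let ?T = "g\<^sub>1 S"
    obtain N where N: "openin A.X N" "?T \<in> N"
        "\<forall>T'\<in>N. \<exists>z1 z2. norm z1 < d \<and> norm z2 < d \<and> agree R (h\<^sub>1 T' \<ominus> z1) (h\<^sub>1 ?T) \<and>
           agree (R' + norm (s ?T)) (h\<^sub>2 T' \<ominus> z2) (h\<^sub>2 ?T) \<and> s T' - s ?T = z2 - z1"
      using near[OF g1_maps[OF S] d, of R "R' + norm (s ?T)"] by (elim exE conjE) (rule that)
    let ?N = "{S \<in> topspace A1.X. g\<^sub>1 S \<in> N}"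
    have "\<exists>z. norm z < d \<and> agree R (S' \<ominus> z) S \<and> agree R' (\<phi> S' \<ominus> z) (\<phi> S)" if S': "S' \<in> ?N" for S'
    proof -
      have S'1: "S' \<in> \<Omega>\<^sub>1" and T'N: "g\<^sub>1 S' \<in> N" using S' by simp_all
      obtain z1 z2 where z: "norm z1 < d" "agree R (h\<^sub>1 (g\<^sub>1 S') \<ominus> z1) (h\<^sub>1 ?T)"
          "agree (R' + norm (s ?T)) (h\<^sub>2 (g\<^sub>1 S') \<ominus> z2) (h\<^sub>2 ?T)" "s (g\<^sub>1 S') - s ?T = z2 - z1"
        using N(3)[rule_format, OF T'N] by (elim exE conjE) (rule that)
      have "agree R' (h\<^sub>2 (g\<^sub>1 S') \<ominus> z2 \<ominus> s ?T) (h\<^sub>2 ?T \<ominus> s ?T)"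
        by (rule agree_translate[OF z(3)]) simp
      moreover have "z2 + s ?T = s (g\<^sub>1 S') + z1" using z(4) by (simp add: algebra_simps)
      ultimately have "agree R' (\<phi> S' \<ominus> z1) (\<phi> S)" by (simp add: \<phi>_def k_def)
      moreover have "agree R (S' \<ominus> z1) S" using z(2) h1g1 S S'1 by simp
      ultimately show ?thesis using z(1) by blast
    qed
    moreover have "openin A1.X ?N" using g1 N(1) by (rule openin_continuous_map_preimage)
    moreover have "S \<in> ?N" using S N(2) by simp
    ultimately show "\<exists>N. openin A1.X N \<and> S \<in> N \<and>
        (\<forall>S'\<in>N. \<exists>z. norm z < d \<and> agree R (S' \<ominus> z) S \<and> agree R' (\<phi> S' \<ominus> z) (\<phi> S))"
      by (intro exI[of _ ?N] conjI ballI)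
  qed
  then interpret D: displacement_map \<Omega>\<^sub>1 \<Omega>\<^sub>2 \<phi>
    by unfold_locales (use k_maps g1_maps in \<open>simp_all add: \<phi>_def\<close>)
  interpret G: continuous_pair \<Omega>\<^sub>2 \<Omega> g\<^sub>2 by unfold_locales (rule g2)
  interpret H: continuous_pair \<Omega> \<Omega>\<^sub>1 h\<^sub>1 by unfold_locales (rule h1)
  \<comment> \<open>The correction takes place in \<open>\<Omega>\<^sub>2\<close> and is lifted to \<open>\<Omega>\<close> through the inverse of \<open>h\<^sub>2\<close>.\<close>
  obtain \<sigma> where \<sigma>: "continuous_map A.X euclidean \<sigma>"
      and "\<forall>T\<in>topspace A.X. g\<^sub>2 (h\<^sub>2 T \<ominus> s T) = g\<^sub>2 (h\<^sub>2 T) \<ominus> \<sigma> T"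
    using G.continuous_lift[OF h2 s_cont A.compact] by (elim exE conjE) (rule that)
  then have g2k: "g\<^sub>2 (k T) = T \<ominus> \<sigma> T" if "T \<in> \<Omega>" for T
    using that g2h2 by (simp add: k_def)
  have factor: "h\<^sub>2 (T \<ominus> \<sigma> T) = \<phi> (h\<^sub>1 T)" if T: "T \<in> \<Omega>" for T
    using h2g2[OF k_maps[OF T]] g2k[OF T] g1h1[OF T] by (simp add: \<phi>_def)
  \<comment> \<open>Two points with the same image lie on one orbit, where \<open>\<phi>\<close> is injective by equivariance and
    aperiodicity.\<close>
  have "inj_on \<phi> \<Omega>\<^sub>1"
  proof (rule inj_onI)
    fix S S' assume S: "S \<in> \<Omega>\<^sub>1" and S': "S' \<in> \<Omega>\<^sub>1" and eq: "\<phi> S = \<phi> S'"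
    let ?T = "g\<^sub>1 S" and ?T' = "g\<^sub>1 S'"
    have "?T \<ominus> \<sigma> ?T = ?T' \<ominus> \<sigma> ?T'"
      using eq g2k[OF g1_maps[OF S]] g2k[OF g1_maps[OF S']] by (simp add: \<phi>_def)
    then have "?T' \<ominus> \<sigma> ?T' \<ominus> (- \<sigma> ?T') = ?T \<ominus> \<sigma> ?T \<ominus> (- \<sigma> ?T')" by simp
    then have "?T' = ?T \<ominus> (\<sigma> ?T - \<sigma> ?T')" by simp
    then obtain w where w: "S' = S \<ominus> w"
      using H.lift[OF g1_maps[OF S], of "\<sigma> ?T - \<sigma> ?T'"] h1g1[OF S] h1g1[OF S'] by auto
    then have "\<phi> S \<ominus> w = \<phi> S" using D.equivariant[OF S, of w] eq by simp
    then have "w = 0" using A2.aperiodic D.maps_to[OF S] unfolding aperiodic_space_def by blast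
    then show "S = S'" using w by simp
  qed
  moreover have "\<Omega>\<^sub>2 = {}" if "\<Omega>\<^sub>1 = {}"
    using that h1_maps G.g_maps by blast
  ultimately have "MLD_equivalence \<Omega>\<^sub>1 \<Omega>\<^sub>2 \<phi>" by (intro D.MLD)
  then show ?thesis
    using \<sigma> A.quasi_translation_translate[OF \<sigma>] factor
    by (intro exI[of _ \<sigma>] exI[of _ \<phi>]) simp
qed


end
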